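(* Suppose the Markov chain $\Xi$ on $\mathbb X\subseteq\mathbb R$ satisfies (N$'$), $(\mathrm T^{\mathrm{out}}_{\alpha,\beta,c})$ and $(\mathrm D'_{\gamma,b})$. Then: (i) if $\gamma>\alpha-1$, $\Xi$ is null recurrent; (ii) if $\gamma<\alpha-1$ and $b<0$, $\Xi$ is positive recurrent; (iii) if $\gamma<\alpha-1$ and $b>0$, $\Xi$ is directional transient; (iv) if $\gamma=\alpha-1$ and $b<c\pi|\csc(\pi\alpha)|$, $\Xi$ is null recurrent; (v) if $\gamma=\alpha-1$ and $b>c\pi|\csc(\pi\alpha)|$, $\Xi$ is directional transient.
   Context: $\Xi=(\xi_n)_{n\ge0}$ is a time-homogeneous Markov chain on an infinite, unbounded, measurable $\mathbb X\subseteq\mathbb R$. $\mathbb P_x,\mathbb E_x$ refer to the chain started at $x$; $\theta:=\xi_1-\xi_0$; $y_+:=y\mathbf 1\{y\ge0\}$, $y_-:=-y\mathbf 1\{y<0\}$; $\mu(x):=\mathbb E_x[\theta]$; $\tau_a:=\min\{n\ge0:|\xi_n|\le a\}$. $\Xi$ is transient if $|\xi_n|\to\infty$ a.s.; recurrent if $\liminf_n|\xi_n|\le r_0$ a.s. for some deterministic $r_0$; positive recurrent if $\mathbb E_x[\tau_a]<\infty$ for all large $a$ and all $x$; null recurrent if recurrent and $\mathbb E_x[\tau_a]=\infty$ for all large $a$ and all $|x|>a$; directional transient if $\lim_n\xi_n\in\{-\infty,+\infty\}$ a.s. (N$'$): $\limsup_n|\xi_n|=+\infty$ a.s. $(\mathrm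 T^{\mathrm{out}}_{\alpha,\beta,c})$: there exist $\alpha\in(1,2)$, $\beta>\alpha$, $c>0$, $x_0\in\mathbb R_+$ with $\lim_{y\to\infty}\sup_{x\ge x_0}|y^\alpha\mathbb P_x[\theta_+>y]-c|=\lim_{y\to\infty}\sup_{x\le -x_0}|y^\alpha\mathbb P_x[\theta_->y]-c|=0$, $\sup_{x\ge x_0}\mathbb E_x[\theta_-^\beta]<\infty$, and $\sup_{x\le-x_0}\mathbb E_x[\theta_+^\beta]<\infty$. $(\mathrm D'_{\gamma,b})$: there exist $\gamma\ge0$, $b\in\mathbb R$ with $\lim_{x\to+\infty}x^\gamma\mu(x)=\lim_{x\to-\infty}(-|x|^\gamma\mu(x))=b$. *)

theory Defs
  imports "HOL-Probability.Probability"
begin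

text \<open>Finite-dimensional distributions of a chain with transition kernel K:
  kseq K [A0,...,An] x = P_x(xi_0 in A0, ..., xi_n in An).\<close>
primrec kseq :: "(real \<Rightarrow> real measure) \<Rightarrow> real set list \<Rightarrow> real \<Rightarrow> ennreal" where
  "kseq K [] x = 1"
| "kseq K (A # As) x = indicator A x * (\<integral>\<^sup>+ y. kseq K As y \<partial>K x)"

definition markov_chain ::
  "real set \<Rightarrow> (real \<Rightarrow> real measure) \<Rightarrow> (real \<Rightarrow> real stream measure) \<Rightarrow> bool" where
  "markov_chain X K M \<longleftrightarrow>
     X \<in> sets borel \<and> infinite X \<and> \<not> bounded X \<and>
     K \<in> borel \<rightarrow>\<^sub>M prob_algebra borel \<and>
     (\<forall>x\<in>X. emeasure (K x) X = 1) \<and>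
     (\<forall>x\<in>X. prob_space (M x) \<and> sets (M x) = sets (stream_space borel) \<and>
        (\<forall>As. (\<forall>A\<in>set As. A \<in> sets borel) \<longrightarrow>
           emeasure (M x) {\<omega> \<in> space (M x). \<forall>i<length As. \<omega> !! i \<in> As ! i} = kseq K As x))"

definition pos_part_r :: "real \<Rightarrow> real" where "pos_part_r y = (if y \<ge> 0 then y else 0)"
definition neg_part_r :: "real \<Rightarrow> real" where "neg_part_r y = (if y < 0 then - y else 0)"

definition theta :: "real stream \<Rightarrow> real" where "theta \<omega> = \<omega> !! 1 - \<omega> !! 0"

definition drift :: "(real \<Rightarrow> real stream measure) \<Rightarrow> real \<Rightarrow> real" where
  "drift M x = (\<integral>\<omega>. theta \<omega> \<partial>M x)"

definition hit_time :: "real \<Rightarrow> real stream \<Rightarrow> ennreal" where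
  "hit_time a \<omega> = (if \<exists>n. \<bar>\<omega> !! n\<bar> \<le> a then of_nat (LEAST n. \<bar>\<omega> !! n\<bar> \<le> a) else \<infinity>)"

definition transient_mc :: "real set \<Rightarrow> (real \<Rightarrow> real stream measure) \<Rightarrow> bool" where
  "transient_mc X M \<longleftrightarrow> (\<forall>x\<in>X. AE \<omega> in M x. filterlim (\<lambda>n. \<bar>\<omega> !! n\<bar>) at_top sequentially)"

definition recurrent_mc :: "real set \<Rightarrow> (real \<Rightarrow> real stream measure) \<Rightarrow> bool" where
  "recurrent_mc X M \<longleftrightarrow> (\<exists>r0::real. \<forall>x\<in>X. AE \<omega> in M x.
      liminf (\<lambda>n. ereal \<bar>\<omega> !! n\<bar>) \<le> ereal r0)"

definition positive_recurrent_mc :: "real set \<Rightarrow> (real \<Rightarrow> real stream measure) \<Rightarrow> bool" where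
  "positive_recurrent_mc X M \<longleftrightarrow> (\<exists>a0::real. \<forall>a\<ge>a0. \<forall>x\<in>X.
      (\<integral>\<^sup>+ \<omega>. hit_time a \<omega> \<partial>M x) < \<infinity>)"

definition null_recurrent_mc :: "real set \<Rightarrow> (real \<Rightarrow> real stream measure) \<Rightarrow> bool" where
  "null_recurrent_mc X M \<longleftrightarrow> recurrent_mc X M \<and> (\<exists>a0::real. \<forall>a\<ge>a0. \<forall>x\<in>X.
      \<bar>x\<bar> > a \<longrightarrow> (\<integral>\<^sup>+ \<omega>. hit_time a \<omega> \<partial>M x) = \<infinity>)"

definition directional_transient_mc :: "real set \<Rightarrow> (real \<Rightarrow> real stream measure) \<Rightarrow> bool" where
  "directional_transient_mc X M \<longleftrightarrow> (\<forall>x\<in>X. AE \<omega> in M x.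
      filterlim (\<lambda>n. \<omega> !! n) at_top sequentially \<or> filterlim (\<lambda>n. \<omega> !! n) at_bot sequentially)"

definition cond_N' :: "real set \<Rightarrow> (real \<Rightarrow> real stream measure) \<Rightarrow> bool" where
  "cond_N' X M \<longleftrightarrow> (\<forall>x\<in>X. AE \<omega> in M x. limsup (\<lambda>n. ereal \<bar>\<omega> !! n\<bar>) = \<infinity>)"

text \<open>Condition (T^out_{alpha,beta,c}) with witness x0; the "lim sup_x" is uniform convergence.\<close>
definition cond_T_out ::
  "real set \<Rightarrow> (real \<Rightarrow> real stream measure) \<Rightarrow> real \<Rightarrow> real \<Rightarrow> real \<Rightarrow> real \<Rightarrow> bool" where
  "cond_T_out X M \<alpha> \<beta> c x0 \<longleftrightarrow>
     1 < \<alpha> \<and> \<alpha> < 2 \<and> \<beta> > \<alpha> \<and> c > 0 \<and> x0 \<ge> 0 \<and>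
     uniform_limit {x\<in>X. x \<ge> x0}
        (\<lambda>y x. y powr \<alpha> * measure (M x) {\<omega> \<in> space (M x). pos_part_r (theta \<omega>) > y})
        (\<lambda>x. c) at_top \<and>
     uniform_limit {x\<in>X. x \<le> - x0}
        (\<lambda>y x. y powr \<alpha> * measure (M x) {\<omega> \<in> space (M x). neg_part_r (theta \<omega>) > y})
        (\<lambda>x. c) at_top \<and>
     (SUP x\<in>{x\<in>X. x \<ge> x0}. \<integral>\<^sup>+ \<omega>. ennreal (neg_part_r (theta \<omega>) powr \<beta>) \<partial>M x) < \<infinity> \<and>
     (SUP x\<in>{x\<in>X. x \<le> - x0}. \<integral>\<^sup>+ \<omega>. ennreal (pos_part_r (theta \<omega>) powr \<beta>) \<partial>M x) < \<infinity>"

definition cond_D' :: "real set \<Rightarrow> (real \<Rightarrow> real stream measure) \<Rightarrow> real \<Rightarrow> real \<Rightarrow> bool" where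
  "cond_D' X M \<gamma> b \<longleftrightarrow> \<gamma> \<ge> 0 \<and>
     ((\<lambda>x. x powr \<gamma> * drift M x) \<longlongrightarrow> b) (at_top \<sqinter> principal X) \<and>
     ((\<lambda>x. - (\<bar>x\<bar> powr \<gamma> * drift M x)) \<longlongrightarrow> b) (at_bot \<sqinter> principal X)"

end

theory Submission
  imports Defs
begin

text \<open>Write \<open>Z\<close> for the outward increment at distance \<open>t = |x|\<close> from the origin and
  \<open>\<kappa> = \<pi> |csc (\<pi> \<alpha>)|\<close>, which equals the Beta integral of \<open>u powr (1 - \<alpha>) / (1 + u)\<close> over the half-line.
  Since \<open>ln (t + Z) - ln t = Z / t - g (Z\<^sup>+ / t)\<close> on \<open>Z \<ge> 0\<close> with \<open>g u = u - ln (1 + u)\<close>, and the tail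
  condition gives \<open>E g (Z\<^sup>+ / t) \<sim> c \<kappa> t powr (- \<alpha>)\<close>, the logarithm has drift
  \<open>(t powr (\<alpha> - 1) E Z - c \<kappa>) t powr (- \<alpha>)\<close> to leading order. If this is negative, \<open>ln |x|\<close> is a
  supermartingale outside a bounded set, which together with non-confinement gives recurrence. If it is
  positive, a one-sided \<open>x powr (- \<nu>)\<close> with small \<open>\<nu>\<close> is a supermartingale far out, so the chain
  stays on one side with probability close to 1. Positive recurrence is Foster's criterion for
  \<open>|x| powr (1 + \<gamma>)\<close>. For infinite mean hitting times, truncations of \<open>|x| powr \<alpha>\<close> have drift bounded
  below, so the mean hitting time from \<open>x\<close> is at least of order \<open>|x| powr \<alpha>\<close>, which is not
  integrable after one jump.

  The measures \<open>M x\<close> need not depend measurably on \<open>x\<close>, so the Markov property enters only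
  through the finite-dimensional distributions \<open>kseq\<close>, by induction on lists.\<close>

section \<open>Finite-dimensional distributions\<close>

text \<open>The obstacle is that the outward increment has no finite moment of order \<alpha> < 2,
  so a second-order Taylor expansion has no integrable remainder. The function \<open>g\<close>,
  called \<open>log_gap\<close> below, takes its place: it is of order \<open>u\<^sup>2\<close> near
  0 and of order \<open>u\<close> at infinity, hence integrable against a tail of index between 1
  and 2. On outward jumps the remainders of the negative power and of the truncated power are
  bounded by multiples of it, so a single asymptotic evaluation serves both sides of the critical
  value and the lower bound on hitting times. Inward jumps, including those across the origin, cost
  only order \<open>t powr - \<beta>\<close>, which is smaller because \<beta> > \<alpha>.

  Only the drift exponent \<alpha> - 1 needs the sharp constant. A larger exponent is this one with
  limit 0; a smaller exponent with \<open>b > 0\<close> gives a drift that exceeds every multiple of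
  the critical scale. With \<open>b < 0\<close> the exponent \<open>1 + \<gamma>\<close> in Foster's
  criterion is the one for which the linear term tends to a negative constant.\<close>

locale real_chain =
  fixes X :: "real set" and K :: "real \<Rightarrow> real measure" and M :: "real \<Rightarrow> real stream measure"
  assumes mc: "markov_chain X K M"
begin

lemma X_sets [measurable]: "X \<in> sets borel"
  and K_measurable [measurable]: "K \<in> borel \<rightarrow>\<^sub>M prob_algebra borel"
  and K_X: "x \<in> X \<Longrightarrow> emeasure (K x) X = 1"
  and prob_M: "x \<in> X \<Longrightarrow> prob_space (M x)"
  and sets_M: "x \<in> X \<Longrightarrow> sets (M x) = sets (stream_space borel)"
  and M_cyl: "x \<in> X \<Longrightarrow> (\<And>A. A \<in> set As \<Longrightarrow> A \<in> sets borel) \<Longrightarrow>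
    emeasure (M x) {\<omega> \<in> space (M x). \<forall>i<length As. \<omega> !! i \<in> As ! i} = kseq K As x"
  using mc unfolding markov_chain_def by auto

lemma space_M: "x \<in> X \<Longrightarrow> space (M x) = UNIV"
  using sets_eq_imp_space_eq[OF sets_M] by (simp add: space_stream_space)

lemma prob_K: "prob_space (K x)" and sets_K [simp, measurable_cong]: "sets (K x) = sets borel"
  using measurable_space[OF K_measurable, of x] by (auto simp: space_prob_algebra)

lemma space_K [simp]: "space (K x) = UNIV"
  using sets_eq_imp_space_eq[OF sets_K] by simp

lemma emeasure_K_UNIV [simp]: "emeasure (K x) UNIV = 1"
  using prob_space.emeasure_space_1[OF prob_K, of x] by simp

lemma AE_K_X: assumes "x \<in> X" shows "AE y in K x. y \<in> X"
proof -
  interpret prob_space "K x" by (rule prob_K)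
  have "prob X = 1" using K_X[OF assms] by (simp add: emeasure_eq_measure)
  then show ?thesis by (subst AE_in_set_eq_1) auto
qed

lemma nn_integral_K_measurable [measurable]:
  assumes [measurable]: "f \<in> borel_measurable borel"
  shows "(\<lambda>x. \<integral>\<^sup>+ y. f y \<partial>K x) \<in> borel_measurable borel"
proof -
  have "K \<in> borel \<rightarrow>\<^sub>M subprob_algebra borel"
    by (rule measurable_prob_algebraD) measurable
  from measurable_compose[OF this nn_integral_measurable_subprob_algebra[OF assms]] show ?thesis .
qed

lemma kseq_measurable [measurable]:
  "(\<And>A. A \<in> set As \<Longrightarrow> A \<in> sets borel) \<Longrightarrow> kseq K As \<in> borel_measurable borel"
proof (induction As)
  case (Cons A As)
  have [measurable]: "A \<in> sets borel" "kseq K As \<in> borel_measurable borel" using Cons by auto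
  have "kseq K (A # As) = (\<lambda>x. indicator A x * (\<integral>\<^sup>+ y. kseq K As y \<partial>K x))" by auto
  then show ?case by simp
next
  case Nil
  have "kseq K [] = (\<lambda>x. 1)" by auto
  then show ?case by simp
qed

lemma kseq_le_1: "kseq K As x \<le> 1"
proof (induction As arbitrary: x)
  case (Cons A As)
  have "(\<integral>\<^sup>+ y. kseq K As y \<partial>K x) \<le> (\<integral>\<^sup>+ y. 1 \<partial>K x)"
    by (intro nn_integral_mono Cons)
  also have "\<dots> = 1" by (simp)
  finally show ?case by (auto simp: indicator_def)
qed simp

lemma nn_integral_K_mono:
  assumes "x \<in> X" "\<And>y. y \<in> X \<Longrightarrow> f y \<le> g y"
  shows "(\<integral>\<^sup>+ y. f y \<partial>K x) \<le> (\<integral>\<^sup>+ y. g y \<partial>K x)"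
  by (rule nn_integral_mono_AE) (use AE_K_X[OF assms(1)] assms(2) in auto)

text \<open>The Markov property at the fixed time \<open>length Bs\<close>: peeling off the prefix
  one step at a time keeps the bound, because each step is a linear monotone integral over a kernel
  that charges only \<open>X\<close>.\<close>

lemma kseq_append_mono:
  assumes "\<And>y. y \<in> X \<Longrightarrow> q * kseq K Cs y \<le> kseq K Ds y"
    "\<And>A. A \<in> set Bs \<union> set Cs \<Longrightarrow> A \<in> sets borel" "x \<in> X"
  shows "q * kseq K (Bs @ Cs) x \<le> kseq K (Bs @ Ds) x"
  using assms(2,3)
proof (induction Bs arbitrary: x)
  case (Cons B Bs)
  have [measurable]: "kseq K (Bs @ Cs) \<in> borel_measurable borel"
    by (rule kseq_measurable) (use Cons.prems in auto)
  have "q * (\<integral>\<^sup>+ y. kseq K (Bs @ Cs) y \<partial>K x) = (\<integral>\<^sup>+ y. q * kseq K (Bs @ Cs) y \<partial>K x)"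
    by (rule nn_integral_cmult[symmetric]) measurable
  also have "\<dots> \<le> (\<integral>\<^sup>+ y. kseq K (Bs @ Ds) y \<partial>K x)"
    by (rule nn_integral_K_mono[OF Cons.prems(2)]) (use Cons in auto)
  finally show ?case by (auto simp: indicator_def)
qed (use assms in simp)

section \<open>First-exit and survival sums\<close>

lemma kseq_exit:
  assumes B: "B \<in> sets borel"
  shows "(\<Sum>n<N. kseq K (replicate n B @ [- B]) x) + kseq K (replicate N B) x = 1"
proof (induction N arbitrary: x)
  case (Suc N)
  have [measurable]: "B \<in> sets borel" "\<And>n. kseq K (replicate n B @ [- B]) \<in> borel_measurable borel"
      "kseq K (replicate N B) \<in> borel_measurable borel"
    using B by (auto intro!: kseq_measurable split: if_splits)
  have "(\<Sum>n<Suc N. kseq K (replicate n B @ [- B]) x) + kseq K (replicate (Suc N) B) x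
    = indicator (- B) x + (\<Sum>n<N. indicator B x * (\<integral>\<^sup>+ y. kseq K (replicate n B @ [- B]) y \<partial>K x))
       + indicator B x * (\<integral>\<^sup>+ y. kseq K (replicate N B) y \<partial>K x)"
    by (subst sum.lessThan_Suc_shift) simp
  also have "\<dots> = indicator (- B) x + indicator B x *
      (\<integral>\<^sup>+ y. (\<Sum>n<N. kseq K (replicate n B @ [- B]) y) + kseq K (replicate N B) y \<partial>K x)"
    by (simp add: nn_integral_add nn_integral_sum sum_distrib_left distrib_left add.assoc)
  also have "\<dots> = 1"
    by (simp add: Suc indicator_def)
  finally show ?case .
qed simp

text \<open>Maximal inequality without stopping times. As \<open>B\<close> and \<open>C\<close> are
  disjoint, the summands are the probabilities that the first exit from \<open>B\<close> happens at
  time \<open>n\<close> and lands in \<open>C\<close>; conditioning on the first step replaces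
  optional stopping.\<close>

lemma supermartingale_hit:
  assumes [measurable]: "B \<in> sets borel" "C \<in> sets borel" and disj: "B \<inter> C = {}"
    and C: "\<And>x. x \<in> X \<Longrightarrow> x \<in> C \<Longrightarrow> r \<le> f x"
    and B: "\<And>x. x \<in> X \<Longrightarrow> x \<in> B \<Longrightarrow> (\<integral>\<^sup>+ y. f y \<partial>K x) \<le> f x"
    and x: "x \<in> X"
  shows "r * (\<Sum>n<N. kseq K (replicate n B @ [C]) x) \<le> f x"
  using x
proof (induction N arbitrary: x)
  case (Suc N)
  have [measurable]: "\<And>n. kseq K (replicate n B @ [C]) \<in> borel_measurable borel"
    by (rule kseq_measurable) (auto split: if_splits)
  have eq: "(\<Sum>n<Suc N. kseq K (replicate n B @ [C]) x)
    = indicator C x + indicator B x * (\<integral>\<^sup>+ y. (\<Sum>n<N. kseq K (replicate n B @ [C]) y) \<partial>K x)"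
    by (subst sum.lessThan_Suc_shift) (simp add: nn_integral_sum sum_distrib_left)
  consider "x \<in> C" "x \<notin> B" | "x \<in> B" "x \<notin> C" | "x \<notin> C" "x \<notin> B" using disj by blast
  then show ?case
  proof cases
    case 2
    have "r * (\<integral>\<^sup>+ y. (\<Sum>n<N. kseq K (replicate n B @ [C]) y) \<partial>K x)
      = (\<integral>\<^sup>+ y. r * (\<Sum>n<N. kseq K (replicate n B @ [C]) y) \<partial>K x)"
      by (rule nn_integral_cmult[symmetric]) measurable
    also have "\<dots> \<le> (\<integral>\<^sup>+ y. f y \<partial>K x)"
      by (rule nn_integral_K_mono) (use Suc in auto)
    also have "\<dots> \<le> f x" using B 2 Suc.prems by auto
    finally show ?thesis using 2 by (simp add: eq del: sum.lessThan_Suc)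
  qed (use C Suc.prems eq in \<open>auto simp del: sum.lessThan_Suc\<close>)
qed simp

text \<open>The sum is the mean of the exit time from \<open>A\<close> truncated at
  \<open>Suc N\<close>, since its term of index \<open>n\<close> is the probability of surviving
  beyond time \<open>n\<close>. One unit of time is spent in \<open>A\<close> before the restart
  from the next state.\<close>

lemma survival_sum_step:
  assumes [measurable]: "A \<in> sets borel"
  shows "(\<Sum>n<Suc N. kseq K (replicate (Suc n) A) x)
    = indicator A x * (1 + (\<integral>\<^sup>+ y. (\<Sum>n<N. kseq K (replicate (Suc n) A) y) \<partial>K x))"
proof -
  have [measurable]: "\<And>n. kseq K (replicate n A) \<in> borel_measurable borel"
    by (rule kseq_measurable) (auto split: if_splits)
  have step: "kseq K (replicate (Suc (Suc n)) A) x
      = indicator A x * (\<integral>\<^sup>+ y. kseq K (replicate (Suc n) A) y \<partial>K x)" for n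
    by simp
  have "(\<Sum>n<Suc N. kseq K (replicate (Suc n) A) x)
    = kseq K (replicate (Suc 0) A) x
      + (\<Sum>n<N. indicator A x * (\<integral>\<^sup>+ y. kseq K (replicate (Suc n) A) y \<partial>K x))"
    by (subst sum.lessThan_Suc_shift) (simp only: step)
  also have "\<dots> = indicator A x * (1 + (\<Sum>n<N. \<integral>\<^sup>+ y. kseq K (replicate (Suc n) A) y \<partial>K x))"
    by (simp add: sum_distrib_left distrib_left del: kseq.simps(2) replicate_Suc) simp
  also have "(\<Sum>n<N. \<integral>\<^sup>+ y. kseq K (replicate (Suc n) A) y \<partial>K x)
    = (\<integral>\<^sup>+ y. (\<Sum>n<N. kseq K (replicate (Suc n) A) y) \<partial>K x)"
    by (rule nn_integral_sum[symmetric]) measurable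
  finally show ?thesis .
qed

text \<open>Foster's criterion for truncated exit times: each step inside \<open>A\<close> uses up
  one unit of \<open>f\<close> on average, so the bound is uniform in \<open>N\<close>.\<close>

lemma foster_sum:
  assumes [measurable]: "A \<in> sets borel" "f \<in> borel_measurable borel"
    and A: "\<And>x. x \<in> X \<Longrightarrow> x \<in> A \<Longrightarrow> 1 + (\<integral>\<^sup>+ y. f y \<partial>K x) \<le> f x"
    and x: "x \<in> X"
  shows "(\<Sum>n<N. kseq K (replicate (Suc n) A) x) \<le> f x"
  using x
proof (induction N arbitrary: x)
  case (Suc N)
  have [measurable]: "\<And>n. kseq K (replicate n A) \<in> borel_measurable borel"
    by (rule kseq_measurable) (auto split: if_splits)
  note eq = survival_sum_step[OF assms(1), where N = N and x = x]
  have "(\<integral>\<^sup>+ y. (\<Sum>n<N. kseq K (replicate (Suc n) A) y) \<partial>K x) \<le> (\<integral>\<^sup>+ y. f y \<partial>K x)"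
    by (rule nn_integral_K_mono) (use Suc in auto)
  then have "1 + (\<integral>\<^sup>+ y. (\<Sum>n<N. kseq K (replicate (Suc n) A) y) \<partial>K x) \<le> 1 + (\<integral>\<^sup>+ y. f y \<partial>K x)"
    by (rule add_left_mono)
  then have "x \<in> A \<Longrightarrow> 1 + (\<integral>\<^sup>+ y. (\<Sum>n<N. kseq K (replicate (Suc n) A) y) \<partial>K x) \<le> f x"
    using A[OF Suc.prems] by (rule order_trans)
  then show ?case unfolding eq by (cases "x \<in> A") (simp_all del: kseq.simps(2) replicate_Suc)
qed simp

text \<open>The comparison opposite to Foster's: \<open>f\<close> falls by at most \<open>C\<close>
  per step on average, so coming down to the level \<open>s\<close> takes time. The last term, with
  the bound \<open>b\<close> on \<open>f\<close>, pays for the paths that have not left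
  \<open>A\<close> before time \<open>N\<close>; at \<open>N = 0\<close> it carries the whole
  estimate.\<close>

lemma bounded_sum_lower:
  assumes [measurable]: "A \<in> sets borel" "f \<in> borel_measurable borel"
    and A: "\<And>x. x \<in> X \<Longrightarrow> x \<in> A \<Longrightarrow> f x \<le> (\<integral>\<^sup>+ y. f y \<partial>K x) + C"
    and s: "\<And>x. x \<in> X \<Longrightarrow> x \<notin> A \<Longrightarrow> f x \<le> s"
    and b: "\<And>x. f x \<le> b"
    and x: "x \<in> X"
  shows "f x \<le> s + C * (\<Sum>n<N. kseq K (replicate (Suc n) A) x) + b * kseq K (replicate N A) x"
  using x
proof (induction N arbitrary: x)
  case 0
  then show ?case using b[of x] by (simp add: add_increasing)
next
  case (Suc N)
  have [measurable]: "\<And>n. kseq K (replicate n A) \<in> borel_measurable borel"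
    by (rule kseq_measurable) (auto split: if_splits)
  note eq = survival_sum_step[OF assms(1), where N = N and x = x]
  show ?case
  proof (cases "x \<in> A")
    case True
    have "f x \<le> (\<integral>\<^sup>+ y. f y \<partial>K x) + C" using A Suc.prems True by auto
    also have "(\<integral>\<^sup>+ y. f y \<partial>K x) \<le> (\<integral>\<^sup>+ y. s + C * (\<Sum>n<N. kseq K (replicate (Suc n) A) y)
        + b * kseq K (replicate N A) y \<partial>K x)"
      by (rule nn_integral_K_mono) (use Suc in auto)
    also have "\<dots> = s + C * (\<integral>\<^sup>+ y. (\<Sum>n<N. kseq K (replicate (Suc n) A) y) \<partial>K x)
        + b * (\<integral>\<^sup>+ y. kseq K (replicate N A) y \<partial>K x)"
      by (simp add: nn_integral_add nn_integral_cmult del: kseq.simps(2) replicate_Suc)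
    also have "(\<integral>\<^sup>+ y. kseq K (replicate N A) y \<partial>K x) = kseq K (replicate (Suc N) A) x"
      using True by simp
    finally show ?thesis unfolding eq using True
      by (simp add: distrib_left algebra_simps del: kseq.simps(2) replicate_Suc)
  next
    case False
    then show ?thesis using s[OF Suc.prems] by (simp add: add_increasing2)
  qed
qed

end

section \<open>Cylinder events and hitting times\<close>

context real_chain
begin

definition cyl :: "real set list \<Rightarrow> real stream set" where
  "cyl As = {\<omega>. \<forall>i<length As. \<omega> !! i \<in> As ! i}"

lemma snth_measurable_M: "x \<in> X \<Longrightarrow> (\<lambda>\<omega>. \<omega> !! n) \<in> borel_measurable (M x)"
  by (subst measurable_cong_sets[OF sets_M refl]) measurable

lemma sets_cyl:
  assumes "x \<in> X" "\<And>A. A \<in> set As \<Longrightarrow> A \<in> sets borel"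
  shows "cyl As \<in> sets (M x)"
proof -
  have "{\<omega> \<in> space (M x). \<forall>i\<in>{..<length As}. \<omega> !! i \<in> As ! i} \<in> sets (M x)"
  proof (rule sets.sets_Collect_finite_All)
    fix i assume "i \<in> {..<length As}"
    then have "As ! i \<in> sets borel" using assms(2) by simp
    from measurable_sets[OF snth_measurable_M[OF assms(1)] this, of i]
    show "{\<omega> \<in> space (M x). \<omega> !! i \<in> As ! i} \<in> sets (M x)"
      by (simp add: vimage_def Int_def conj_commute)
  qed simp
  moreover have "cyl As = {\<omega> \<in> space (M x). \<forall>i\<in>{..<length As}. \<omega> !! i \<in> As ! i}"
    using space_M[OF assms(1)] by (auto simp: cyl_def)
  ultimately show ?thesis by simp
qed

lemma emeasure_cyl:
  assumes "x \<in> X" "\<And>A. A \<in> set As \<Longrightarrow> A \<in> sets borel"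
  shows "emeasure (M x) (cyl As) = kseq K As x"
  using M_cyl[OF assms] space_M[OF assms(1)] by (simp add: cyl_def)

lemma cyl_append:
  "cyl (As @ Bs) = {\<omega> \<in> cyl As. \<forall>i<length Bs. \<omega> !! (length As + i) \<in> Bs ! i}"
proof -
  have "(\<forall>i<length As + length Bs. \<omega> !! i \<in> (As @ Bs) ! i) \<longleftrightarrow>
    (\<forall>i<length As. \<omega> !! i \<in> As ! i) \<and> (\<forall>i<length Bs. \<omega> !! (length As + i) \<in> Bs ! i)" for \<omega>
  proof (intro iffI conjI allI impI)
    fix i assume *: "(\<forall>i<length As. \<omega> !! i \<in> As ! i) \<and> (\<forall>i<length Bs. \<omega> !! (length As + i) \<in> Bs ! i)"
      and i: "i < length As + length Bs"
    show "\<omega> !! i \<in> (As @ Bs) ! i"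
    proof (cases "i < length As")
      case False
      then obtain j where "i = length As + j" using le_Suc_ex[of "length As" i] by (auto simp: not_less)
      then show ?thesis using * i by simp
    qed (use * in \<open>simp add: nth_append\<close>)
  next
    fix i assume *: "\<forall>i<length As + length Bs. \<omega> !! i \<in> (As @ Bs) ! i"
    show "\<omega> !! i \<in> As ! i" if "i < length As" using *[rule_format, of i] that by (simp add: nth_append)
    show "\<omega> !! (length As + i) \<in> Bs ! i" if "i < length Bs"
      using *[rule_format, of "length As + i"] that by simp
  qed
  then show ?thesis by (simp add: cyl_def)
qed

text \<open>Continuity from above: an event with infinite horizon is a decreasing limit of
  cylinders, so statements about all times reduce to \<open>kseq\<close>.\<close>

lemma cyl_tail_INF:
  assumes x: "x \<in> X" and As: "\<And>A. A \<in> set As \<Longrightarrow> A \<in> sets borel" and A: "A \<in> sets borel"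
  shows "{\<omega> \<in> cyl As. \<forall>n\<ge>length As. \<omega> !! n \<in> A} \<in> sets (M x)"
    and "emeasure (M x) {\<omega> \<in> cyl As. \<forall>n\<ge>length As. \<omega> !! n \<in> A}
      = (INF N. kseq K (As @ replicate N A) x)"
proof -
  interpret prob_space "M x" by (rule prob_M[OF x])
  have eq: "{\<omega> \<in> cyl As. \<forall>n\<ge>length As. \<omega> !! n \<in> A} = (\<Inter>N. cyl (As @ replicate N A))"
  proof (intro set_eqI iffI)
    fix \<omega> assume "\<omega> \<in> (\<Inter>N. cyl (As @ replicate N A))"
    then have *: "\<omega> \<in> cyl (As @ replicate N A)" for N by (rule INT_D) simp
    have "\<omega> !! n \<in> A" if n: "length As \<le> n" for n
    proof -
      obtain j where "n = length As + j" using le_Suc_ex[OF n] by blast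
      then show ?thesis using *[of "Suc j"] unfolding cyl_append by (auto simp del: replicate_Suc)
    qed
    then show "\<omega> \<in> {\<omega> \<in> cyl As. \<forall>n\<ge>length As. \<omega> !! n \<in> A}" using *[of 0] by simp
  qed (auto simp: cyl_append)
  have s: "cyl (As @ replicate N A) \<in> sets (M x)" for N
    by (rule sets_cyl[OF x]) (use As A in \<open>auto split: if_splits\<close>)
  then show "{\<omega> \<in> cyl As. \<forall>n\<ge>length As. \<omega> !! n \<in> A} \<in> sets (M x)"
    unfolding eq by (intro sets.countable_INT) auto
  have "(INF N. emeasure (M x) (cyl (As @ replicate N A))) = emeasure (M x) (\<Inter>N. cyl (As @ replicate N A))"
  proof (rule INF_emeasure_decseq)
    show "range (\<lambda>N. cyl (As @ replicate N A)) \<subseteq> sets (M x)" using s by blast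
    show "decseq (\<lambda>N. cyl (As @ replicate N A))" by (auto simp: decseq_def cyl_append)
  qed simp
  moreover have "emeasure (M x) (cyl (As @ replicate N A)) = kseq K (As @ replicate N A) x" for N
    by (rule emeasure_cyl[OF x]) (use As A in \<open>auto split: if_splits\<close>)
  ultimately show "emeasure (M x) {\<omega> \<in> cyl As. \<forall>n\<ge>length As. \<omega> !! n \<in> A}
      = (INF N. kseq K (As @ replicate N A) x)"
    unfolding eq by simp
qed

text \<open>The hitting time counts the indices \<open>n\<close> for which all of the times
  \<open>0, ..., n\<close> avoid the interval, whence the \<open>Suc n\<close> factors. A path that
  never hits contributes 1 for every \<open>n\<close>, in agreement with the value infinity of
  \<open>hit_time\<close>.\<close>

lemma nn_integral_hit_time:
  assumes x: "x \<in> X"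
  shows "(\<integral>\<^sup>+ \<omega>. hit_time a \<omega> \<partial>M x) = (\<Sum>n. kseq K (replicate (Suc n) {y. \<bar>y\<bar> > a}) x)"
proof -
  let ?A = "{y. \<bar>y\<bar> > a}"
  have [measurable]: "?A \<in> sets borel" by measurable
  have cylA: "cyl (replicate n ?A) = {\<omega>. \<forall>i<n. \<bar>\<omega> !! i\<bar> > a}" for n by (auto simp: cyl_def)
  have "hit_time a \<omega> = (\<Sum>n. indicator (cyl (replicate (Suc n) ?A)) \<omega>)" for \<omega>
  proof (cases "\<exists>n. \<bar>\<omega> !! n\<bar> \<le> a")
    case True
    define k where "k = (LEAST n. \<bar>\<omega> !! n\<bar> \<le> a)"
    have k: "\<bar>\<omega> !! k\<bar> \<le> a" unfolding k_def using True by (rule LeastI_ex)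
    have lk: "a < \<bar>\<omega> !! i\<bar>" if "i < k" for i
      using not_less_Least[of i "\<lambda>n. \<bar>\<omega> !! n\<bar> \<le> a"] that by (simp add: k_def not_le)
    have ind: "indicator (cyl (replicate (Suc n) ?A)) \<omega> = (if n < k then 1 else 0 :: ennreal)" for n
    proof (cases "n < k")
      case False
      then have "\<not> (\<forall>i<Suc n. a < \<bar>\<omega> !! i\<bar>)" using k by (intro notI) (auto dest!: spec[of _ k])
      then show ?thesis using False unfolding cylA by simp
    qed (use lk in \<open>auto simp: cylA simp del: replicate_Suc\<close>)
    have "(\<Sum>n. indicator (cyl (replicate (Suc n) ?A)) \<omega> :: ennreal) = (\<Sum>n<k. 1)"
      unfolding ind by (subst suminf_finite[of "{..<k}"]) auto
    then show ?thesis using True by (simp add: hit_time_def k_def)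
  next
    case False
    then have "indicator (cyl (replicate (Suc n) ?A)) \<omega> = (1::ennreal)" for n
      unfolding cylA by (auto simp: not_le)
    then have "(\<Sum>n. indicator (cyl (replicate (Suc n) ?A)) \<omega> :: ennreal) = \<infinity>"
      by (simp add: suminf_eq_SUP ennreal_SUP_of_nat_eq_top)
    then show ?thesis using False by (simp add: hit_time_def)
  qed
  then have "(\<integral>\<^sup>+ \<omega>. hit_time a \<omega> \<partial>M x)
    = (\<integral>\<^sup>+ \<omega>. (\<Sum>n. indicator (cyl (replicate (Suc n) ?A)) \<omega>) \<partial>M x)" by simp
  also have "\<dots> = (\<Sum>n. \<integral>\<^sup>+ \<omega>. indicator (cyl (replicate (Suc n) ?A)) \<omega> \<partial>M x)"
    by (rule nn_integral_suminf) (intro borel_measurable_indicator sets_cyl[OF x]; auto split: if_splits)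
  also have "\<dots> = (\<Sum>n. kseq K (replicate (Suc n) ?A) x)"
  proof (rule suminf_cong)
    fix n
    have b: "B \<in> sets borel" if "B \<in> set (replicate (Suc n) ?A)" for B
      using that by (auto split: if_splits)
    show "(\<integral>\<^sup>+ \<omega>. indicator (cyl (replicate (Suc n) ?A)) \<omega> \<partial>M x) = kseq K (replicate (Suc n) ?A) x"
      by (subst nn_integral_indicator, rule sets_cyl[OF x b], assumption, rule emeasure_cyl[OF x b])
  qed
  finally show ?thesis .
qed



section \<open>Criteria for recurrence and for the size of mean hitting times\<close>

lemma kseq_replicate_Suc_le:
  assumes "x \<in> X" "A \<in> sets borel" "\<And>B. B \<in> set As \<Longrightarrow> B \<in> sets borel"
  shows "kseq K (As @ replicate (Suc N) A) x \<le> kseq K (As @ replicate N A) x"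
proof -
  have "1 * kseq K ((As @ replicate N A) @ [A]) x \<le> kseq K ((As @ replicate N A) @ []) x"
    by (rule kseq_append_mono) (use assms kseq_le_1[of "[A]"] in \<open>auto split: if_splits simp del: kseq.simps(2)\<close>)
  then show ?thesis using assms by (simp add: replicate_append_same)
qed

text \<open>The form in which non-confinement enters: every ball is left, and the least exit index
  lets later arguments decompose according to the exit time.\<close>

lemma AE_exit_ball:
  assumes x: "x \<in> X" and N: "cond_N' X M"
  shows "AE \<omega> in M x. \<exists>n. (\<forall>i<n. \<bar>\<omega> !! i\<bar> < R) \<and> R \<le> \<bar>\<omega> !! n\<bar>"
proof -
  have "AE \<omega> in M x. limsup (\<lambda>n. ereal \<bar>\<omega> !! n\<bar>) = \<infinity>"
    using N x by (auto simp: cond_N'_def)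
  then show ?thesis
  proof eventually_elim
    case (elim \<omega>)
    have ex: "\<exists>n. R \<le> \<bar>\<omega> !! n\<bar>"
    proof (rule ccontr)
      assume "\<not> (\<exists>n. R \<le> \<bar>\<omega> !! n\<bar>)"
      then have "limsup (\<lambda>n. ereal \<bar>\<omega> !! n\<bar>) \<le> ereal R"
        by (intro Limsup_bounded) (auto intro!: always_eventually simp: not_le less_imp_le)
      with elim show False by simp
    qed
    define n where "n = (LEAST n. R \<le> \<bar>\<omega> !! n\<bar>)"
    have "R \<le> \<bar>\<omega> !! n\<bar>" unfolding n_def using ex by (rule LeastI_ex)
    moreover have "\<bar>\<omega> !! i\<bar> < R" if "i < n" for i
      using not_less_Least[of i "\<lambda>n. R \<le> \<bar>\<omega> !! n\<bar>"] that by (simp add: n_def not_le)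
    ultimately show ?case by blast
  qed
qed

text \<open>On the event of never entering \<open>[-a, a]\<close> the path still leaves every ball,
  so it reaches the region \<open>f \<ge> k\<close> without having entered. By the maximal
  inequality this has probability at most \<open>f x / k\<close>, and \<open>k\<close> is
  arbitrary.\<close>

lemma never_hit_zero:
  assumes x: "x \<in> X" and N: "cond_N' X M"
    and [measurable]: "f \<in> borel_measurable borel" and fin: "f x < \<infinity>"
    and f: "\<And>x. x \<in> X \<Longrightarrow> \<bar>x\<bar> > a \<Longrightarrow> (\<integral>\<^sup>+ y. f y \<partial>K x) \<le> f x"
    and large: "\<And>k. \<exists>R. \<forall>y. \<bar>y\<bar> \<ge> R \<longrightarrow> ennreal (real k) \<le> f y"
  shows "(INF N. kseq K (replicate N {y. \<bar>y\<bar> > a}) x) = 0"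
proof -
  let ?A = "{y. \<bar>y\<bar> > a}"
  have [measurable]: "?A \<in> sets borel" by measurable
  define E where "E = {\<omega>. \<forall>n. \<omega> !! n \<in> ?A}"
  have E: "E \<in> sets (M x)" "emeasure (M x) E = (INF N. kseq K (replicate N ?A) x)"
    using cyl_tail_INF[OF x, of "[]" ?A] by (simp_all add: cyl_def E_def)
  have "ennreal (real k) * emeasure (M x) E \<le> f x" for k
  proof -
    obtain R where R: "\<And>y. \<bar>y\<bar> \<ge> R \<Longrightarrow> ennreal (real k) \<le> f y" using large by blast
    define B where "B = {y. a < \<bar>y\<bar> \<and> \<bar>y\<bar> < R}"
    define C where "C = {y. a < \<bar>y\<bar> \<and> R \<le> \<bar>y\<bar>}"
    have BC [measurable]: "B \<in> sets borel" "C \<in> sets borel" unfolding B_def C_def by measurable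
    have b: "D \<in> sets borel" if "D \<in> set (replicate n B @ [C])" for D n
      using that BC by (auto split: if_splits)
    have AE: "AE \<omega> in M x. \<omega> \<in> E \<longrightarrow> \<omega> \<in> (\<Union>n. cyl (replicate n B @ [C]))"
    proof -
      show ?thesis
        using AE_exit_ball[OF x N, of R]
      proof eventually_elim
        case (elim \<omega>)
        then obtain n where n: "R \<le> \<bar>\<omega> !! n\<bar>" "\<forall>i<n. \<bar>\<omega> !! i\<bar> < R" by blast
        show ?case
        proof
          assume "\<omega> \<in> E"
          then have "\<omega> \<in> cyl (replicate n B @ [C])"
            unfolding cyl_append using n by (auto simp: E_def cyl_def B_def C_def)
          then show "\<omega> \<in> (\<Union>n. cyl (replicate n B @ [C]))" by blast
        qed
      qed
    qed
    have cs: "range (\<lambda>n. cyl (replicate n B @ [C])) \<subseteq> sets (M x)"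
    proof
      fix D assume "D \<in> range (\<lambda>n. cyl (replicate n B @ [C]))"
      then obtain n where "D = cyl (replicate n B @ [C])" by (rule rangeE)
      then show "D \<in> sets (M x)" by (simp only:) (rule sets_cyl[OF x b])
    qed
    have "emeasure (M x) E \<le> emeasure (M x) (\<Union>n. cyl (replicate n B @ [C]))"
      by (rule emeasure_mono_AE[OF AE]) (rule sets.countable_UN[OF cs])
    also have "\<dots> \<le> (\<Sum>n. emeasure (M x) (cyl (replicate n B @ [C])))"
      by (rule emeasure_subadditive_countably[OF cs])
    also have "\<dots> = (\<Sum>n. kseq K (replicate n B @ [C]) x)"
      by (intro suminf_cong emeasure_cyl[OF x b])
    finally have "ennreal (real k) * emeasure (M x) E
      \<le> ennreal (real k) * (\<Sum>n. kseq K (replicate n B @ [C]) x)" by (rule mult_left_mono) simp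
    also have "\<dots> = (\<Sum>n. ennreal (real k) * kseq K (replicate n B @ [C]) x)" by simp
    also have "\<dots> \<le> f x"
    proof (rule suminf_le_const[OF summableI])
      fix N
      have "ennreal (real k) * (\<Sum>n<N. kseq K (replicate n B @ [C]) x) \<le> f x"
        by (rule supermartingale_hit[where r = "ennreal (real k)" and f = f, OF BC _ _ _ x])
          (use f R in \<open>auto simp: B_def C_def\<close>)
      then show "(\<Sum>n<N. ennreal (real k) * kseq K (replicate n B @ [C]) x) \<le> f x"
        by (simp add: sum_distrib_left)
    qed
    finally show ?thesis .
  qed
  note k = this
  interpret prob_space "M x" by (rule prob_M[OF x])
  have "prob E = 0"
  proof (rule ccontr)
    assume "prob E \<noteq> 0"
    then have p: "prob E > 0" by (simp add: zero_less_measure_iff)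
    obtain F where F: "0 \<le> F" "f x = ennreal F" using fin by (cases "f x") auto
    obtain k :: nat where "F / prob E < real k" using reals_Archimedean2 by blast
    then have "F < real k * prob E" using p by (simp add: field_simps)
    moreover have "real k * prob E \<le> F"
      using k[of k] F by (simp add: emeasure_eq_measure ennreal_mult'[symmetric])
    ultimately show False by simp
  qed
  then show ?thesis using E by (simp add: emeasure_eq_measure)
qed

text \<open>Recurrence asks for a visit after every time \<open>m\<close>. The shift is carried out
  on \<open>kseq\<close> by integrating over the first step; infimum and integral may be exchanged
  because \<open>kseq\<close> is bounded by 1.\<close>

lemma INF_shift_zero:
  assumes A: "A \<in> sets borel" and z: "\<And>x. x \<in> X \<Longrightarrow> (INF N. kseq K (replicate N A) x) = 0"
    and x: "x \<in> X"
  shows "(INF N. kseq K (replicate m UNIV @ replicate N A) x) = 0"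
  using x
proof (induction m arbitrary: x)
  case (Suc m)
  have b: "B \<in> sets borel" if "B \<in> set (replicate m UNIV @ replicate N A)" for B N
    using that A by (auto split: if_splits)
  have b': "B \<in> sets borel" if "B \<in> set (replicate m UNIV)" for B :: "real set"
    using that by (auto split: if_splits)
  have [measurable]: "kseq K (replicate m UNIV @ replicate N A) \<in> borel_measurable borel" for N
    by (rule kseq_measurable[OF b])
  have "(INF N. kseq K (replicate (Suc m) UNIV @ replicate N A) x)
    = (INF N. \<integral>\<^sup>+ y. kseq K (replicate m UNIV @ replicate N A) y \<partial>K x)" by simp
  also have "\<dots> = (\<integral>\<^sup>+ y. (INF N. kseq K (replicate m UNIV @ replicate N A) y) \<partial>K x)"
  proof (rule nn_integral_monotone_convergence_INF_AE'[symmetric])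
    show "AE y in K x. kseq K (replicate m UNIV @ replicate (Suc N) A) y
      \<le> kseq K (replicate m UNIV @ replicate N A) y" for N
      using AE_K_X[OF Suc.prems] by eventually_elim (rule kseq_replicate_Suc_le[OF _ A b'])
    have "(\<integral>\<^sup>+ y. kseq K (replicate m UNIV @ replicate 0 A) y \<partial>K x) \<le> (\<integral>\<^sup>+ y. 1 \<partial>K x)"
      by (intro nn_integral_mono kseq_le_1)
    then show "(\<integral>\<^sup>+ y. kseq K (replicate m UNIV @ replicate 0 A) y \<partial>K x) < \<infinity>"
      by (auto intro: le_less_trans)
  qed measurable
  also have "\<dots> = (\<integral>\<^sup>+ y. 0 \<partial>K x)"
    by (rule nn_integral_cong_AE) (use AE_K_X[OF Suc.prems] Suc.IH in auto)
  finally show ?case by simp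
qed (use z in simp)

lemma recurrentI:
  assumes z: "\<And>x. x \<in> X \<Longrightarrow> (INF N. kseq K (replicate N {y. \<bar>y\<bar> > a}) x) = 0"
  shows "recurrent_mc X M"
  unfolding recurrent_mc_def
proof (intro exI[of _ a] ballI)
  fix x assume x: "x \<in> X"
  let ?A = "{y. \<bar>y\<bar> > a}"
  have A: "?A \<in> sets borel" by measurable
  have "AE \<omega> in M x. \<exists>n\<ge>m. \<bar>\<omega> !! n\<bar> \<le> a" for m
  proof (rule AE_I')
    have b: "B \<in> sets borel" if "B \<in> set (replicate m UNIV)" for B :: "real set"
      using that by (auto split: if_splits)
    let ?E = "{\<omega> \<in> cyl (replicate m UNIV). \<forall>n\<ge>length (replicate m (UNIV::real set)). \<omega> !! n \<in> ?A}"
    have "emeasure (M x) ?E = 0"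
      by (rule trans[OF cyl_tail_INF(2)[OF x b A] INF_shift_zero[OF A z x]])
    then show "?E \<in> null_sets (M x)" by (rule null_setsI) (rule cyl_tail_INF(1)[OF x b A])
    show "{\<omega> \<in> space (M x). \<not> (\<exists>n\<ge>m. \<bar>\<omega> !! n\<bar> \<le> a)} \<subseteq> ?E"
      by (auto simp: cyl_def not_le[where 'a = real])
  qed
  then have "AE \<omega> in M x. \<forall>m. \<exists>n\<ge>m. \<bar>\<omega> !! n\<bar> \<le> a" by (simp add: AE_all_countable)
  then show "AE \<omega> in M x. liminf (\<lambda>n. ereal \<bar>\<omega> !! n\<bar>) \<le> ereal a"
  proof eventually_elim
    case (elim \<omega>)
    show ?case
      unfolding liminf_SUP_INF
    proof (rule SUP_least)
      fix m
      obtain n where "n \<ge> m" "\<bar>\<omega> !! n\<bar> \<le> a" using elim by blast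
      then show "(INF n\<in>{m..}. ereal \<bar>\<omega> !! n\<bar>) \<le> ereal a"
        by (intro INF_lower2[of n]) auto
    qed
  qed
qed

lemma positive_recurrentI:
  assumes [measurable]: "f \<in> borel_measurable borel" and fin: "\<And>x. f x < \<infinity>"
    and f: "\<And>x. x \<in> X \<Longrightarrow> \<bar>x\<bar> > a \<Longrightarrow> 1 + (\<integral>\<^sup>+ y. f y \<partial>K x) \<le> f x"
  shows "positive_recurrent_mc X M"
  unfolding positive_recurrent_mc_def
proof (intro exI[of _ a] allI impI ballI)
  fix a' x assume a': "a \<le> a'" and x: "x \<in> X"
  have "(\<integral>\<^sup>+ \<omega>. hit_time a' \<omega> \<partial>M x) \<le> f x"
    unfolding nn_integral_hit_time[OF x]
    by (rule suminf_le_const[OF summableI], rule foster_sum[OF _ _ _ x]) (use f a' in auto)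
  then show "(\<integral>\<^sup>+ \<omega>. hit_time a' \<omega> \<partial>M x) < \<infinity>" using fin by (rule le_less_trans)
qed

text \<open>With \<open>S\<close> the mean hitting time, \<open>s + C * S\<close> dominates every
  truncation \<open>f R\<close> and therefore \<open>g\<close>. A single jump from \<open>x\<close>
  already makes the mean of \<open>g\<close> infinite, and \<open>S x\<close> is at least the mean
  of \<open>S\<close> after that jump.\<close>

lemma hit_time_infinite:
  fixes f :: "nat \<Rightarrow> real \<Rightarrow> real"
  assumes x: "x \<in> X" and a: "\<bar>x\<bar> > a" and C: "C < \<infinity>" "C \<noteq> 0" and s: "s < \<infinity>"
    and [measurable]: "\<And>R. f R \<in> borel_measurable borel"
    and b: "\<And>R. \<exists>b<\<infinity>. \<forall>y. ennreal (f R y) \<le> b"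
    and f: "\<And>R x. x \<in> X \<Longrightarrow> \<bar>x\<bar> > a \<Longrightarrow> ennreal (f R x) \<le> (\<integral>\<^sup>+ y. ennreal (f R y) \<partial>K x) + C"
    and fs: "\<And>R x. \<bar>x\<bar> \<le> a \<Longrightarrow> ennreal (f R x) \<le> s"
    and g: "\<And>y. g y \<le> (SUP n. ennreal (f n y))" and [measurable]: "g \<in> borel_measurable borel"
    and inf: "(\<integral>\<^sup>+ y. g y \<partial>K x) = \<infinity>"
  shows "(\<integral>\<^sup>+ \<omega>. hit_time a \<omega> \<partial>M x) = \<infinity>"
proof -
  let ?A = "{y. \<bar>y\<bar> > a}"
  have [measurable]: "?A \<in> sets borel" by measurable
  define S where "S y = (\<Sum>n. kseq K (replicate (Suc n) ?A) y)" for y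
  have b2 [measurable]: "kseq K (replicate n ?A) \<in> borel_measurable borel" for n
    by (rule kseq_measurable) (auto split: if_splits)
  have Sm [measurable]: "S \<in> borel_measurable borel"
    unfolding S_def by (intro borel_measurable_suminf_order b2)
  have bound: "ennreal (f R y) \<le> s + C * S y" if y: "y \<in> X" for R y
  proof (cases "S y = \<infinity>")
    case True
    then show ?thesis using C by (simp add: ennreal_mult_top)
  next
    case False
    obtain b where b: "b < \<infinity>" "\<And>y. ennreal (f R y) \<le> b" using assms(7) by blast
    have le: "ennreal (f R y) \<le> s + C * S y + b * kseq K (replicate N ?A) y" for N
    proof -
      have "ennreal (f R y) \<le> s + C * (\<Sum>n<N. kseq K (replicate (Suc n) ?A) y) + b * kseq K (replicate N ?A) y"
        by (rule bounded_sum_lower[where f = "\<lambda>y. ennreal (f R y)", OF _ _ _ _ _ y]) (use f fs b in auto)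
      also have "\<dots> \<le> s + C * S y + b * kseq K (replicate N ?A) y"
        unfolding S_def by (intro add_mono mult_left_mono sum_le_suminf) (auto intro: summableI)
      finally show ?thesis .
    qed
    \<comment> \<open>When the mean hitting time is finite, the survival probabilities are summable
      and tend to 0. As \<open>f R\<close> is bounded, the boundary term then disappears in the
      limit.\<close>
    have "(\<lambda>n. kseq K (replicate (Suc n) ?A) y) \<longlonglongrightarrow> 0"
    proof -
      define r where "r n = enn2real (kseq K (replicate (Suc n) ?A) y)" for n
      have r: "kseq K (replicate (Suc n) ?A) y = ennreal (r n)" for n
        unfolding r_def by (rule ennreal_enn2real[OF le_less_trans[OF kseq_le_1 ennreal_one_less_top], symmetric])
      have "summable r"
        by (rule summable_suminf_not_top) (use False in \<open>auto simp: S_def r r_def[symmetric] simp del: replicate_Suc kseq.simps(2)\<close>, simp add: r_def)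
      then have "(\<lambda>n. ennreal (r n)) \<longlonglongrightarrow> ennreal 0"
        by (intro tendsto_ennrealI summable_LIMSEQ_zero)
      then show ?thesis unfolding r by simp
    qed
    then have "(\<lambda>n. s + C * S y + b * kseq K (replicate (Suc n) ?A) y) \<longlonglongrightarrow> s + C * S y + b * 0"
      by (intro tendsto_add tendsto_const ennreal_tendsto_cmult b(1)[unfolded infinity_ennreal_def])
    then have "ennreal (f R y) \<le> s + C * S y + b * 0"
      by (rule LIMSEQ_le_const) (use le in blast)
    then show ?thesis by simp
  qed
  have "\<infinity> = (\<integral>\<^sup>+ y. g y \<partial>K x)" using inf by simp
  also have "\<dots> \<le> (\<integral>\<^sup>+ y. s + C * S y \<partial>K x)"
    by (rule nn_integral_K_mono[OF x]) (rule order_trans[OF g SUP_least[OF bound]])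
  also have "\<dots> = s + C * (\<integral>\<^sup>+ y. S y \<partial>K x)" by (simp add: nn_integral_add nn_integral_cmult)
  finally have SK: "(\<integral>\<^sup>+ y. S y \<partial>K x) = \<infinity>" using C s by (auto simp: ennreal_mult_eq_top_iff top_unique)
  have "(\<integral>\<^sup>+ y. S y \<partial>K x) = (\<Sum>n. \<integral>\<^sup>+ y. kseq K (replicate (Suc n) ?A) y \<partial>K x)"
    unfolding S_def by (rule nn_integral_suminf) (use b2 in simp)
  \<comment> \<open>From a start with \<open>\<bar>x\<bar> > a\<close>, the series averaged over one
    jump is the series at \<open>x\<close> without its first term.\<close>
  also have "\<dots> = (\<Sum>n. kseq K (replicate (Suc (Suc n)) ?A) x)" using a by simp
  also have "\<dots> \<le> S x"
    unfolding S_def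
  proof (rule suminf_le_const[OF summableI])
    fix N
    have "(\<Sum>n<N. kseq K (replicate (Suc (Suc n)) ?A) x) \<le> (\<Sum>n<Suc N. kseq K (replicate (Suc n) ?A) x)"
      unfolding sum.lessThan_Suc_shift by (rule add_increasing) auto
    also have "\<dots> \<le> (\<Sum>n. kseq K (replicate (Suc n) ?A) x)"
      by (rule sum_le_suminf) (auto intro: summableI)
    finally show "(\<Sum>n<N. kseq K (replicate (Suc (Suc n)) ?A) x) \<le> (\<Sum>n. kseq K (replicate (Suc n) ?A) x)" .
  qed
  finally have "S x = \<infinity>" using SK by (simp add: top_unique)
  then show ?thesis unfolding nn_integral_hit_time[OF x] S_def .
qed

section \<open>Directional transience from the probability of never leaving a half-line\<close>

lemma stay_lower:
  assumes A [measurable]: "A \<in> sets borel" and x: "x \<in> X"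
    and sup: "\<And>x. x \<in> X \<Longrightarrow> x \<in> A \<Longrightarrow> (\<integral>\<^sup>+ y. f y \<partial>K x) \<le> f x"
    and out: "\<And>x. x \<in> X \<Longrightarrow> x \<notin> A \<Longrightarrow> ennreal \<rho> \<le> f x"
    and \<rho>: "0 < \<rho>" and e: "0 \<le> e" and fx: "f x \<le> ennreal (e * \<rho>)"
  shows "ennreal (1 - e) \<le> kseq K (replicate N A) x"
proof -
  define S where "S = (\<Sum>n<N. kseq K (replicate n A @ [- A]) x)"
  define k where "k = kseq K (replicate N A) x"
  \<comment> \<open>With target \<open>- A\<close> the maximal inequality bounds the probability of
    leaving \<open>A\<close> before time \<open>N\<close> by
    \<open>f x / \<rho> \<le> e\<close>.\<close>
  have "ennreal \<rho> * S \<le> f x"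
    unfolding S_def by (rule supermartingale_hit[where r = "ennreal \<rho>" and f = f, OF _ _ _ _ _ x]) (use sup out in auto)
  then have 1: "ennreal \<rho> * S \<le> ennreal (e * \<rho>)" using fx by (rule order_trans)
  have 2: "S + k = 1" unfolding S_def k_def by (rule kseq_exit[OF A])
  then have "S < \<top>" "k < \<top>" by (auto simp: less_top[symmetric])
  then obtain s k' where s: "S = ennreal s" "0 \<le> s" and k': "k = ennreal k'" "0 \<le> k'"
    by (metis less_top enn2real_nonneg ennreal_enn2real)
  have "\<rho> * s \<le> e * \<rho>" using 1 \<rho> e s by (simp add: ennreal_mult'[symmetric])
  then have "s \<le> e" using \<rho> by simp
  moreover have "s + k' = 1"
    using 2 s k' by (simp add: ennreal_plus[symmetric] del: ennreal_plus)
  ultimately show ?thesis unfolding k_def[symmetric] k' by (intro ennreal_leI) simp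
qed

text \<open>From each state of \<open>C\<close> the chain stays in \<open>A\<close> for ever with
  probability at least \<open>q\<close>, and by the Markov property at time \<open>n\<close> this
  factor multiplies the probability of arriving in \<open>C\<close>. Since
  \<open>C \<subseteq> A\<close>, the arrival time itself may be counted as a time spent in
  \<open>A\<close>.\<close>

lemma stay_event:
  fixes n :: nat
  assumes x: "x \<in> X" and C: "C \<in> sets borel" and A: "A \<in> sets borel" and B: "B \<in> sets borel" and "C \<subseteq> A"
    and stay: "\<And>y N. y \<in> X \<Longrightarrow> y \<in> C \<Longrightarrow> q \<le> kseq K (replicate N A) y"
  defines "D \<equiv> {\<omega> \<in> cyl (replicate n B @ [C]). \<forall>k\<ge>length (replicate n B @ [C]). \<omega> !! k \<in> A}"
  shows "D \<in> sets (M x)" "q * emeasure (M x) (cyl (replicate n B @ [C])) \<le> emeasure (M x) D"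
proof -
  have b: "S \<in> sets borel" if "S \<in> set (replicate n B @ [C])" for S
    using that B C by (auto split: if_splits)
  show "D \<in> sets (M x)" unfolding D_def by (rule cyl_tail_INF(1)[OF x b A])
  have "q * kseq K (replicate n B @ [C]) x \<le> kseq K (replicate n B @ ([C] @ replicate N A)) x" for N
  proof (rule kseq_append_mono[OF _ _ x])
    fix y assume y: "y \<in> X"
    show "q * kseq K [C] y \<le> kseq K ([C] @ replicate N A) y"
    proof (cases "y \<in> C")
      case True
      then have *: "kseq K ([C] @ replicate N A) y = kseq K (replicate (Suc N) A) y"
        using \<open>C \<subseteq> A\<close> by auto
      have "kseq K [C] y = 1" using True by simp
      then show ?thesis unfolding * using stay[OF y True, of "Suc N"] by (simp only: mult_1_right)
    qed simp
  qed (use B C in \<open>auto split: if_splits\<close>)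
  moreover have "emeasure (M x) D = (INF N. kseq K ((replicate n B @ [C]) @ replicate N A) x)"
    unfolding D_def by (rule cyl_tail_INF(2)[OF x b A])
  moreover have "emeasure (M x) (cyl (replicate n B @ [C])) = kseq K (replicate n B @ [C]) x"
    by (rule emeasure_cyl[OF x b])
  ultimately show "q * emeasure (M x) (cyl (replicate n B @ [C])) \<le> emeasure (M x) D"
    by (auto intro: INF_greatest)
qed

text \<open>The first exit from a large ball lands on one of the two sides, and from there the chain
  keeps to that side beyond level \<open>r\<close> with probability near 1. Letting \<open>e\<close>
  tend to 0 gives, for each \<open>r\<close>, almost surely a side on which the path eventually
  stays beyond \<open>r\<close>.\<close>

lemma directional_transientI:
  assumes N: "cond_N' X M"
    and stay: "\<And>r e. 0 < e \<Longrightarrow> \<exists>R>r. \<forall>x\<in>X.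
      (R \<le> x \<longrightarrow> (\<forall>N. ennreal (1 - e) \<le> kseq K (replicate N {r..}) x)) \<and>
      (x \<le> - R \<longrightarrow> (\<forall>N. ennreal (1 - e) \<le> kseq K (replicate N {..-r}) x))"
  shows "directional_transient_mc X M"
  unfolding directional_transient_mc_def
proof (intro ballI)
  fix x assume x: "x \<in> X"
  interpret prob_space "M x" by (rule prob_M[OF x])
  define Up where "Up r n = {\<omega>. \<forall>k\<ge>n. r \<le> \<omega> !! k}" for r :: real and n :: nat
  define Dn where "Dn r n = {\<omega>. \<forall>k\<ge>n. \<omega> !! k \<le> - r}" for r :: real and n :: nat
  have UD: "Up r n \<in> sets (M x)" "Dn r n \<in> sets (M x)" for r n
  proof -
    have "Up r n = {\<omega> \<in> cyl (replicate n UNIV). \<forall>k\<ge>length (replicate n (UNIV::real set)). \<omega> !! k \<in> {r..}}"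
      "Dn r n = {\<omega> \<in> cyl (replicate n UNIV). \<forall>k\<ge>length (replicate n (UNIV::real set)). \<omega> !! k \<in> {..-r}}"
      by (auto simp: Up_def Dn_def cyl_def)
    then show "Up r n \<in> sets (M x)" "Dn r n \<in> sets (M x)"
      by (simp_all only:) (rule cyl_tail_INF(1)[OF x]; auto split: if_splits)+
  qed
  have main: "AE \<omega> in M x. \<exists>n. \<omega> \<in> Up r n \<or> \<omega> \<in> Dn r n" if r: "0 < r" for r
  proof -
    define E where "E = (\<Union>n. Up r n \<union> Dn r n)"
    have E [measurable]: "E \<in> sets (M x)" unfolding E_def using UD by (intro sets.countable_UN') auto
    have "1 - e \<le> prob E" if e: "0 < e" "e < 1" for e
    proof -
      obtain R where R: "R > r"
        "\<And>y N. y \<in> X \<Longrightarrow> R \<le> y \<Longrightarrow> ennreal (1 - e) \<le> kseq K (replicate N {r..}) y"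
        "\<And>y N. y \<in> X \<Longrightarrow> y \<le> - R \<Longrightarrow> ennreal (1 - e) \<le> kseq K (replicate N {..-r}) y"
        using stay[OF e(1), of r] by blast
      define B where "B = {y::real. \<bar>y\<bar> < R}"
      have B [measurable]: "B \<in> sets borel" unfolding B_def by measurable
      define G where "G C n = cyl (replicate n B @ [C])" for C n
      define D where "D C A n = {\<omega> \<in> cyl (replicate n B @ [C]). \<forall>k\<ge>length (replicate n B @ [C]). \<omega> !! k \<in> A}" for C A n
      have G: "G C n \<in> sets (M x)" if "C \<in> sets borel" for C n
        unfolding G_def by (rule sets_cyl[OF x]) (use that B in \<open>auto split: if_splits\<close>)
      have Dp: "D {R..} {r..} n \<in> sets (M x)"
        "ennreal (1 - e) * emeasure (M x) (G {R..} n) \<le> emeasure (M x) (D {R..} {r..} n)" for n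
        unfolding D_def G_def by (rule stay_event[OF x]; use R in auto)+
      have Dm: "D {..-R} {..-r} n \<in> sets (M x)"
        "ennreal (1 - e) * emeasure (M x) (G {..-R} n) \<le> emeasure (M x) (D {..-R} {..-r} n)" for n
        unfolding D_def G_def by (rule stay_event[OF x]; use R in auto)+
      \<comment> \<open>In \<open>H n\<close> the index \<open>n\<close> is the first exit time from
        \<open>B\<close>. The sets are therefore disjoint, their probabilities add up, and nothing
        is lost beyond the factor \<open>1 - e\<close>.\<close>
      define H where "H n = D {R..} {r..} n \<union> D {..-R} {..-r} n" for n
      have Gmem: "\<omega> \<in> G C n \<longleftrightarrow> (\<forall>i<n. \<omega> !! i \<in> B) \<and> \<omega> !! n \<in> C" for \<omega> C n
        unfolding G_def cyl_append by (auto simp: cyl_def)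
      have DG: "D C A n = {\<omega> \<in> G C n. \<forall>k\<ge>Suc n. \<omega> !! k \<in> A}" for C A n
        by (simp add: D_def G_def)
      have HG: "\<omega> \<in> H n \<Longrightarrow> (\<forall>i<n. \<omega> !! i \<in> B) \<and> \<omega> !! n \<notin> B" for \<omega> n
        using R(1) r by (auto simp: H_def DG Gmem B_def)
      have disj: "disjoint_family H"
        unfolding disjoint_family_on_def
      proof (intro ballI impI)
        fix m n :: nat assume "m \<noteq> n"
        show "H m \<inter> H n = {}"
        proof (rule ccontr)
          assume "H m \<inter> H n \<noteq> {}"
          then obtain \<omega> where "\<omega> \<in> H m" "\<omega> \<in> H n" by blast
          from HG[OF this(1)] HG[OF this(2)] \<open>m \<noteq> n\<close> show False by (meson linorder_neqE_nat)
        qed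
      qed
      have HE: "(\<Union>n. H n) \<subseteq> E"
      proof
        fix \<omega> assume "\<omega> \<in> (\<Union>n. H n)"
        then obtain n where "\<omega> \<in> H n" by blast
        then have "\<omega> \<in> Up r (Suc n) \<or> \<omega> \<in> Dn r (Suc n)"
          by (auto simp: H_def D_def Up_def Dn_def)
        then show "\<omega> \<in> E" by (auto simp: E_def)
      qed
      have H: "ennreal (1 - e) * emeasure (M x) (G (- B) n) \<le> emeasure (M x) (H n)" for n
      proof -
        have "G (- B) n \<subseteq> G {R..} n \<union> G {..-R} n" by (auto simp: Gmem B_def)
        then have "emeasure (M x) (G (- B) n) \<le> emeasure (M x) (G {R..} n \<union> G {..-R} n)"
          by (intro emeasure_mono sets.Un G) auto
        also have "\<dots> \<le> emeasure (M x) (G {R..} n) + emeasure (M x) (G {..-R} n)"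
          by (intro emeasure_subadditive G) auto
        finally have "ennreal (1 - e) * emeasure (M x) (G (- B) n)
          \<le> ennreal (1 - e) * (emeasure (M x) (G {R..} n) + emeasure (M x) (G {..-R} n))"
          by (rule mult_left_mono) simp
        also have "\<dots> \<le> emeasure (M x) (D {R..} {r..} n) + emeasure (M x) (D {..-R} {..-r} n)"
          unfolding distrib_left by (intro add_mono Dp Dm)
        also have "\<dots> = emeasure (M x) (H n)"
        proof -
          have "D {R..} {r..} n \<inter> D {..-R} {..-r} n = {}"
            using R(1) r by (auto simp: DG Gmem)
          then show ?thesis unfolding H_def by (intro plus_emeasure Dp Dm)
        qed
        finally show ?thesis .
      qed
      have "1 = emeasure (M x) (\<Union>n. G (- B) n)"
      proof -
        have "AE \<omega> in M x. \<omega> \<in> (\<Union>n. G (- B) n)"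
          using AE_exit_ball[OF x N, of R]
          by eventually_elim (auto simp: Gmem B_def not_less)
        then have "prob (\<Union>n. G (- B) n) = 1"
          by (subst prob_eq_1) (use G in auto)
        then show ?thesis by (simp add: emeasure_eq_measure)
      qed
      also have "\<dots> \<le> (\<Sum>n. emeasure (M x) (G (- B) n))"
        by (rule emeasure_subadditive_countably) (use G in auto)
      finally have "ennreal (1 - e) * 1 \<le> ennreal (1 - e) * (\<Sum>n. emeasure (M x) (G (- B) n))"
        by (rule mult_left_mono) simp
      also have "\<dots> = (\<Sum>n. ennreal (1 - e) * emeasure (M x) (G (- B) n))" by simp
      also have "\<dots> \<le> (\<Sum>n. emeasure (M x) (H n))"
        by (rule suminf_le[OF H]) (auto intro: summableI)
      also have "\<dots> = emeasure (M x) (\<Union>n. H n)"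
        by (rule suminf_emeasure[OF _ disj]) (use Dp Dm in \<open>auto simp: H_def\<close>)
      also have "\<dots> \<le> emeasure (M x) E" by (rule emeasure_mono[OF HE E])
      finally show ?thesis using e by (simp add: emeasure_eq_measure)
    qed
    note E_ge = this
    have "1 \<le> prob E"
    proof (rule field_le_epsilon)
      fix e :: real assume "0 < e"
      then have "1 - min e (1 / 2) \<le> prob E" by (intro E_ge) auto
      then show "1 \<le> prob E + e" by simp
    qed
    then have "prob E = 1" by (simp add: antisym)
    then have "AE \<omega> in M x. \<omega> \<in> E" using prob_eq_1[OF E] by simp
    then show ?thesis by eventually_elim (auto simp: E_def)
  qed
  have "AE \<omega> in M x. \<forall>j::nat. \<exists>n. \<omega> \<in> Up (real (Suc j)) n \<or> \<omega> \<in> Dn (real (Suc j)) n"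
    unfolding AE_all_countable by (intro allI main) simp
  then show "AE \<omega> in M x. filterlim (\<lambda>n. \<omega> !! n) at_top sequentially \<or> filterlim (\<lambda>n. \<omega> !! n) at_bot sequentially"
  proof eventually_elim
    case (elim \<omega>)
    then have ex: "\<exists>n. \<omega> \<in> Up (real (Suc j)) n \<or> \<omega> \<in> Dn (real (Suc j)) n" for j by blast
    \<comment> \<open>Being eventually above a positive level excludes being eventually below a
      negative one, so the side found for the first level is the side for all levels.\<close>
    have clash: False if "\<omega> \<in> Up (real (Suc j)) n" "\<omega> \<in> Dn (real (Suc i)) m" for i j n m
    proof -
      have "real (Suc j) \<le> \<omega> !! (max n m)" "\<omega> !! (max n m) \<le> - real (Suc i)"
        using that by (auto simp: Up_def Dn_def)
      then show False by simp
    qed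
    obtain n0 where "\<omega> \<in> Up (real (Suc 0)) n0 \<or> \<omega> \<in> Dn (real (Suc 0)) n0" using ex by blast
    then show ?case
    proof
      assume up: "\<omega> \<in> Up (real (Suc 0)) n0"
      have "eventually (\<lambda>k. Z \<le> \<omega> !! k) sequentially" for Z
      proof -
        obtain j where j: "Z \<le> real j" using real_arch_simple by blast
        obtain n where "\<omega> \<in> Up (real (Suc j)) n" using ex[of j] clash[OF up] by blast
        then have "Z \<le> \<omega> !! k" if "n \<le> k" for k using that j by (fastforce simp: Up_def)
        then show ?thesis by (auto simp: eventually_sequentially)
      qed
      then show ?case by (simp add: filterlim_at_top)
    next
      assume dn: "\<omega> \<in> Dn (real (Suc 0)) n0"
      have "eventually (\<lambda>k. \<omega> !! k \<le> Z) sequentially" for Z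
      proof -
        obtain j where j: "- Z \<le> real j" using real_arch_simple by blast
        obtain n where "\<omega> \<in> Dn (real (Suc j)) n" using ex[of j] clash[OF _ dn] by blast
        then have "\<omega> !! k \<le> Z" if "n \<le> k" for k using that j by (fastforce simp: Dn_def)
        then show ?thesis by (auto simp: eventually_sequentially)
      qed
      then show ?case by (simp add: filterlim_at_bot)
    qed
  qed
qed

end

section \<open>Pointwise inequalities for one step\<close>

definition log_gap :: "real \<Rightarrow> real" where "log_gap u = u - ln (1 + u)"

lemma log_gap_0 [simp]: "log_gap 0 = 0"
  by (simp add: log_gap_def)

lemma log_gap_nonneg: "0 \<le> u \<Longrightarrow> 0 \<le> log_gap u"
  using ln_add_one_self_le_self[of u] by (simp add: log_gap_def)

lemma log_gap_measurable [measurable]: "log_gap \<in> borel_measurable borel"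
  unfolding log_gap_def by measurable

lemma DERIV_log_gap: "u > -1 \<Longrightarrow> (log_gap has_real_derivative u / (1 + u)) (at u)"
  unfolding log_gap_def by (auto intro!: derivative_eq_intros simp: field_simps)

lemma nonneg_by_deriv:
  fixes f :: "real \<Rightarrow> real"
  assumes "a \<le> b" "0 \<le> f a"
    "\<And>x. a \<le> x \<Longrightarrow> x \<le> b \<Longrightarrow> (f has_real_derivative f' x) (at x)"
    "\<And>x. a \<le> x \<Longrightarrow> x \<le> b \<Longrightarrow> 0 \<le> f' x"
  shows "0 \<le> f b"
proof -
  have "f a \<le> f b"
    by (rule DERIV_nonneg_imp_nondecreasing[OF assms(1)]) (use assms in blast)
  then show ?thesis using assms(2) by simp
qed

lemma square_le_log_gap:
  assumes "0 \<le> u" "u \<le> 1" shows "u\<^sup>2 \<le> 6 * log_gap u"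
proof -
  have "0 \<le> 6 * log_gap u - u\<^sup>2"
  proof (rule nonneg_by_deriv[where a = 0 and f = "\<lambda>u. 6 * log_gap u - u\<^sup>2"
      and f' = "\<lambda>u. 6 * (u / (1 + u)) - 2 * u"])
    fix x :: real assume x: "0 \<le> x" "x \<le> u"
    show "((\<lambda>u. 6 * log_gap u - u\<^sup>2) has_real_derivative 6 * (x / (1 + x)) - 2 * x) (at x)"
      by (rule derivative_eq_intros DERIV_log_gap refl | use x in simp)+
    have "2 * x * (1 + x) \<le> 2 * x * 3" using x assms by (intro mult_left_mono) auto
    then show "0 \<le> 6 * (x / (1 + x)) - 2 * x" using x by (simp add: field_simps)
  qed (use assms in auto)
  then show ?thesis by simp
qed

lemma self_le_log_gap:
  assumes "1 \<le> u" shows "u \<le> 6 * log_gap u"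
proof -
  have "0 \<le> 6 * log_gap u - u"
  proof (rule nonneg_by_deriv[where a = 1 and f = "\<lambda>u. 6 * log_gap u - u"
      and f' = "\<lambda>u. 6 * (u / (1 + u)) - 1"])
    fix x :: real assume x: "1 \<le> x" "x \<le> u"
    show "((\<lambda>u. 6 * log_gap u - u) has_real_derivative 6 * (x / (1 + x)) - 1) (at x)"
      by (rule derivative_eq_intros DERIV_log_gap refl | use x in simp)+
    show "0 \<le> 6 * (x / (1 + x)) - 1" using x by (simp add: field_simps)
  qed (use assms square_le_log_gap[of 1] in auto)
  then show ?thesis by simp
qed

text \<open>The coefficient \<open>\<nu> * (1 + \<nu>)\<close> is exact to second order at 0, where
  \<open>log_gap u\<close> is about half of \<open>u\<^sup>2\<close>. Its ratio to the linear
  coefficient \<nu> tends to 1 as \<nu> tends to 0, and this is why transience reaches the same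
  critical constant as the logarithm.\<close>

lemma powr_minus_le_log_gap:
  assumes "0 \<le> u" "0 \<le> \<nu>"
  shows "(1 + u) powr - \<nu> \<le> 1 - \<nu> * u + \<nu> * (1 + \<nu>) * log_gap u"
proof -
  let ?f = "\<lambda>u. 1 - \<nu> * u + \<nu> * (1 + \<nu>) * log_gap u - (1 + u) powr - \<nu>"
  have "0 \<le> ?f u"
  proof (rule nonneg_by_deriv[where a = 0 and f = ?f
      and f' = "\<lambda>x. - \<nu> + \<nu> * (1 + \<nu>) * (x / (1 + x)) + \<nu> * (1 + x) powr (- \<nu> - 1)"])
    fix x :: real assume x: "0 \<le> x" "x \<le> u"
    show "(?f has_real_derivative - \<nu> + \<nu> * (1 + \<nu>) * (x / (1 + x)) + \<nu> * (1 + x) powr (- \<nu> - 1)) (at x)"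
      by (rule derivative_eq_intros DERIV_log_gap refl | use x in simp)+
    \<comment> \<open>The derivative in question is \<nu> times
      \<open>(1 + x) powr (- \<nu> - 1) - (1 - \<nu> * x) / (1 + x)\<close>, so it is enough to have
      the tangent bound \<open>1 - \<nu> * x \<le> (1 + x) powr - \<nu>\<close>.\<close>
    have "\<nu> * ln (1 + x) \<le> \<nu> * x"
      using x assms ln_add_one_self_le_self[of x] by (intro mult_left_mono) auto
    then have "1 - \<nu> * x \<le> (1 + x) powr - \<nu>"
      using exp_ge_add_one_self[of "- \<nu> * ln (1 + x)"] x by (simp add: powr_def)
    then have "(1 - \<nu> * x) / (1 + x) \<le> (1 + x) powr (- \<nu> - 1)"
      using x by (simp add: powr_diff divide_right_mono)
    then have "0 \<le> \<nu> * ((1 + x) powr (- \<nu> - 1) - (1 - \<nu> * x) / (1 + x))"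
      using assms by simp
    also have "\<dots> = - \<nu> + \<nu> * (1 + \<nu>) * (x / (1 + x)) + \<nu> * (1 + x) powr (- \<nu> - 1)"
      using x by (simp add: field_simps)
    finally show "0 \<le> - \<nu> + \<nu> * (1 + \<nu>) * (x / (1 + x)) + \<nu> * (1 + x) powr (- \<nu> - 1)" .
  qed (use assms in auto)
  then show ?thesis by simp
qed

text \<open>For inward jumps of at most half the distance only the linear coefficient has to be
  sharp. The crude constant 4 absorbs the losses in \<open>- ln (1 - u) \<le> u + u\<^sup>2\<close>
  and \<open>exp v \<le> 1 + v + v\<^sup>2\<close>.\<close>

lemma powr_minus_le_quadratic:
  assumes u: "0 \<le> u" "u \<le> 1 / 2" and \<nu>: "0 \<le> \<nu>" "\<nu> \<le> 1"
  shows "(1 - u :: real) powr - \<nu> \<le> 1 + \<nu> * u + 4 * u\<^sup>2"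
proof -
  have u2: "u\<^sup>2 \<le> u / 2" using u using mult_left_mono[of u "1/2" u] by (simp add: power2_eq_square)
  define v where "v = \<nu> * (u + u\<^sup>2)"
  have v: "0 \<le> v" "v \<le> 1" "v \<le> 3 / 2 * u" 
  proof -
    have "\<nu> * (u + u\<^sup>2) \<le> 1 * (u + u\<^sup>2)" using \<nu> u by (intro mult_right_mono) auto
    then show "v \<le> 1" "v \<le> 3 / 2 * u" using u2 u by (auto simp: v_def)
  qed (use u \<nu> in \<open>auto simp: v_def\<close>)
  have "- ln (1 - u) \<le> u + u\<^sup>2"
  proof -
    have "0 \<le> u + u\<^sup>2 + ln (1 - u)"
    proof (rule nonneg_by_deriv[where a = 0 and f = "\<lambda>u. u + u\<^sup>2 + ln (1 - u)"
        and f' = "\<lambda>u. 1 + 2 * u - 1 / (1 - u)"])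
      fix x :: real assume x: "0 \<le> x" "x \<le> u"
      show "((\<lambda>u. u + u\<^sup>2 + ln (1 - u)) has_real_derivative 1 + 2 * x - 1 / (1 - x)) (at x)"
        using x u by (auto intro!: derivative_eq_intros)
      have "0 \<le> x * (1 - 2 * x)" using x u by auto
      then show "0 \<le> 1 + 2 * x - 1 / (1 - x)" using x u by (simp add: field_simps)
    qed (use u in auto)
    then show ?thesis by simp
  qed
  then have "- \<nu> * ln (1 - u) \<le> v"
    using mult_left_mono[of "- ln (1 - u)" "u + u\<^sup>2" \<nu>] \<nu> by (simp add: v_def)
  then have "(1 - u) powr - \<nu> \<le> exp v" using u by (simp add: powr_def)
  also have "\<dots> \<le> 1 + v + v\<^sup>2" by (rule exp_bound) (use v in auto)
  also have "v\<^sup>2 \<le> (3 / 2 * u)\<^sup>2" using v by (intro power_mono) auto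
  also have "1 + v + (3 / 2 * u)\<^sup>2 \<le> 1 + \<nu> * u + 4 * u\<^sup>2"
  proof -
    have "\<nu> * u\<^sup>2 \<le> 1 * u\<^sup>2" using \<nu> by (intro mult_right_mono) auto
    then have "v + (3 / 2 * u)\<^sup>2 \<le> \<nu> * u + u\<^sup>2 + 9 / 4 * u\<^sup>2"
      by (simp add: v_def distrib_left power2_eq_square)
    moreover have "(3 / 2 * u)\<^sup>2 = 9 / 4 * u\<^sup>2" by (simp add: power_mult_distrib power_divide)
    moreover have "0 \<le> u\<^sup>2" by simp
    ultimately show ?thesis by linarith
  qed
  finally show ?thesis by simp
qed

lemma square_le_powr:
  assumes "\<bar>u\<bar> \<le> (1::real)" "0 < q" "q \<le> 2" shows "u\<^sup>2 \<le> \<bar>u\<bar> powr q"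
proof (cases "u = 0")
  case False
  have "u\<^sup>2 = \<bar>u\<bar> powr 2" using False powr_numeral[of "\<bar>u\<bar>" "num.Bit0 num.One"] by simp
  also have "\<dots> \<le> \<bar>u\<bar> powr q" using assms False by (intro powr_mono') auto
  finally show ?thesis .
qed (use assms in simp)

lemma powr_le_linear:
  assumes "0 \<le> s" "s \<le> 1" "-1 \<le> (u::real)" shows "(1 + u) powr s \<le> 1 + s * u"
proof (cases "u = -1")
  case False
  then have "(1 + u) powr s * 1 powr (1 - s) \<le> s * (1 + u) + (1 - s) * 1"
    by (intro Youngs_inequality_0) (use assms in auto)
  then show ?thesis by (simp add: algebra_simps)
qed (use assms in simp)

text \<open>Bernoulli's inequality on the whole line. Where the left side is positive, it is the
  concave inequality with exponent \<open>1 / p\<close> at the point \<open>p * u\<close>, raised to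
  the power \<open>p\<close>.\<close>

lemma abs_powr_ge_linear:
  assumes "1 \<le> (p::real)" shows "1 + p * u \<le> \<bar>1 + u\<bar> powr p"
proof (cases "1 + p * u \<le> 0")
  case False
  have "-1 \<le> u"
  proof (rule ccontr)
    assume "\<not> -1 \<le> u"
    then have "p * u \<le> 1 * u" using assms by (intro mult_right_mono_neg) auto
    with \<open>\<not> -1 \<le> u\<close> False show False by simp
  qed
  have "(1 + p * u) powr (1 / p) \<le> 1 + 1 / p * (p * u)"
    by (rule powr_le_linear) (use assms False in auto)
  then have "((1 + p * u) powr (1 / p)) powr p \<le> (1 + u) powr p"
    using assms by (intro powr_mono2) auto
  then show ?thesis using assms False \<open>-1 \<le> u\<close> by (simp add: powr_powr)
qed (use order_trans in \<open>fastforce\<close>)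

text \<open>The freedom in \<open>q\<close> is the point: near 0 the error is quadratic and
  \<open>q \<le> 2\<close> suffices, for large \<open>u\<close> the growth is of order
  \<open>p \<le> q\<close>. Later \<open>q\<close> is taken below \<alpha>, where the moment is
  finite.\<close>

lemma abs_powr_le_linear_plus:
  assumes p: "1 \<le> (p::real)" "p \<le> 2" and q: "p \<le> q" "q \<le> 2"
  shows "\<bar>1 + u\<bar> powr p \<le> 1 + p * u + 4 * \<bar>u\<bar> powr q"
proof -
  consider "\<bar>u\<bar> \<le> 1" | "u > 1" | "u < -1" by linarith
  then show ?thesis
  proof cases
    case 1
    show ?thesis
    proof (cases "u = -1")
      case False
      then have u: "0 < 1 + u" using 1 by auto
      have "\<bar>1 + u\<bar> powr p = (1 + u) * (1 + u) powr (p - 1)"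
        using u by (simp add: powr_diff)
      also have "\<dots> \<le> (1 + u) * (1 + (p - 1) * u)"
        by (intro mult_left_mono powr_le_linear) (use p u in auto)
      also have "\<dots> = 1 + p * u + (p - 1) * u\<^sup>2" by (simp add: algebra_simps power2_eq_square)
      also have "(p - 1) * u\<^sup>2 \<le> 4 * u\<^sup>2" using p by (intro mult_right_mono) auto
      also have "u\<^sup>2 \<le> \<bar>u\<bar> powr q" using 1 p q by (intro square_le_powr) auto
      finally show ?thesis by simp
    qed (use p in simp)
  next
    case 2
    have "\<bar>1 + u\<bar> powr p \<le> (2 * u) powr p" using 2 p by (intro powr_mono2) auto
    also have "\<dots> = 2 powr p * u powr p" using 2 by (simp add: powr_mult)
    also have "\<dots> \<le> 2 powr 2 * u powr q" using 2 p q by (intro mult_mono powr_mono) auto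
    finally show ?thesis using 2 p by (simp add: add_increasing)
  next
    case 3
    have "\<bar>1 + u\<bar> powr p \<le> \<bar>u\<bar> powr p" using 3 p by (intro powr_mono2) auto
    also have "\<dots> \<le> \<bar>u\<bar> powr q" using 3 q by (intro powr_mono) auto
    finally have a: "\<bar>1 + u\<bar> powr p \<le> \<bar>u\<bar> powr q" .
    have "\<bar>u\<bar> powr 1 \<le> \<bar>u\<bar> powr q" using 3 p q by (intro powr_mono) auto
    then have b: "\<bar>u\<bar> \<le> \<bar>u\<bar> powr q" by simp
    have "p * (-u) \<le> 2 * (-u)" using 3 p by (intro mult_right_mono) auto
    then show ?thesis using a b 3 by linarith
  qed
qed

lemma abs_abs_powr_minus_one:
  assumes p: "1 \<le> (p::real)" "p \<le> 2" and u: "\<bar>u\<bar> \<le> 1"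
  shows "\<bar>\<bar>1 + u\<bar> powr p - 1\<bar> \<le> 3 * \<bar>u\<bar>"
proof -
  have "1 + p * u \<le> \<bar>1 + u\<bar> powr p" by (rule abs_powr_ge_linear) fact
  moreover have "\<bar>1 + u\<bar> powr p \<le> 1 + 3 * \<bar>u\<bar>"
  proof (cases "u \<ge> 0")
    case True
    have "\<bar>1 + u\<bar> powr p \<le> \<bar>1 + u\<bar> powr 2" using True p by (intro powr_mono) auto
    also have "\<dots> = 1 + 2 * u + u * u" using True by (simp add: power2_eq_square algebra_simps)
    also have "u * u \<le> 1 * u" using True u by (intro mult_right_mono) auto
    finally show ?thesis using True by simp
  next
    case False
    have "\<bar>1 + u\<bar> powr p \<le> 1 powr p" using False p u by (intro powr_mono2) auto
    then show ?thesis using False by simp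
  qed
  moreover have "\<bar>p * u\<bar> \<le> 3 * \<bar>u\<bar>" unfolding abs_mult using p by (intro mult_right_mono) auto
  ultimately show ?thesis by linarith
qed

section \<open>The test functions after one jump\<close>

lemma theta_measurable [measurable]: "theta \<in> borel_measurable (stream_space borel)"
  unfolding theta_def by measurable

lemma pos_part_r_measurable [measurable]: "pos_part_r \<in> borel_measurable borel"
  unfolding pos_part_r_def by measurable

lemma neg_part_r_measurable [measurable]: "neg_part_r \<in> borel_measurable borel"
  unfolding neg_part_r_def by measurable

lemma neg_part_r_simps: "z \<ge> 0 \<Longrightarrow> neg_part_r z = 0" "z < 0 \<Longrightarrow> neg_part_r z = - z"
  by (auto simp: neg_part_r_def)

text \<open>Outward jumps give equality. An inward jump of relative size \<open>v = w / t\<close>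
  with \<open>t - w \<ge> 1\<close> needs no correction, by \<open>ln (1 - v) \<le> - v\<close>. One
  that crosses the origin has \<open>v > 1\<close>; there the bound obtained grows like
  \<open>v\<close> instead of falling, and twice \<open>v powr \<beta> \<ge> v\<close> makes up for
  the wrong sign.\<close>

lemma ln_abs_step:
  assumes t: "3 \<le> t" and \<beta>: "1 \<le> \<beta>"
  shows "ln (max 1 \<bar>t + z\<bar>) \<le> ln t + z / t - log_gap (max 0 z / t) + 2 * (neg_part_r z / t) powr \<beta>"
proof (cases "z \<ge> 0")
  case True
  have "ln (t + z) = ln (t * (1 + z / t))" using t by (simp add: distrib_left)
  also have "\<dots> = ln t + ln (1 + z / t)" using t True by (intro ln_mult_pos) (auto simp: add_pos_nonneg)
  finally show ?thesis using True t by (simp add: log_gap_def neg_part_r_simps max_def)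
next
  case False
  define w where "w = - z"
  have w: "w > 0" and z: "z = - w" using False by (auto simp: w_def)
  \<comment> \<open>This is the purpose of \<open>3 \<le> t\<close>: where the cut-off at 1 is
    active the left side is 0, and \<open>ln t \<ge> 1 \<ge> w / t\<close> keeps the right side
    nonnegative.\<close>
  have lnt: "1 \<le> ln t" using t exp_le by (subst ln_ge_iff) auto
  have "ln (max 1 \<bar>t - w\<bar>) \<le> ln t - w / t + 2 * (w / t) powr \<beta>"
  proof (cases "w \<le> t")
    case le: True
    have wt: "w / t \<le> 1" using le t by simp
    show ?thesis
    proof (cases "t - w \<ge> 1")
      case True
      have "ln (t - w) = ln (t * (1 - w / t))" using t by (simp add: right_diff_distrib)
      also have "\<dots> = ln t + ln (1 - w / t)"
        using t True by (intro ln_mult_pos) (auto simp: field_simps)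
      also have "ln (1 - w / t) \<le> - (w / t)"
        using ln_add_one_self_le_self2[of "- (w / t)"] True t by (auto simp: field_simps)
      finally show ?thesis using True by (simp add: max_def add_increasing2)
    next
      case False
      then have "max 1 \<bar>t - w\<bar> = 1" using le by auto
      then have "ln (max 1 \<bar>t - w\<bar>) = 0" by simp
      moreover have "0 \<le> (w / t) powr \<beta>" by simp
      ultimately show ?thesis using lnt wt by linarith
    qed
  next
    case False
    have "ln (max 1 \<bar>t - w\<bar>) \<le> ln w" using False t by (intro ln_mono) auto
    also have "ln w = ln (t * (w / t))" using t by simp
    also have "\<dots> = ln t + ln (w / t)" using t w by (intro ln_mult_pos) auto
    also have "ln (w / t) \<le> w / t - 1" using t w by (intro ln_le_minus_one) auto
    finally have *: "ln (max 1 \<bar>t - w\<bar>) \<le> ln t + (w / t - 1)" by simp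
    have "(w / t) powr 1 \<le> (w / t) powr \<beta>" using False t \<beta> by (intro powr_mono) auto
    then have "w / t \<le> (w / t) powr \<beta>" using False t by simp
    with * show ?thesis by linarith
  qed
  then show ?thesis using w t by (simp add: z neg_part_r_simps)
qed

text \<open>The function is frozen at 1 below level 1, so a jump to the other side costs at most 1
  whatever its size. The inward error carries no factor \<open>t powr - \<nu>\<close>, which later
  limits the size of \<nu>.\<close>

lemma negative_powr_step:
  assumes t: "2 \<le> t" and \<beta>: "0 < \<beta>" "\<beta> \<le> 2" and \<nu>: "0 \<le> \<nu>" "\<nu> \<le> 1"
  shows "(if t + z \<ge> 1 then (t + z) powr - \<nu> else 1)
    \<le> t powr - \<nu> * (1 - \<nu> * (z / t) + \<nu> * (1 + \<nu>) * log_gap (max 0 z / t))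
      + 8 * (neg_part_r z / t) powr \<beta>" (is "?l \<le> _")
proof (cases "z \<ge> 0")
  case True
  have "(t + z) powr - \<nu> = (t * (1 + z / t)) powr - \<nu>" using t by (simp add: distrib_left)
  also have "\<dots> = t powr - \<nu> * (1 + z / t) powr - \<nu>" using t True by (simp add: powr_mult)
  also have "\<dots> \<le> t powr - \<nu> * (1 - \<nu> * (z / t) + \<nu> * (1 + \<nu>) * log_gap (z / t))"
    using t True \<nu> by (intro mult_left_mono powr_minus_le_log_gap) auto
  finally show ?thesis using True t by (simp add: neg_part_r_simps)
next
  case False
  define w where "w = - z"
  have w: "w > 0" and z: "z = - w" using False by (auto simp: w_def)
  have tn: "t powr - \<nu> \<le> 1" using t \<nu> powr_mono[of "-\<nu>" 0 t] by simp
  have le1: "?l \<le> 1"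
    using powr_mono[of "-\<nu>" 0 "t + z"] \<nu> by auto
  have "?l \<le> t powr - \<nu> * (1 + \<nu> * (w / t)) + 8 * (w / t) powr \<beta>"
  proof (cases "w / t \<le> 1 / 2")
    case True
    then have "t - w \<ge> 1" using t by (auto simp: field_simps)
    then have "?l = (t * (1 - w / t)) powr - \<nu>" using t by (simp add: right_diff_distrib z)
    also have "\<dots> = t powr - \<nu> * (1 - w / t) powr - \<nu>" by (rule powr_mult)
    also have "\<dots> \<le> t powr - \<nu> * (1 + \<nu> * (w / t) + 4 * (w / t)\<^sup>2)"
      using t w True \<nu> by (intro mult_left_mono powr_minus_le_quadratic) auto
    also have "\<dots> = t powr - \<nu> * (1 + \<nu> * (w / t)) + t powr - \<nu> * (4 * (w / t)\<^sup>2)"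
      by (simp add: distrib_left)
    also have "t powr - \<nu> * (4 * (w / t)\<^sup>2) \<le> 1 * (4 * (w / t) powr \<beta>)"
      using square_le_powr[of "w / t" \<beta>] tn True t w \<beta> by (intro mult_mono) auto
    also have "\<dots> \<le> 8 * (w / t) powr \<beta>" by simp
    finally show ?thesis by simp
  next
    case False
    \<comment> \<open>A jump of more than half the distance leaves the function at most 1, while
      \<open>(w / t) powr \<beta>\<close> is at least \<open>(1 / 2) powr 2 = 1 / 4\<close>.\<close>
    have "1 = 4 * (1 / 2) powr (2::real)" by (simp add: power2_eq_square)
    also have "\<dots> \<le> 4 * (1 / 2) powr \<beta>" using \<beta> by (intro mult_left_mono powr_mono') auto
    also have "\<dots> \<le> 8 * (w / t) powr \<beta>" using False \<beta> by (intro mult_mono powr_mono2) auto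
    finally have "?l \<le> 8 * (w / t) powr \<beta>" using le1 by linarith
    moreover have "0 \<le> t powr - \<nu> * (1 + \<nu> * (w / t))" using \<nu> w t by simp
    ultimately show ?thesis by linarith
  qed
  then show ?thesis using w t by (simp add: z neg_part_r_simps)
qed

lemma abs_powr_step:
  fixes t z :: real
  assumes t: "0 < t" and pq: "1 \<le> p" "p \<le> q" "q \<le> 2"
  shows "\<bar>t + z\<bar> powr p \<le> t powr p + p * t powr (p - 1) * z + 4 * t powr (p - q) * \<bar>z\<bar> powr q"
proof -
  have "\<bar>t + z\<bar> powr p = (t * \<bar>1 + z / t\<bar>) powr p"
    using t abs_mult[of t "1 + z / t"] by (simp add: distrib_left)
  also have "\<dots> = t powr p * \<bar>1 + z / t\<bar> powr p" using t by (simp add: powr_mult)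
  also have "\<dots> \<le> t powr p * (1 + p * (z / t) + 4 * \<bar>z / t\<bar> powr q)"
    using pq by (intro mult_left_mono abs_powr_le_linear_plus) auto
  also have "\<dots> = t powr p + p * t powr (p - 1) * z + 4 * t powr (p - q) * \<bar>z\<bar> powr q"
    using t by (simp add: powr_diff powr_divide algebra_simps)
  finally show ?thesis .
qed

text \<open>The truncation \<open>s / (1 + e s)\<close> of \<open>s = |x|\<^sup>p\<close> keeps the second-order error of size
  \<open>t\<^sup>p min(u\<^sup>2, |u|)\<close> uniformly in \<open>e\<close>.\<close>

lemma truncated_powr_step:
  fixes t z :: real
  assumes t: "0 < t" and p: "1 \<le> p" "p \<le> \<beta>" "\<beta> \<le> 2" and e: "0 \<le> e"
  defines "f \<equiv> \<lambda>x. \<bar>x\<bar> powr p / (1 + e * \<bar>x\<bar> powr p)"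
  defines "A \<equiv> 1 / (1 + e * t powr p)\<^sup>2"
  shows "f t + A * p * t powr (p - 1) * z
    \<le> f (t + z) + 54 * t powr p * log_gap (max 0 z / t) + 9 * t powr p * (neg_part_r z / t) powr \<beta>"
proof -
  define s where "s = t powr p"
  define u where "u = z / t"
  have s: "s > 0" using t by (simp add: s_def)
  define s' where "s' = s * \<bar>1 + u\<bar> powr p"
  have s': "s' \<ge> 0" using s by (simp add: s'_def)
  have z: "z = t * u" using t by (simp add: u_def)
  have "\<bar>t + z\<bar> = t * \<bar>1 + u\<bar>" using t abs_mult[of t "1 + u"] by (simp add: z distrib_left)
  then have tz: "\<bar>t + z\<bar> powr p = s'" using t by (simp add: powr_mult s'_def s_def)
  have ft: "f t = s / (1 + e * s)" "f (t + z) = s' / (1 + e * s')"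
    using t by (auto simp: f_def s_def tz)
  have "1 \<le> (1 + e * s)\<^sup>2" using e s by (intro one_le_power) auto
  then have A: "0 \<le> A" "A \<le> 1" by (auto simp: A_def s_def[symmetric] divide_le_eq_1)
  have lin: "A * p * t powr (p - 1) * z = A * (p * s * u)"
    using t by (simp add: z s_def powr_diff)
  have gz: "log_gap (max 0 z / t) = log_gap (max 0 u)" "neg_part_r z / t = neg_part_r u"
    using t by (auto simp: u_def max_def neg_part_r_def zero_le_divide_iff divide_less_0_iff)
  have g0: "0 \<le> log_gap (max 0 u)" by (rule log_gap_nonneg) auto
  have pos: "1 + e * s > 0" "1 + e * s' > 0" using e s s' by (auto simp: add_pos_nonneg)
  have "f t + A * (p * s * u) \<le> f (t + z) + s * (54 * log_gap (max 0 u) + 9 * neg_part_r u powr \<beta>)"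
  proof -
    consider "\<bar>u\<bar> \<le> 1" | "u > 1" | "u < -1" by linarith
    then show ?thesis
    proof cases
      case 1
      define d where "d = s' - s"
      have d1: "p * s * u \<le> d"
        using mult_left_mono[OF abs_powr_ge_linear[OF p(1), of u], of s] s
        by (simp add: d_def s'_def algebra_simps)
      have "\<bar>d\<bar> = s * \<bar>\<bar>1 + u\<bar> powr p - 1\<bar>"
        using s abs_mult[of s "\<bar>1 + u\<bar> powr p - 1"] by (simp add: d_def s'_def algebra_simps)
      also have "\<dots> \<le> s * (3 * \<bar>u\<bar>)"
        using s p 1 by (intro mult_left_mono abs_abs_powr_minus_one) auto
      finally have "\<bar>d\<bar>\<^sup>2 \<le> (s * (3 * \<bar>u\<bar>))\<^sup>2" by (intro power_mono) auto
      then have d2: "d\<^sup>2 \<le> 9 * s\<^sup>2 * u\<^sup>2" by (simp add: power_mult_distrib)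
      have "f (t + z) - f t = d / ((1 + e * s) * (1 + e * s'))"
        using pos by (simp add: ft d_def field_simps)
      \<comment> \<open>\<open>A\<close> is the derivative of \<open>s / (1 + e * s)\<close>, and
        the second-order remainder is exact here. Its bound contains a factor \<open>e * s\<close>,
        which the denominator absorbs; this gives uniformity in \<open>e\<close>.\<close>
      also have "\<dots> = A * d - e * d\<^sup>2 / ((1 + e * s)\<^sup>2 * (1 + e * s'))"
      proof -
        have "A * d - e * d\<^sup>2 / ((1 + e * s)\<^sup>2 * (1 + e * s'))
          = d * ((1 + e * s') - e * d) / ((1 + e * s)\<^sup>2 * (1 + e * s'))"
          using pos by (simp add: A_def s_def[symmetric] divide_simps power2_eq_square) (simp add: algebra_simps)
        also have "(1 + e * s') - e * d = 1 + e * s" by (simp add: d_def algebra_simps)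
        also have "d * (1 + e * s) / ((1 + e * s)\<^sup>2 * (1 + e * s')) = d / ((1 + e * s) * (1 + e * s'))"
          using pos by (simp add: power2_eq_square)
        finally show ?thesis by simp
      qed
      finally have fd: "f (t + z) - f t = A * d - e * d\<^sup>2 / ((1 + e * s)\<^sup>2 * (1 + e * s'))" .
      have "e * d\<^sup>2 / ((1 + e * s)\<^sup>2 * (1 + e * s')) \<le> s * (9 * u\<^sup>2)"
      proof -
        have "e * d\<^sup>2 \<le> e * (9 * s\<^sup>2 * u\<^sup>2)" using d2 e by (intro mult_left_mono) auto
        also have "\<dots> = (e * s) * (s * (9 * u\<^sup>2))" by (simp add: power2_eq_square)
        also have "\<dots> \<le> ((1 + e * s)\<^sup>2 * (1 + e * s')) * (s * (9 * u\<^sup>2))"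
        proof (intro mult_right_mono)
          have "e * s * 1 \<le> (1 + e * s)\<^sup>2 * (1 + e * s')"
            using e s s' by (intro mult_mono) (auto simp: power2_eq_square algebra_simps)
          then show "e * s \<le> (1 + e * s)\<^sup>2 * (1 + e * s')" by simp
        qed (use s in auto)
        finally show ?thesis using pos by (simp add: pos_divide_le_eq mult.commute)
      qed
      moreover have "9 * u\<^sup>2 \<le> 54 * log_gap (max 0 u) + 9 * neg_part_r u powr \<beta>"
      proof (cases "u \<ge> 0")
        case True
        then show ?thesis using square_le_log_gap[of u] 1 by (simp add: neg_part_r_simps)
      next
        case False
        then show ?thesis using square_le_powr[of u \<beta>] 1 p by (simp add: neg_part_r_simps)
      qed
      then have "s * (9 * u\<^sup>2) \<le> s * (54 * log_gap (max 0 u) + 9 * neg_part_r u powr \<beta>)"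
        using s by (intro mult_left_mono) auto
      moreover have "A * (p * s * u) \<le> A * d" using A d1 by (intro mult_left_mono) auto
      ultimately show ?thesis using fd by linarith
    next
      case 2
      \<comment> \<open>An outward jump longer than \<open>t\<close> only raises \<open>f\<close>,
        so the whole linear term can be charged to \<open>log_gap\<close>, which is at least
        \<open>u / 6\<close> there.\<close>
      have "s \<le> s'"
        using mult_left_mono[OF ge_one_powr_ge_zero[of "1 + u" p], of s] s p 2 by (simp add: s'_def)
      then have "s / (1 + e * s) \<le> s' / (1 + e * s')" using pos by (simp add: field_simps)
      then have "f t \<le> f (t + z)" by (simp add: ft)
      moreover have "A * (p * s * u) \<le> 1 * (p * s * u)"
        using A p s 2 by (intro mult_right_mono) auto
      moreover have "p * s * u \<le> s * (54 * log_gap (max 0 u))"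
      proof -
        have "p * s * u \<le> 9 * s * u" using p s 2 by (intro mult_right_mono) auto
        also have "\<dots> \<le> 9 * s * (6 * log_gap u)" using s 2 self_le_log_gap[of u] by (intro mult_left_mono) auto
        finally show ?thesis using 2 by simp
      qed
      ultimately show ?thesis using 2 by (simp add: neg_part_r_simps)
    next
      case 3
      \<comment> \<open>Past the origin the linear term is nonpositive, and losing all of
        \<open>f t\<close> costs at most \<open>s\<close>, which is paid by
        \<open>neg_part_r u powr \<beta> \<ge> 1\<close>.\<close>
      have "s * 1 \<le> s * (1 + e * s)" using e s by (intro mult_left_mono) auto
      then have "f t \<le> s" using pos by (simp add: ft pos_divide_le_eq)
      moreover have "0 \<le> f (t + z)" using s' pos by (simp add: ft)
      moreover have "A * (p * s * u) \<le> 0" using A p s 3 by (simp add: mult_nonneg_nonpos)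
      moreover have "s * 1 \<le> s * (54 * log_gap (max 0 u) + 9 * neg_part_r u powr \<beta>)"
      proof (intro mult_left_mono)
        have "1 \<le> neg_part_r u powr \<beta>" using 3 p by (auto simp: neg_part_r_simps intro!: ge_one_powr_ge_zero)
        then show "1 \<le> 54 * log_gap (max 0 u) + 9 * neg_part_r u powr \<beta>" using g0 by linarith
      qed (use s in auto)
      ultimately show ?thesis by linarith
    qed
  qed
  then show ?thesis unfolding lin gz by (simp add: s_def[symmetric] algebra_simps)
qed

section \<open>The layer cake formula and the Beta integral\<close>

lemma layer_cake:
  fixes h h' :: "real \<Rightarrow> real"
  assumes L: "sigma_finite_measure L" and sets_L [measurable_cong]: "sets L = sets borel"
    and h0: "h 0 = 0" and hc: "continuous_on {0..} h"
    and hd: "\<And>y. y > 0 \<Longrightarrow> (h has_real_derivative h' y) (at y)"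
    and h'm [measurable]: "h' \<in> borel_measurable borel"
    and h'0: "\<And>y. y \<ge> 0 \<Longrightarrow> 0 \<le> h' y"
  shows "(\<integral>\<^sup>+ z. ennreal (h (max 0 z)) \<partial>L)
    = (\<integral>\<^sup>+ y. ennreal (h' y) * indicator {0<..} y * emeasure L {y<..} \<partial>lborel)"
proof -
  interpret L: sigma_finite_measure L by fact
  interpret pair_sigma_finite L lborel ..
  have *: "ennreal (h (max 0 z))
    = (\<integral>\<^sup>+ y. ennreal (h' y) * indicator {0<..} y * indicator {y<..} z \<partial>lborel)" for z
  proof (cases "z > 0")
    case True
    have "(h' has_integral (h z - h 0)) {0..z}"
      by (rule fundamental_theorem_of_calculus_interior)
        (use True hd continuous_on_subset[OF hc] in
          \<open>auto simp: has_real_derivative_iff_has_vector_derivative[symmetric]\<close>)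
    then have "(\<integral>\<^sup>+ y. ennreal (h' y) * indicator {0..z} y \<partial>lborel) = ennreal (h z)"
      using nn_integral_has_integral_lebesgue'[of "{0..z}" h'] h'0 h0 by simp
    also have "(\<integral>\<^sup>+ y. ennreal (h' y) * indicator {0..z} y \<partial>lborel)
      = (\<integral>\<^sup>+ y. ennreal (h' y) * indicator {0<..} y * indicator {y<..} z \<partial>lborel)"
    proof (rule nn_integral_cong_AE)
      have "AE y in lborel. y \<noteq> 0 \<and> y \<noteq> z" by (simp add: AE_lborel_singleton)
      then show "AE y in lborel. ennreal (h' y) * indicator {0..z} y
        = ennreal (h' y) * indicator {0<..} y * indicator {y<..} z"
        by eventually_elim (auto simp: indicator_def)
    qed
    finally show ?thesis using True by (simp add: max_def)
  next
    case False
    then have "(\<lambda>y. ennreal (h' y) * indicator {0<..} y * indicator {y<..} z) = (\<lambda>y. 0)"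
      by (auto simp: indicator_def)
    then show ?thesis using False h0 by (simp add: max_def)
  qed
  have "(\<integral>\<^sup>+ z. ennreal (h (max 0 z)) \<partial>L)
    = (\<integral>\<^sup>+ z. \<integral>\<^sup>+ y. ennreal (h' y) * indicator {0<..} y * indicator {y<..} z \<partial>lborel \<partial>L)"
    by (simp add: *)
  also have "\<dots> = (\<integral>\<^sup>+ y. \<integral>\<^sup>+ z. ennreal (h' y) * indicator {0<..} y * indicator {y<..} z \<partial>L \<partial>lborel)"
  proof (rule Fubini'[symmetric])
    have "(\<lambda>p. ennreal (h' (snd p)) * indicator {0<..} (snd p) * indicator {p. snd p < fst p} p :: ennreal)
      \<in> borel_measurable (L \<Otimes>\<^sub>M lborel)" by measurable
    then show "(\<lambda>(z, y). ennreal (h' y) * indicator {0<..} y * indicator {y<..} z)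
      \<in> borel_measurable (L \<Otimes>\<^sub>M lborel)"
      by (rule measurable_cong[THEN iffD1, rotated]) (auto simp: indicator_def)
  qed
  also have "\<dots> = (\<integral>\<^sup>+ y. ennreal (h' y) * indicator {0<..} y * emeasure L {y<..} \<partial>lborel)"
    by (intro nn_integral_cong, subst nn_integral_cmult) (auto simp: sets_L)
  finally show ?thesis .
qed

section \<open>The critical constant as a Beta integral\<close>

definition kap :: "real \<Rightarrow> real" where "kap \<alpha> = pi * \<bar>1 / sin (pi * \<alpha>)\<bar>"

text \<open>Euler's reflection formula at \<open>2 - \<alpha>\<close>; the two arguments of the Beta
  function add up to 1, so its denominator is 1. As \<open>pi * (2 - \<alpha>)\<close> lies in
  \<open>(0, pi)\<close>, the sine at \<open>pi * \<alpha>\<close> is negative, which accounts for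
  the absolute value.\<close>

lemma kap_eq_Beta:
  assumes "1 < \<alpha>" "\<alpha> < 2"
  shows "kap \<alpha> = Beta (2 - \<alpha>) (\<alpha> - 1)"
proof -
  have "complex_of_real (Gamma (2 - \<alpha>) * Gamma (1 - (2 - \<alpha>)))
    = complex_of_real (pi / sin (pi * (2 - \<alpha>)))"
    using Gamma_reflection_complex[of "complex_of_real (2 - \<alpha>)"]
    by (simp flip: Gamma_complex_of_real sin_of_real)
  then have "Gamma (2 - \<alpha>) * Gamma (\<alpha> - 1) = pi / sin (pi * (2 - \<alpha>))"
    by (simp only: of_real_eq_iff) (simp add: algebra_simps)
  moreover have "sin (pi * (2 - \<alpha>)) = - sin (pi * \<alpha>)"
    by (simp add: right_diff_distrib sin_diff mult.commute[of pi 2])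
  moreover have "sin (pi * (2 - \<alpha>)) > 0"
    by (rule sin_gt_zero) (use assms in auto)
  moreover have "Beta (2 - \<alpha>) (\<alpha> - 1) = Gamma (2 - \<alpha>) * Gamma (\<alpha> - 1)"
    by (simp add: Beta_def)
  ultimately show ?thesis by (simp add: kap_def abs_if)
qed

lemma kap_pos: "1 < \<alpha> \<Longrightarrow> \<alpha> < 2 \<Longrightarrow> 0 < kap \<alpha>"
  using kap_eq_Beta[of \<alpha>] by (simp add: Beta_def Gamma_real_pos)

text \<open>The substitution \<open>u = t / (1 - t)\<close> carries the unit interval to the
  half-line and turns the integrand into the Beta kernel \<open>B\<close>.\<close>

lemma nn_integral_kap:
  assumes \<alpha>: "1 < \<alpha>" "\<alpha> < 2"
  shows "(\<integral>\<^sup>+ u. ennreal (u powr (1 - \<alpha>) / (1 + u)) * indicator {0<..} u \<partial>lborel) = ennreal (kap \<alpha>)"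
proof -
  define f where "f u = u powr (1 - \<alpha>) / (1 + u)" for u :: real
  define B where "B t = t powr (2 - \<alpha> - 1) * (1 - t) powr (\<alpha> - 1 - 1)" for t :: real
  have e01: "einterval 0 1 = {0<..<1::real}" by (auto simp: einterval_def zero_ereal_def one_ereal_def)
  have eq: "f (t / (1 - t)) * (1 / (1 - t)\<^sup>2) = B t" if "0 < t" "t < 1" for t
  proof -
    have "1 + t / (1 - t) = 1 / (1 - t)" using that by (simp add: field_simps)
    then have "f (t / (1 - t)) * (1 / (1 - t)\<^sup>2)
      = (t / (1 - t)) powr (1 - \<alpha>) * (1 - t) / (1 - t)\<^sup>2" by (simp add: f_def)
    also have "\<dots> = t powr (1 - \<alpha>) * ((1 - t) powr 1 / ((1 - t) powr (1 - \<alpha>) * (1 - t) powr 2))"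
      using that by (simp add: powr_divide)
    also have "(1 - t) powr 1 / ((1 - t) powr (1 - \<alpha>) * (1 - t) powr 2) = (1 - t) powr (1 - ((1 - \<alpha>) + 2))"
      by (simp only: powr_diff powr_add)
    finally show ?thesis by (simp add: B_def algebra_simps)
  qed
  have BI: "(B has_integral kap \<alpha>) {0..1}"
    unfolding B_def kap_eq_Beta[OF \<alpha>] by (rule has_integral_Beta_real) (use \<alpha> in auto)
  have Bnn: "(\<integral>\<^sup>+ t. ennreal (B t) * indicator {0..1} t \<partial>lborel) = ennreal (kap \<alpha>)"
    by (rule nn_integral_has_integral_lebesgue'[OF _ BI]) (auto simp: B_def)
  have Bnn': "(\<integral>\<^sup>+ t. ennreal (indicator {0<..<1} t * B t) \<partial>lborel) = ennreal (kap \<alpha>)"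
    unfolding Bnn[symmetric]
  proof (rule nn_integral_cong_AE)
    have "AE t in lborel. t \<noteq> 0 \<and> t \<noteq> (1::real)" by (simp add: AE_lborel_singleton)
    then show "AE t in lborel. ennreal (indicator {0<..<1} t * B t) = ennreal (B t) * indicator {0..1} t"
      by eventually_elim (auto simp: indicator_def)
  qed
  have Bint: "has_bochner_integral lborel (\<lambda>t. indicator {0<..<1} t * B t) (kap \<alpha>)"
    by (rule has_bochner_integral_nn_integral)
      (use Bnn' kap_pos[OF \<alpha>] in \<open>auto simp: B_def\<close>)
  have ind: "(\<lambda>t. indicator {0<..<1} t *\<^sub>R (f (t / (1 - t)) * (1 / (1 - t)\<^sup>2))) = (\<lambda>t. indicator {0<..<1} t * B t)"
    using eq by (auto simp: indicator_def)
  note sub = interval_integral_substitution_nonneg[of 0 1 "\<lambda>t. t / (1 - t)" "\<lambda>t. 1 / (1 - t)\<^sup>2" f]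
  have prem: "set_integrable lborel (einterval 0 1) (\<lambda>t. f (t / (1 - t)) * (1 / (1 - t)\<^sup>2))"
    unfolding e01 set_integrable_def ind using Bint by (simp add: has_bochner_integral_iff)
  have der: "((\<lambda>t. t / (1 - t)) has_real_derivative 1 / (1 - x)\<^sup>2) (at x)" if "0 < x" "x < 1" for x :: real
    using that by (auto intro!: derivative_eq_intros simp: power2_eq_square field_simps)
  have lim0: "((ereal \<circ> (\<lambda>t. t / (1 - t)) \<circ> real_of_ereal) \<longlongrightarrow> 0) (at_right 0)"
  proof -
    have "((\<lambda>t::real. t / (1 - t)) \<longlongrightarrow> 0 / (1 - 0)) (at_right 0)" by (intro tendsto_intros) auto
    then show ?thesis
      by (simp add: o_def zero_ereal_def at_right_ereal filterlim_filtermap)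
  qed
  have lim1: "((ereal \<circ> (\<lambda>t. t / (1 - t)) \<circ> real_of_ereal) \<longlongrightarrow> \<infinity>) (at_left 1)"
  proof -
    have "filterlim (\<lambda>t::real. t / (1 - t)) at_top (at_left 1)" 
    proof -
      have "filterlim (\<lambda>t::real. 1 - t) (at_right 0) (at_left 1)"
        by (auto simp: filterlim_at eventually_at_left_field intro!: tendsto_eq_intros exI[of _ 0])
      then have "filterlim (\<lambda>t::real. inverse (1 - t)) at_top (at_left 1)"
        by (rule filterlim_compose[OF filterlim_inverse_at_top_right])
      then show ?thesis
        using filterlim_tendsto_pos_mult_at_top[of "\<lambda>t. t" 1 "at_left 1" "\<lambda>t::real. inverse (1 - t)"]
        by (simp add: divide_inverse)
    qed
    then have "((\<lambda>t. ereal (t / (1 - t))) \<longlongrightarrow> \<infinity>) (at_left 1)"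
      by (simp add: tendsto_PInfty_eq_at_top)
    then show ?thesis
      by (simp add: o_def one_ereal_def at_left_ereal filterlim_filtermap)
  qed
  have cf: "isCont f (x / (1 - x))" if "0 < x" "x < 1" for x
    using that unfolding f_def by (intro continuous_intros) (auto simp: add_pos_pos field_simps)
  have S: "set_integrable lborel (einterval 0 \<infinity>) f"
    "(LBINT x=0..\<infinity>. f x) = (LBINT t=0..1. f (t / (1 - t)) * (1 / (1 - t)\<^sup>2))"
    by (rule sub[OF _ _ _ _ _ _ lim0 lim1 prem];
        simp add: der cf zero_ereal_def one_ereal_def f_def)+
  have e0i: "einterval 0 \<infinity> = {0<..}" by (auto simp: einterval_def zero_ereal_def)
  have "(LBINT t=0..1. f (t / (1 - t)) * (1 / (1 - t)\<^sup>2)) = kap \<alpha>"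
    unfolding interval_lebesgue_integral_def set_lebesgue_integral_def e01 ind
    using Bint by (simp add: has_bochner_integral_iff)
  then have I: "has_bochner_integral lborel (\<lambda>u. indicator {0<..} u * f u) (kap \<alpha>)"
    using S unfolding interval_lebesgue_integral_def set_lebesgue_integral_def set_integrable_def e0i
    by (simp add: has_bochner_integral_iff)
  have "(\<integral>\<^sup>+ u. ennreal (indicator {0<..} u * f u) \<partial>lborel) = ennreal (kap \<alpha>)"
    using I by (subst nn_integral_eq_integral) (auto simp: has_bochner_integral_iff f_def indicator_def)
  also have "(\<lambda>u. ennreal (indicator {0<..} u * f u))
    = (\<lambda>u. ennreal (u powr (1 - \<alpha>) / (1 + u)) * indicator {0<..} u)"
    by (auto simp: f_def indicator_def)
  finally show ?thesis .
qed

section \<open>Heavy-tailed outward increments\<close>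

text \<open>One law with explicit constants: \<eta> is the tolerance on the tail constant, valid
  from \<open>Y\<close> on, and \<open>Bd\<close> bounds the inward moment. Sharing these constants
  among all far starting points makes the drift estimates uniform. The exponent \<beta> is at most 2
  because the pointwise inequalities compare with squares.\<close>

locale out_law = prob_space L for L :: "real measure" +
  fixes \<alpha> \<beta> c \<eta> Y Bd :: real
  assumes sets_L [simp, measurable_cong]: "sets L = sets borel"
    and \<alpha>: "1 < \<alpha>" "\<alpha> < 2" and \<beta>: "\<alpha> < \<beta>" "\<beta> \<le> 2" and \<eta>: "0 \<le> \<eta>" "\<eta> < c" and Y: "1 \<le> Y"
    and tail_lower: "\<And>y. Y \<le> y \<Longrightarrow> (c - \<eta>) * y powr - \<alpha> \<le> prob {y<..}"
    and tail_upper: "\<And>y. Y \<le> y \<Longrightarrow> prob {y<..} \<le> (c + \<eta>) * y powr - \<alpha>"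
    and Bd: "0 \<le> Bd"
    and neg_moment: "(\<integral>\<^sup>+ z. ennreal (neg_part_r z powr \<beta>) \<partial>L) \<le> ennreal Bd"
begin

lemma space_L [simp]: "space L = UNIV"
  using sets_eq_imp_space_eq[OF sets_L] by simp

lemma prob_UNIV [simp]: "prob UNIV = 1"
  using prob_space by simp

lemma tail_measurable [measurable]: "(\<lambda>y. emeasure L {y<..}) \<in> borel_measurable borel"
proof -
  have "mono (\<lambda>y. - prob {y<..})"
    by (intro monoI) (auto intro!: finite_measure_mono)
  then have "(\<lambda>y. - (- prob {y<..})) \<in> borel_measurable borel"
    by (intro borel_measurable_uminus borel_measurable_mono)
  then show ?thesis by (simp add: emeasure_eq_measure)
qed

lemma c_eta_nonneg: "0 \<le> c + \<eta>" "0 \<le> c - \<eta>"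
  using \<eta> by auto

lemma ennreal_mult_tail: "0 \<le> k \<Longrightarrow> ennreal k * emeasure L {y<..} = ennreal (k * prob {y<..})"
  by (simp add: emeasure_eq_measure ennreal_mult')

section \<open>The mean of the logarithmic gap\<close>

lemma nn_integral_log_gap:
  assumes t: "0 < t"
  shows "(\<integral>\<^sup>+ z. ennreal (log_gap (max 0 z / t)) \<partial>L)
    = (\<integral>\<^sup>+ y. ennreal (y / (t * (t + y))) * indicator {0<..} y * emeasure L {y<..} \<partial>lborel)"
proof (rule layer_cake[where h = "\<lambda>z. log_gap (z / t)"])
  show "sigma_finite_measure L" ..
  have d: "((\<lambda>z. log_gap (z / t)) has_real_derivative y / (t * (t + y))) (at y)" if "y \<ge> 0" for y
  proof -
    have "((\<lambda>z. log_gap (z / t)) has_real_derivative (y / t / (1 + y / t)) * (1 / t)) (at y)"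
      by (rule DERIV_chain2[OF DERIV_log_gap])
        (use t that in \<open>auto intro!: derivative_eq_intros intro: less_le_trans[of _ 0]\<close>)
    then show ?thesis using t that by (simp add: field_simps)
  qed
  show "continuous_on {0..} (\<lambda>z. log_gap (z / t))"
    using d by (meson DERIV_isCont atLeast_iff continuous_at_imp_continuous_on)
  show "((\<lambda>z. log_gap (z / t)) has_real_derivative y / (t * (t + y))) (at y)" if "y > 0" for y
    using d that by simp
qed (use t in auto)

text \<open>The value for a pure power tail on the whole half-line. Scaling by \<open>t\<close>
  extracts the order \<open>t powr - \<alpha>\<close> and leaves the Beta integral; this is how the
  critical constant arises.\<close>

lemma kernel_scale:
  assumes t: "0 < t"
  shows "(\<integral>\<^sup>+ y. ennreal (y / (t * (t + y)) * y powr - \<alpha>) * indicator {0<..} y \<partial>lborel)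
    = ennreal (kap \<alpha> * t powr - \<alpha>)"
proof -
  have "(\<integral>\<^sup>+ y. ennreal (y / (t * (t + y)) * y powr - \<alpha>) * indicator {0<..} y \<partial>lborel)
    = ennreal t * (\<integral>\<^sup>+ u. ennreal (t * u / (t * (t + t * u)) * (t * u) powr - \<alpha>) * indicator {0<..} (t * u) \<partial>lborel)"
    using nn_integral_real_affine[of "\<lambda>y. ennreal (y / (t * (t + y)) * y powr - \<alpha>) * indicator {0<..} y" t 0] t
    by simp
  also have "\<dots> = ennreal t * (\<integral>\<^sup>+ u. ennreal (t powr (- \<alpha> - 1)) * (ennreal (u powr (1 - \<alpha>) / (1 + u)) * indicator {0<..} u) \<partial>lborel)"
  proof (rule arg_cong[where f = "\<lambda>i. ennreal t * i"], rule nn_integral_cong)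
    fix u :: real
    show "ennreal (t * u / (t * (t + t * u)) * (t * u) powr - \<alpha>) * indicator {0<..} (t * u)
      = ennreal (t powr (- \<alpha> - 1)) * (ennreal (u powr (1 - \<alpha>) / (1 + u)) * indicator {0<..} u)"
    proof (cases "u > 0")
      case True
      have "t * u / (t * (t + t * u)) * (t * u) powr - \<alpha> = (t powr - \<alpha> / t) * (u * u powr - \<alpha> / (1 + u))"
      proof -
        have "t * u / (t * (t + t * u)) = u / (1 + u) / t"
          using t by (simp add: distrib_left[of t 1 u, simplified, symmetric])
        then show ?thesis using t True by (simp add: powr_mult mult_ac)
      qed
      also have "\<dots> = t powr (- \<alpha> - 1) * (u powr (1 - \<alpha>) / (1 + u))"
        using t True by (simp add: powr_diff powr_minus_divide)
      finally have "ennreal (t * u / (t * (t + t * u)) * (t * u) powr - \<alpha>)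
        = ennreal (t powr (- \<alpha> - 1)) * ennreal (u powr (1 - \<alpha>) / (1 + u))"
        by (simp only: ennreal_mult'[OF powr_ge_zero])
      moreover have "indicator {0<..} (t * u) = (1::ennreal)" "indicator {0<..} u = (1::ennreal)"
        using t True by auto
      ultimately show ?thesis by (simp only: mult_1_right)
    qed (use t in \<open>auto simp: zero_less_mult_iff\<close>)
  qed
  also have "\<dots> = ennreal t * (ennreal (t powr (- \<alpha> - 1)) * ennreal (kap \<alpha>))"
    by (subst nn_integral_cmult) (auto simp: nn_integral_kap[OF \<alpha>])
  also have "\<dots> = ennreal (t * (t powr (- \<alpha> - 1) * kap \<alpha>))"
    using t kap_pos[OF \<alpha>] by (simp add: ennreal_mult')
  also have "t * (t powr (- \<alpha> - 1) * kap \<alpha>) = kap \<alpha> * t powr - \<alpha>"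
    using t by (simp add: powr_diff)
  finally show ?thesis .
qed

text \<open>Below \<open>Y\<close> the tail is not controlled: there the probability is bounded by 1
  and the kernel by \<open>Y / t\<^sup>2\<close>, an error of smaller order since \<alpha> <
  2.\<close>

lemma nn_log_gap_upper:
  assumes t: "0 < t"
  shows "(\<integral>\<^sup>+ z. ennreal (log_gap (max 0 z / t)) \<partial>L) \<le> ennreal ((c + \<eta>) * kap \<alpha> * t powr - \<alpha> + Y\<^sup>2 / t\<^sup>2)"
proof -
  have "(\<integral>\<^sup>+ z. ennreal (log_gap (max 0 z / t)) \<partial>L)
    \<le> (\<integral>\<^sup>+ y. ennreal (c + \<eta>) * (ennreal (y / (t * (t + y)) * y powr - \<alpha>) * indicator {0<..} y)
         + ennreal (Y / t\<^sup>2) * indicator {0..Y} y \<partial>lborel)"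
    unfolding nn_integral_log_gap[OF t]
  proof (rule nn_integral_mono)
    fix y :: real
    show "ennreal (y / (t * (t + y))) * indicator {0<..} y * emeasure L {y<..}
      \<le> ennreal (c + \<eta>) * (ennreal (y / (t * (t + y)) * y powr - \<alpha>) * indicator {0<..} y)
         + ennreal (Y / t\<^sup>2) * indicator {0..Y} y"
    proof (cases "y > 0")
      case y: True
      have k: "0 \<le> y / (t * (t + y))" using y t by simp
      show ?thesis
      proof (cases "y \<ge> Y")
        case True
        have "y / (t * (t + y)) * prob {y<..} \<le> y / (t * (t + y)) * ((c + \<eta>) * y powr - \<alpha>)"
          by (rule mult_left_mono[OF tail_upper[OF True] k])
        then have "ennreal (y / (t * (t + y))) * emeasure L {y<..}
          \<le> ennreal (c + \<eta>) * ennreal (y / (t * (t + y)) * y powr - \<alpha>)"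
          unfolding ennreal_mult_tail[OF k] ennreal_mult'[OF c_eta_nonneg(1), symmetric]
          by (intro ennreal_leI) (simp add: mult_ac)
        then show ?thesis using y by (simp add: add_increasing2)
      next
        case False
        have "y / (t * (t + y)) \<le> y / (t * t)" using y t by (intro divide_left_mono) auto
        also have "\<dots> \<le> Y / t\<^sup>2" using False t by (simp add: power2_eq_square divide_right_mono)
        finally have "y / (t * (t + y)) * prob {y<..} \<le> Y / t\<^sup>2 * 1"
          using Y k by (intro mult_mono) auto
        then have "ennreal (y / (t * (t + y))) * emeasure L {y<..} \<le> ennreal (Y / t\<^sup>2)"
          unfolding ennreal_mult_tail[OF k] by (intro ennreal_leI) simp
        then show ?thesis using y False by (simp add: add_increasing)
      qed
    qed simp
  qed
  also have "\<dots> = ennreal (c + \<eta>) * ennreal (kap \<alpha> * t powr - \<alpha>) + ennreal (Y / t\<^sup>2) * ennreal Y"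
    unfolding kernel_scale[OF t, symmetric]
    using Y by (subst nn_integral_add) (simp_all add: nn_integral_cmult del: times_divide_eq_left)
  also have "\<dots> = ennreal ((c + \<eta>) * kap \<alpha> * t powr - \<alpha> + Y\<^sup>2 / t\<^sup>2)"
    using \<eta> kap_pos[OF \<alpha>] Y
    by (simp add: ennreal_mult'[symmetric] ennreal_plus[symmetric] power2_eq_square mult.assoc del: ennreal_plus)
  finally show ?thesis .
qed

text \<open>The power tail is integrated from 0 although the tail bound starts at \<open>Y\<close>.
  The excess below \<open>Y\<close>, finite because \<alpha> < 2, goes to the right-hand side; the
  additive form avoids subtraction in \<open>ennreal\<close>.\<close>

lemma nn_log_gap_lower:
  assumes t: "0 < t"
  shows "ennreal ((c - \<eta>) * kap \<alpha> * t powr - \<alpha>)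
    \<le> (\<integral>\<^sup>+ z. ennreal (log_gap (max 0 z / t)) \<partial>L) + ennreal (c / t\<^sup>2 * (Y powr (2 - \<alpha>) / (2 - \<alpha>)))"
proof -
  have "ennreal ((c - \<eta>) * kap \<alpha> * t powr - \<alpha>) = ennreal (c - \<eta>) * ennreal (kap \<alpha> * t powr - \<alpha>)"
    using \<eta> by (simp add: ennreal_mult'[symmetric] mult.assoc)
  also have "\<dots> = (\<integral>\<^sup>+ y. ennreal (c - \<eta>) * (ennreal (y / (t * (t + y)) * y powr - \<alpha>) * indicator {0<..} y) \<partial>lborel)"
    unfolding kernel_scale[OF t, symmetric] by (rule nn_integral_cmult[symmetric]) measurable
  also have "\<dots> \<le> (\<integral>\<^sup>+ y. ennreal (y / (t * (t + y))) * indicator {0<..} y * emeasure L {y<..}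
      + ennreal (c / t\<^sup>2) * (ennreal (y powr (1 - \<alpha>)) * indicator {0..Y} y) \<partial>lborel)"
  proof (rule nn_integral_mono)
    fix y :: real
    show "ennreal (c - \<eta>) * (ennreal (y / (t * (t + y)) * y powr - \<alpha>) * indicator {0<..} y)
      \<le> ennreal (y / (t * (t + y))) * indicator {0<..} y * emeasure L {y<..}
        + ennreal (c / t\<^sup>2) * (ennreal (y powr (1 - \<alpha>)) * indicator {0..Y} y)"
    proof (cases "y > 0")
      case y: True
      have k: "0 \<le> y / (t * (t + y))" using y t by simp
      show ?thesis
      proof (cases "y \<ge> Y")
        case True
        have "y / (t * (t + y)) * ((c - \<eta>) * y powr - \<alpha>) \<le> y / (t * (t + y)) * prob {y<..}"
          by (rule mult_left_mono[OF tail_lower[OF True] k])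
        then have "ennreal (c - \<eta>) * ennreal (y / (t * (t + y)) * y powr - \<alpha>)
          \<le> ennreal (y / (t * (t + y))) * emeasure L {y<..}"
          unfolding ennreal_mult_tail[OF k] ennreal_mult'[OF c_eta_nonneg(2), symmetric]
          by (intro ennreal_leI) (simp add: mult_ac)
        then show ?thesis using y by (simp add: add_increasing2)
      next
        case False
        have ct: "0 \<le> c / t\<^sup>2" using \<eta> by simp
        have "y / (t * (t + y)) \<le> y / (t * t)" using y t by (intro divide_left_mono) auto
        then have "(c - \<eta>) * (y / (t * (t + y)) * y powr - \<alpha>) \<le> c * (y / (t * t) * y powr - \<alpha>)"
          using \<eta> y t by (intro mult_mono mult_right_mono) auto
        also have "\<dots> = c / t\<^sup>2 * y powr (1 - \<alpha>)"
          using y t by (simp add: powr_diff powr_minus_divide power2_eq_square)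
        finally have "ennreal (c - \<eta>) * ennreal (y / (t * (t + y)) * y powr - \<alpha>)
          \<le> ennreal (c / t\<^sup>2) * ennreal (y powr (1 - \<alpha>))"
          unfolding ennreal_mult'[OF c_eta_nonneg(2), symmetric] ennreal_mult'[OF ct, symmetric]
          by (rule ennreal_leI)
        then show ?thesis using y False by (simp add: add_increasing)
      qed
    qed simp
  qed
  also have "\<dots> = (\<integral>\<^sup>+ z. ennreal (log_gap (max 0 z / t)) \<partial>L)
      + ennreal (c / t\<^sup>2) * (\<integral>\<^sup>+ y. ennreal (y powr (1 - \<alpha>)) * indicator {0..Y} y \<partial>lborel)"
    unfolding nn_integral_log_gap[OF t]
    by (subst nn_integral_add) (auto simp: nn_integral_cmult)
  also have "(\<integral>\<^sup>+ y. ennreal (y powr (1 - \<alpha>)) * indicator {0..Y} y \<partial>lborel) = ennreal (Y powr (2 - \<alpha>) / (2 - \<alpha>))"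
    using nn_integral_has_integral_lebesgue'[OF _ has_integral_powr_from_0[of "1 - \<alpha>" Y]] \<alpha> Y by simp
  also have "ennreal (c / t\<^sup>2) * \<dots> = ennreal (c / t\<^sup>2 * (Y powr (2 - \<alpha>) / (2 - \<alpha>)))"
    using \<eta> by (simp add: ennreal_mult'[symmetric])
  finally show ?thesis .
qed

section \<open>Moments of the increment below and at order \<alpha>\<close>

definition pos_moment_bound :: "real \<Rightarrow> real" where
  "pos_moment_bound q = Y powr q + (c + \<eta>) * q / (\<alpha> - q) * Y powr (q - \<alpha>)"

lemma nn_integral_pos_powr:
  assumes q: "1 \<le> q"
  shows "(\<integral>\<^sup>+ z. ennreal (max 0 z powr q) \<partial>L)
    = (\<integral>\<^sup>+ y. ennreal (q * y powr (q - 1)) * indicator {0<..} y * emeasure L {y<..} \<partial>lborel)"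
proof (rule layer_cake[where h = "\<lambda>z. z powr q"])
  show "sigma_finite_measure L" ..
  show "continuous_on {0..} (\<lambda>z. z powr q)"
    using q by (intro continuous_on_powr' continuous_intros) auto
  show "((\<lambda>z. z powr q) has_real_derivative q * y powr (q - 1)) (at y)" if "y > 0" for y
    using that by (auto intro!: derivative_eq_intros)
qed (use q in auto)

text \<open>The summands of \<open>pos_moment_bound q\<close> are the integrals of
  \<open>q * y powr (q - 1)\<close> over \<open>[0, Y]\<close>, with the tail probability bounded by
  1, and from \<open>Y\<close> to infinity against the power tail. The second converges because
  \<open>q < \<alpha>\<close>.\<close>

lemma nn_pos_moment:
  assumes q: "1 \<le> q" "q < \<alpha>"
  shows "(\<integral>\<^sup>+ z. ennreal (max 0 z powr q) \<partial>L) \<le> ennreal (pos_moment_bound q)"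
proof -
  have "(\<integral>\<^sup>+ z. ennreal (max 0 z powr q) \<partial>L)
    \<le> (\<integral>\<^sup>+ y. ennreal q * (ennreal (y powr (q - 1)) * indicator {0..Y} y)
       + ennreal (q * (c + \<eta>)) * (ennreal (y powr (q - 1 - \<alpha>)) * indicator {Y..} y) \<partial>lborel)"
    unfolding nn_integral_pos_powr[OF q(1)]
  proof (rule nn_integral_mono)
    fix y :: real
    show "ennreal (q * y powr (q - 1)) * indicator {0<..} y * emeasure L {y<..}
      \<le> ennreal q * (ennreal (y powr (q - 1)) * indicator {0..Y} y)
       + ennreal (q * (c + \<eta>)) * (ennreal (y powr (q - 1 - \<alpha>)) * indicator {Y..} y)"
    proof (cases "y > 0")
      case y: True
      have k: "0 \<le> q * y powr (q - 1)" using q by simp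
      have q0: "0 \<le> q" "0 \<le> q * (c + \<eta>)" using q c_eta_nonneg by auto
      show ?thesis
      proof (cases "y \<ge> Y")
        case True
        have "q * y powr (q - 1) * prob {y<..} \<le> q * y powr (q - 1) * ((c + \<eta>) * y powr - \<alpha>)"
          by (rule mult_left_mono[OF tail_upper[OF True] k])
        also have "\<dots> = q * (c + \<eta>) * y powr (q - 1 - \<alpha>)"
          by (simp add: powr_diff powr_minus_divide)
        finally have "ennreal (q * y powr (q - 1)) * emeasure L {y<..}
          \<le> ennreal (q * (c + \<eta>)) * ennreal (y powr (q - 1 - \<alpha>))"
          unfolding ennreal_mult_tail[OF k] ennreal_mult'[OF q0(2), symmetric] by (rule ennreal_leI)
        then show ?thesis using y True by (simp add: add_increasing)
      next
        case False
        have "q * y powr (q - 1) * prob {y<..} \<le> q * y powr (q - 1) * 1"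
          using k by (intro mult_left_mono) auto
        then have "ennreal (q * y powr (q - 1)) * emeasure L {y<..} \<le> ennreal q * ennreal (y powr (q - 1))"
          unfolding ennreal_mult_tail[OF k] ennreal_mult'[OF q0(1), symmetric] by (intro ennreal_leI) simp
        then show ?thesis using y False by simp
      qed
    qed simp
  qed
  also have "\<dots> = ennreal q * (\<integral>\<^sup>+ y. ennreal (y powr (q - 1)) * indicator {0..Y} y \<partial>lborel)
      + ennreal (q * (c + \<eta>)) * (\<integral>\<^sup>+ y. ennreal (y powr (q - 1 - \<alpha>)) * indicator {Y..} y \<partial>lborel)"
    by (subst nn_integral_add) (simp_all add: nn_integral_cmult)
  also have "(\<integral>\<^sup>+ y. ennreal (y powr (q - 1)) * indicator {0..Y} y \<partial>lborel) = ennreal (Y powr q / q)"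
    using nn_integral_has_integral_lebesgue'[OF _ has_integral_powr_from_0[of "q - 1" Y]] q Y by simp
  also have "(\<integral>\<^sup>+ y. ennreal (y powr (q - 1 - \<alpha>)) * indicator {Y..} y \<partial>lborel)
    = ennreal (Y powr (q - \<alpha>) / (\<alpha> - q))"
  proof -
    have "- (Y powr (q - 1 - \<alpha> + 1)) / (q - 1 - \<alpha> + 1) = Y powr (q - \<alpha>) / (\<alpha> - q)"
      using q by (simp add: divide_simps) (simp add: algebra_simps)
    then show ?thesis
      using nn_integral_has_integral_lebesgue'[OF _ has_integral_powr_to_inf[of "q - 1 - \<alpha>" Y]] q Y by simp
  qed
  also have "ennreal q * ennreal (Y powr q / q) + ennreal (q * (c + \<eta>)) * ennreal (Y powr (q - \<alpha>) / (\<alpha> - q))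
    = ennreal (pos_moment_bound q)"
    using q c_eta_nonneg Y
    by (simp add: ennreal_mult'[symmetric] ennreal_plus[symmetric] pos_moment_bound_def mult_ac del: ennreal_plus)
  finally show ?thesis .
qed

text \<open>At order \<alpha> exactly, the integrand of the tail formula is at least
  \<open>d / y\<close> from \<open>Y\<close> on, so the moment diverges logarithmically.\<close>

lemma infinite_moment: "(\<integral>\<^sup>+ z. ennreal (max 0 z powr \<alpha>) \<partial>L) = \<infinity>"
proof -
  define d where "d = \<alpha> * (c - \<eta>)"
  have d: "d > 0" using \<alpha> \<eta> by (simp add: d_def)
  have lower: "ennreal (d * (ln R - ln Y)) \<le> (\<integral>\<^sup>+ z. ennreal (max 0 z powr \<alpha>) \<partial>L)" if R: "Y \<le> R" for R
  proof -
    have "(inverse has_integral (ln R - ln Y)) {Y..R}"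
      by (rule fundamental_theorem_of_calculus)
        (use R Y in \<open>auto intro!: DERIV_subset[OF DERIV_ln] simp: has_real_derivative_iff_has_vector_derivative[symmetric]\<close>)
    then have "(\<integral>\<^sup>+ y. ennreal (inverse y) * indicator {Y..R} y \<partial>lborel) = ennreal (ln R - ln Y)"
      by (rule nn_integral_has_integral_lebesgue'[rotated]) (use Y in auto)
    then have "ennreal (d * (ln R - ln Y)) = (\<integral>\<^sup>+ y. ennreal d * (ennreal (inverse y) * indicator {Y..R} y) \<partial>lborel)"
      using d by (subst nn_integral_cmult) (auto simp: ennreal_mult')
    also have "\<dots> \<le> (\<integral>\<^sup>+ y. ennreal (\<alpha> * y powr (\<alpha> - 1)) * indicator {0<..} y * emeasure L {y<..} \<partial>lborel)"
    proof (rule nn_integral_mono)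
      fix y :: real
      show "ennreal d * (ennreal (inverse y) * indicator {Y..R} y)
        \<le> ennreal (\<alpha> * y powr (\<alpha> - 1)) * indicator {0<..} y * emeasure L {y<..}"
      proof (cases "y \<ge> Y")
        case True
        then have y: "y > 0" using Y by simp
        have k: "0 \<le> \<alpha> * y powr (\<alpha> - 1)" using \<alpha> by simp
        have "d * inverse y = \<alpha> * y powr (\<alpha> - 1) * ((c - \<eta>) * y powr - \<alpha>)"
          using y by (simp add: d_def powr_diff powr_minus_divide inverse_eq_divide)
        also have "\<dots> \<le> \<alpha> * y powr (\<alpha> - 1) * prob {y<..}"
          by (rule mult_left_mono[OF tail_lower[OF True] k])
        finally have "ennreal d * ennreal (inverse y) \<le> ennreal (\<alpha> * y powr (\<alpha> - 1)) * emeasure L {y<..}"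
          unfolding ennreal_mult_tail[OF k] using d by (simp add: ennreal_mult'[symmetric] ennreal_leI)
        then show ?thesis using y by (auto simp: indicator_def)
      qed (auto simp: indicator_def)
    qed
    finally show ?thesis using nn_integral_pos_powr[of \<alpha>] \<alpha> by simp
  qed
  show ?thesis
  proof (rule ccontr)
    assume "(\<integral>\<^sup>+ z. ennreal (max 0 z powr \<alpha>) \<partial>L) \<noteq> \<infinity>"
    then obtain r where r: "0 \<le> r" "(\<integral>\<^sup>+ z. ennreal (max 0 z powr \<alpha>) \<partial>L) = ennreal r"
      by (cases "\<integral>\<^sup>+ z. ennreal (max 0 z powr \<alpha>) \<partial>L") auto
    \<comment> \<open>Chosen so that \<open>d * (ln R - ln Y) = r + 1\<close>.\<close>
    define R where "R = Y * exp ((r + 1) / d)"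
    have "Y * 1 \<le> R" unfolding R_def using Y r d by (intro mult_left_mono) auto
    then have "ennreal (d * (ln R - ln Y)) \<le> ennreal r" using lower[of R] r by simp
    moreover have "ln R - ln Y = (r + 1) / d" using Y by (simp add: R_def ln_mult)
    ultimately show False using r d by simp
  qed
qed

lemma integrable_neg: "integrable L (\<lambda>z. neg_part_r z powr \<beta>)"
  and expectation_neg: "expectation (\<lambda>z. neg_part_r z powr \<beta>) \<le> Bd"
proof -
  show I: "integrable L (\<lambda>z. neg_part_r z powr \<beta>)"
    by (rule integrableI_nonneg) (use neg_moment in \<open>auto intro: le_less_trans\<close>)
  show "expectation (\<lambda>z. neg_part_r z powr \<beta>) \<le> Bd"
    using neg_moment Bd by (simp add: nn_integral_eq_integral[OF I] ennreal_le_iff)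
qed

lemma log_gap_pos_nonneg: "0 < t \<Longrightarrow> 0 \<le> log_gap (max 0 z / t)"
  by (rule log_gap_nonneg) simp

lemma
  assumes t: "0 < t"
  shows integrable_log_gap: "integrable L (\<lambda>z. log_gap (max 0 z / t))"
    and expectation_log_gap_upper:
      "expectation (\<lambda>z. log_gap (max 0 z / t)) \<le> (c + \<eta>) * kap \<alpha> * t powr - \<alpha> + Y\<^sup>2 / t\<^sup>2"
    and expectation_log_gap_lower:
      "(c - \<eta>) * kap \<alpha> * t powr - \<alpha> - c / t\<^sup>2 * (Y powr (2 - \<alpha>) / (2 - \<alpha>))
        \<le> expectation (\<lambda>z. log_gap (max 0 z / t))"
proof -
  show I: "integrable L (\<lambda>z. log_gap (max 0 z / t))"
    by (rule integrableI_nonneg)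
      (use nn_log_gap_upper[OF t] log_gap_pos_nonneg[OF t] in \<open>auto intro: le_less_trans\<close>)
  have E: "(\<integral>\<^sup>+ z. ennreal (log_gap (max 0 z / t)) \<partial>L) = ennreal (expectation (\<lambda>z. log_gap (max 0 z / t)))"
    by (rule nn_integral_eq_integral[OF I]) (use log_gap_pos_nonneg[OF t] in auto)
  have E0: "0 \<le> expectation (\<lambda>z. log_gap (max 0 z / t))"
    by (rule Bochner_Integration.integral_nonneg) (use log_gap_pos_nonneg[OF t] in auto)
  have "0 \<le> (c + \<eta>) * kap \<alpha> * t powr - \<alpha> + Y\<^sup>2 / t\<^sup>2"
    using c_eta_nonneg kap_pos[OF \<alpha>] by simp
  then show "expectation (\<lambda>z. log_gap (max 0 z / t)) \<le> (c + \<eta>) * kap \<alpha> * t powr - \<alpha> + Y\<^sup>2 / t\<^sup>2"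
    using nn_log_gap_upper[OF t] by (simp only: E ennreal_le_iff)
  have "0 \<le> c / t\<^sup>2 * (Y powr (2 - \<alpha>) / (2 - \<alpha>))" using \<eta> \<alpha> by simp
  then have "ennreal ((c - \<eta>) * kap \<alpha> * t powr - \<alpha>)
    \<le> ennreal (expectation (\<lambda>z. log_gap (max 0 z / t)) + c / t\<^sup>2 * (Y powr (2 - \<alpha>) / (2 - \<alpha>)))"
    using nn_log_gap_lower[OF t] E0 by (simp only: E ennreal_plus[symmetric])
  moreover have "0 \<le> expectation (\<lambda>z. log_gap (max 0 z / t)) + c / t\<^sup>2 * (Y powr (2 - \<alpha>) / (2 - \<alpha>))"
    by (intro add_nonneg_nonneg) fact+
  ultimately show "(c - \<eta>) * kap \<alpha> * t powr - \<alpha> - c / t\<^sup>2 * (Y powr (2 - \<alpha>) / (2 - \<alpha>))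
        \<le> expectation (\<lambda>z. log_gap (max 0 z / t))"
    by (simp add: ennreal_le_iff del: ennreal_plus)
qed

lemma
  assumes q: "1 \<le> q" "q < \<alpha>"
  shows integrable_abs_powr: "integrable L (\<lambda>z. \<bar>z\<bar> powr q)"
    and expectation_abs_powr: "expectation (\<lambda>z. \<bar>z\<bar> powr q) \<le> pos_moment_bound q + 1 + Bd"
proof -
  have CP0: "0 \<le> pos_moment_bound q" using q c_eta_nonneg by (simp add: pos_moment_bound_def)
  have le: "\<bar>z\<bar> powr q \<le> max 0 z powr q + (1 + neg_part_r z powr \<beta>)" for z
  proof (cases "z \<ge> 0")
    case False
    have "\<bar>z\<bar> powr q \<le> 1 + \<bar>z\<bar> powr \<beta>"
    proof (cases "\<bar>z\<bar> \<le> 1")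
      case True
      then have "\<bar>z\<bar> powr q \<le> 1 powr q" using q by (intro powr_mono2) auto
      then show ?thesis by (simp add: add_increasing2)
    next
      case False
      then have "\<bar>z\<bar> powr q \<le> \<bar>z\<bar> powr \<beta>" using q \<beta> by (intro powr_mono) auto
      then show ?thesis by simp
    qed
    then show ?thesis using False q by (simp add: neg_part_r_simps max_def)
  qed (simp add: neg_part_r_simps)
  have I1: "integrable L (\<lambda>z. max 0 z powr q)"
    by (rule integrableI_nonneg) (use nn_pos_moment[OF q] in \<open>auto intro: le_less_trans\<close>)
  have E1: "expectation (\<lambda>z. max 0 z powr q) \<le> pos_moment_bound q"
    using nn_pos_moment[OF q] CP0 by (simp add: nn_integral_eq_integral[OF I1] ennreal_le_iff)
  have I2: "integrable L (\<lambda>z. max 0 z powr q + (1 + neg_part_r z powr \<beta>))"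
    using I1 integrable_neg by auto
  show I: "integrable L (\<lambda>z. \<bar>z\<bar> powr q)"
    by (rule Bochner_Integration.integrable_bound[OF I2]) (use le in \<open>auto intro!: AE_I2 intro: order_trans\<close>)
  have "expectation (\<lambda>z. \<bar>z\<bar> powr q) \<le> expectation (\<lambda>z. max 0 z powr q + (1 + neg_part_r z powr \<beta>))"
    by (rule integral_mono[OF I I2]) (rule le)
  also have "\<dots> = expectation (\<lambda>z. max 0 z powr q) + (1 + expectation (\<lambda>z. neg_part_r z powr \<beta>))"
    using I1 integrable_neg by (simp add: prob_space)
  finally show "expectation (\<lambda>z. \<bar>z\<bar> powr q) \<le> pos_moment_bound q + 1 + Bd"
    using E1 expectation_neg by simp
qed

lemma integrable_id: "integrable L (\<lambda>z. z)"
  using integrable_abs_powr[of 1] \<alpha> by (simp add: integrable_abs_iff)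

section \<open>Drift of the test functions\<close>

lemma nn_integral_le_expectation:
  assumes "integrable L h" "\<And>z. 0 \<le> f z" "\<And>z. f z \<le> h z"
  shows "(\<integral>\<^sup>+ z. ennreal (f z) \<partial>L) \<le> ennreal (expectation h)"
proof -
  have "(\<integral>\<^sup>+ z. ennreal (f z) \<partial>L) \<le> (\<integral>\<^sup>+ z. ennreal (h z) \<partial>L)"
    by (intro nn_integral_mono ennreal_leI assms)
  also have "\<dots> = ennreal (expectation h)"
    by (rule nn_integral_eq_integral[OF assms(1)]) (use assms in \<open>auto intro: order_trans\<close>)
  finally show ?thesis .
qed

lemma neg_scaled: "0 < t \<Longrightarrow> (neg_part_r z / t) powr \<beta> = t powr - \<beta> * neg_part_r z powr \<beta>"
  by (simp add: powr_divide powr_minus_divide)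

text \<open>\<open>b'\<close> measures the mean increment on the scale
  \<open>t powr (1 - \<alpha>)\<close>, the one at which the linear term and the mean of
  \<open>log_gap\<close> have the same order \<open>t powr - \<alpha>\<close>. The last two terms
  are of smaller order.\<close>

lemma log_drift:
  assumes t: "3 \<le> t" and m: "expectation (\<lambda>z. z) \<le> b' * t powr (1 - \<alpha>)"
  shows "(\<integral>\<^sup>+ z. ennreal (ln (max 1 \<bar>t + z\<bar>)) \<partial>L)
    \<le> ennreal (ln t + (b' - (c - \<eta>) * kap \<alpha>) * t powr - \<alpha>
        + c * (Y powr (2 - \<alpha>) / (2 - \<alpha>)) / t\<^sup>2 + 2 * Bd * t powr - \<beta>)"
proof -
  let ?h = "\<lambda>z. ln t + z / t - log_gap (max 0 z / t) + 2 * (t powr - \<beta> * neg_part_r z powr \<beta>)"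
  have t0: "0 < t" using t by simp
  note I = integrable_id integrable_neg integrable_log_gap[OF t0]
  have "(\<integral>\<^sup>+ z. ennreal (ln (max 1 \<bar>t + z\<bar>)) \<partial>L) \<le> ennreal (expectation ?h)"
  proof (rule nn_integral_le_expectation)
    show "integrable L ?h" using I by auto
    show "ln (max 1 \<bar>t + z\<bar>) \<le> ?h z" for z
      using ln_abs_step[OF t, of \<beta> z] \<alpha> \<beta> t0 by (simp add: neg_scaled)
  qed auto
  also have "expectation ?h = ln t + expectation (\<lambda>z. z) / t - expectation (\<lambda>z. log_gap (max 0 z / t))
      + 2 * (t powr - \<beta> * expectation (\<lambda>z. neg_part_r z powr \<beta>))"
    using I by (simp add: prob_space)
  also have "\<dots> \<le> ln t + (b' - (c - \<eta>) * kap \<alpha>) * t powr - \<alpha>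
        + c * (Y powr (2 - \<alpha>) / (2 - \<alpha>)) / t\<^sup>2 + 2 * Bd * t powr - \<beta>"
  proof -
    have "expectation (\<lambda>z. z) / t \<le> b' * t powr (1 - \<alpha>) / t" using m t0 by (intro divide_right_mono) auto
    also have "\<dots> = b' * t powr - \<alpha>" using t0 by (simp add: powr_diff powr_minus_divide)
    finally have "expectation (\<lambda>z. z) / t \<le> b' * t powr - \<alpha>" .
    moreover have "t powr - \<beta> * expectation (\<lambda>z. neg_part_r z powr \<beta>) \<le> t powr - \<beta> * Bd"
      by (intro mult_left_mono expectation_neg) auto
    ultimately show ?thesis using expectation_log_gap_lower[OF t0] by (simp add: algebra_simps)
  qed
  finally show ?thesis by (simp add: ennreal_leI)
qed

lemma negative_powr_drift:
  assumes t: "2 \<le> t" and \<nu>: "0 \<le> \<nu>" "\<nu> \<le> 1" and m: "b' * t powr (1 - \<alpha>) \<le> expectation (\<lambda>z. z)"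
  shows "(\<integral>\<^sup>+ z. ennreal (if t + z \<ge> 1 then (t + z) powr - \<nu> else 1) \<partial>L)
    \<le> ennreal (t powr - \<nu> * (1 + \<nu> * ((1 + \<nu>) * (c + \<eta>) * kap \<alpha> - b') * t powr - \<alpha>
        + \<nu> * (1 + \<nu>) * (Y\<^sup>2 / t\<^sup>2)) + 8 * Bd * t powr - \<beta>)"
proof -
  let ?h = "\<lambda>z. t powr - \<nu> * (1 - \<nu> * (z / t) + \<nu> * (1 + \<nu>) * log_gap (max 0 z / t))
      + 8 * (t powr - \<beta> * neg_part_r z powr \<beta>)"
  have t0: "0 < t" using t by simp
  note I = integrable_id integrable_neg integrable_log_gap[OF t0]
  have "(\<integral>\<^sup>+ z. ennreal (if t + z \<ge> 1 then (t + z) powr - \<nu> else 1) \<partial>L) \<le> ennreal (expectation ?h)"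
  proof (rule nn_integral_le_expectation)
    show "integrable L ?h" using I by auto
    show "(if t + z \<ge> 1 then (t + z) powr - \<nu> else 1) \<le> ?h z" for z
      using negative_powr_step[OF t, of \<beta> \<nu> z] \<alpha> \<beta> t0 \<nu> by (simp add: neg_scaled)
  qed auto
  also have "expectation ?h = t powr - \<nu> * (1 - \<nu> * (expectation (\<lambda>z. z) / t)
        + \<nu> * (1 + \<nu>) * expectation (\<lambda>z. log_gap (max 0 z / t)))
      + 8 * (t powr - \<beta> * expectation (\<lambda>z. neg_part_r z powr \<beta>))"
    using I by (simp add: prob_space)
  also have "\<dots> \<le> t powr - \<nu> * (1 + \<nu> * ((1 + \<nu>) * (c + \<eta>) * kap \<alpha> - b') * t powr - \<alpha>
        + \<nu> * (1 + \<nu>) * (Y\<^sup>2 / t\<^sup>2)) + 8 * Bd * t powr - \<beta>"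
  proof -
    have "b' * t powr - \<alpha> = b' * t powr (1 - \<alpha>) / t" using t0 by (simp add: powr_diff powr_minus_divide)
    also have "\<dots> \<le> expectation (\<lambda>z. z) / t" using m t0 by (intro divide_right_mono) auto
    finally have "\<nu> * (b' * t powr - \<alpha>) \<le> \<nu> * (expectation (\<lambda>z. z) / t)" using \<nu> by (intro mult_left_mono)
    moreover have "\<nu> * (1 + \<nu>) * expectation (\<lambda>z. log_gap (max 0 z / t))
      \<le> \<nu> * (1 + \<nu>) * ((c + \<eta>) * kap \<alpha> * t powr - \<alpha> + Y\<^sup>2 / t\<^sup>2)"
      using \<nu> by (intro mult_left_mono expectation_log_gap_upper[OF t0]) auto
    ultimately have "1 - \<nu> * (expectation (\<lambda>z. z) / t) + \<nu> * (1 + \<nu>) * expectation (\<lambda>z. log_gap (max 0 z / t))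
      \<le> 1 - \<nu> * (b' * t powr - \<alpha>) + \<nu> * (1 + \<nu>) * ((c + \<eta>) * kap \<alpha> * t powr - \<alpha> + Y\<^sup>2 / t\<^sup>2)"
      by linarith
    also have "\<dots> = 1 + \<nu> * ((1 + \<nu>) * (c + \<eta>) * kap \<alpha> - b') * t powr - \<alpha>
        + \<nu> * (1 + \<nu>) * (Y\<^sup>2 / t\<^sup>2)" by (simp add: algebra_simps)
    finally have *: "t powr - \<nu> * (1 - \<nu> * (expectation (\<lambda>z. z) / t)
        + \<nu> * (1 + \<nu>) * expectation (\<lambda>z. log_gap (max 0 z / t)))
      \<le> t powr - \<nu> * (1 + \<nu> * ((1 + \<nu>) * (c + \<eta>) * kap \<alpha> - b') * t powr - \<alpha>
        + \<nu> * (1 + \<nu>) * (Y\<^sup>2 / t\<^sup>2))" by (rule mult_left_mono) simp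
    have "t powr - \<beta> * expectation (\<lambda>z. neg_part_r z powr \<beta>) \<le> t powr - \<beta> * Bd"
      by (intro mult_left_mono expectation_neg) auto
    with * show ?thesis by (simp add: mult_ac)
  qed
  finally show ?thesis by (simp add: ennreal_leI)
qed

text \<open>Intended for \<open>p = 1 + \<gamma>\<close> with \<open>p < q\<close>: the linear term
  then tends to a constant and the error, of order \<open>t powr (p - q)\<close>, to 0.\<close>

lemma powr_drift:
  assumes t: "0 < t" and pq: "1 \<le> p" "p \<le> q" "q < \<alpha>"
  shows "(\<integral>\<^sup>+ z. ennreal (\<bar>t + z\<bar> powr p) \<partial>L)
    \<le> ennreal (t powr p + p * t powr (p - 1) * expectation (\<lambda>z. z) + 4 * t powr (p - q) * (pos_moment_bound q + 1 + Bd))"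
proof -
  let ?h = "\<lambda>z. t powr p + p * t powr (p - 1) * z + 4 * t powr (p - q) * \<bar>z\<bar> powr q"
  note I = integrable_id integrable_abs_powr[of q]
  have q: "1 \<le> q" "q \<le> 2" using pq \<alpha> by auto
  have "(\<integral>\<^sup>+ z. ennreal (\<bar>t + z\<bar> powr p) \<partial>L) \<le> ennreal (expectation ?h)"
    using I q pq t by (intro nn_integral_le_expectation abs_powr_step) auto
  also have "expectation ?h = t powr p + p * t powr (p - 1) * expectation (\<lambda>z. z)
      + 4 * t powr (p - q) * expectation (\<lambda>z. \<bar>z\<bar> powr q)"
    using I q pq by (simp add: prob_space)
  also have "\<dots> \<le> t powr p + p * t powr (p - 1) * expectation (\<lambda>z. z) + 4 * t powr (p - q) * (pos_moment_bound q + 1 + Bd)"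
    using q pq by (intro add_left_mono mult_left_mono expectation_abs_powr) auto
  finally show ?thesis by (simp add: ennreal_leI)
qed

text \<open>With the exponent \<alpha>, the linear term, the mean of \<open>log_gap\<close> and the
  inward error all stay bounded after multiplication by the power of \<open>t\<close> in front of
  them, so the drift is bounded below by a constant free of \<open>t\<close> and \<open>e\<close>.
  For fixed \<open>e\<close> the function is bounded, which makes its mean finite although the
  moment of order \<alpha> is not.\<close>

lemma truncated_powr_drift:
  assumes t: "1 \<le> t" and e: "0 < e" and m: "\<bar>expectation (\<lambda>z. z)\<bar> \<le> b' * t powr (1 - \<alpha>)" and b': "0 \<le> b'"
  defines "f \<equiv> \<lambda>x. \<bar>x\<bar> powr \<alpha> / (1 + e * \<bar>x\<bar> powr \<alpha>)"
  shows "ennreal (f t) \<le> (\<integral>\<^sup>+ z. ennreal (f (t + z)) \<partial>L)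
    + ennreal (2 * b' + 54 * ((c + \<eta>) * kap \<alpha> + Y\<^sup>2) + 9 * Bd)"
proof -
  define A where "A = 1 / (1 + e * t powr \<alpha>)\<^sup>2"
  have t0: "0 < t" using t by simp
  have "1 \<le> (1 + e * t powr \<alpha>)\<^sup>2" using e by (intro one_le_power) auto
  then have A: "0 \<le> A" "A \<le> 1" by (auto simp: A_def divide_le_eq_1)
  note I = integrable_id integrable_neg integrable_log_gap[OF t0]
  have f0: "0 \<le> f x" for x using e by (auto simp: f_def intro!: divide_nonneg_nonneg add_nonneg_nonneg)
  have fb: "f x \<le> 1 / e" for x
    using e by (auto simp: f_def divide_simps add_pos_nonneg add_nonneg_eq_0_iff)
  have [measurable]: "f \<in> borel_measurable borel" unfolding f_def by measurable
  have If: "integrable L (\<lambda>z. f (t + z))"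
    by (rule integrable_const_bound[of _ "1 / e"]) (use f0 fb in auto)
  let ?l = "\<lambda>z. f t + A * \<alpha> * t powr (\<alpha> - 1) * z"
  let ?h = "\<lambda>z. f (t + z) + 54 * t powr \<alpha> * log_gap (max 0 z / t)
    + 9 * t powr \<alpha> * (t powr - \<beta> * neg_part_r z powr \<beta>)"
  have "expectation ?l \<le> expectation ?h"
  proof (rule integral_mono)
    show "integrable L ?l" using I by auto
    show "integrable L ?h" using I If by auto
    show "?l z \<le> ?h z" for z
      using truncated_powr_step[OF t0, of \<alpha> \<beta> e z] \<alpha> \<beta> e t0 by (simp add: f_def A_def neg_scaled)
  qed
  also have "expectation ?h = expectation (\<lambda>z. f (t + z)) + 54 * t powr \<alpha> * expectation (\<lambda>z. log_gap (max 0 z / t))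
    + 9 * t powr \<alpha> * (t powr - \<beta> * expectation (\<lambda>z. neg_part_r z powr \<beta>))"
    using I If by simp
  also have "expectation ?l = f t + A * \<alpha> * t powr (\<alpha> - 1) * expectation (\<lambda>z. z)"
    using I by (simp add: prob_space)
  finally have main: "f t + A * \<alpha> * t powr (\<alpha> - 1) * expectation (\<lambda>z. z)
    \<le> expectation (\<lambda>z. f (t + z)) + 54 * t powr \<alpha> * expectation (\<lambda>z. log_gap (max 0 z / t))
      + 9 * t powr \<alpha> * (t powr - \<beta> * expectation (\<lambda>z. neg_part_r z powr \<beta>))" .
  have a: "54 * t powr \<alpha> * expectation (\<lambda>z. log_gap (max 0 z / t)) \<le> 54 * ((c + \<eta>) * kap \<alpha> + Y\<^sup>2)"
  proof -
    have "54 * t powr \<alpha> * expectation (\<lambda>z. log_gap (max 0 z / t))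
      \<le> 54 * t powr \<alpha> * ((c + \<eta>) * kap \<alpha> * t powr - \<alpha> + Y\<^sup>2 / t\<^sup>2)"
      by (intro mult_left_mono expectation_log_gap_upper[OF t0]) auto
    also have "\<dots> = 54 * ((c + \<eta>) * kap \<alpha> + Y\<^sup>2 * (t powr \<alpha> / t\<^sup>2))"
      using t0 by (simp add: powr_minus field_simps)
    finally have *: "54 * t powr \<alpha> * expectation (\<lambda>z. log_gap (max 0 z / t))
      \<le> 54 * ((c + \<eta>) * kap \<alpha> + Y\<^sup>2 * (t powr \<alpha> / t\<^sup>2))" .
    have "t powr \<alpha> / t\<^sup>2 \<le> 1"
    proof -
      have "t powr \<alpha> \<le> t powr 2" using t \<alpha> by (intro powr_mono) auto
      then show ?thesis using t0 by (simp add: divide_le_eq_1)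
    qed
    then have "54 * ((c + \<eta>) * kap \<alpha> + Y\<^sup>2 * (t powr \<alpha> / t\<^sup>2)) \<le> 54 * ((c + \<eta>) * kap \<alpha> + Y\<^sup>2 * 1)"
      by (intro mult_left_mono add_left_mono) auto
    then show ?thesis using * by simp
  qed
  have b: "9 * t powr \<alpha> * (t powr - \<beta> * expectation (\<lambda>z. neg_part_r z powr \<beta>)) \<le> 9 * Bd"
  proof -
    have "t powr \<alpha> * t powr - \<beta> = t powr (\<alpha> - \<beta>)" by (simp add: powr_diff powr_minus_divide)
    also have "\<dots> \<le> 1" using t \<beta> powr_mono[of "\<alpha> - \<beta>" 0 t] by simp
    finally have "(t powr \<alpha> * t powr - \<beta>) * expectation (\<lambda>z. neg_part_r z powr \<beta>) \<le> 1 * Bd"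
      using expectation_neg by (intro mult_mono) (auto intro!: Bochner_Integration.integral_nonneg)
    then show ?thesis by (simp add: mult_ac)
  qed
  have d: "- (2 * b') \<le> A * \<alpha> * t powr (\<alpha> - 1) * expectation (\<lambda>z. z)"
  proof -
    have "\<bar>A * \<alpha> * t powr (\<alpha> - 1) * expectation (\<lambda>z. z)\<bar>
      = (A * \<alpha>) * (t powr (\<alpha> - 1) * \<bar>expectation (\<lambda>z. z)\<bar>)"
      using A \<alpha> by (simp add: abs_mult)
    also have "\<dots> \<le> (1 * 2) * (t powr (\<alpha> - 1) * (b' * t powr (1 - \<alpha>)))"
      using A \<alpha> m by (intro mult_mono mult_left_mono) auto
    also have "\<dots> = 2 * b'" using t0 by (simp add: powr_diff)
    finally show ?thesis by linarith
  qed
  have "f t \<le> expectation (\<lambda>z. f (t + z)) + (2 * b' + 54 * ((c + \<eta>) * kap \<alpha> + Y\<^sup>2) + 9 * Bd)"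
    using main a b d by linarith
  then have "ennreal (f t) \<le> ennreal (expectation (\<lambda>z. f (t + z)) + (2 * b' + 54 * ((c + \<eta>) * kap \<alpha> + Y\<^sup>2) + 9 * Bd))"
    by (rule ennreal_leI)
  also have "\<dots> = ennreal (expectation (\<lambda>z. f (t + z))) + ennreal (2 * b' + 54 * ((c + \<eta>) * kap \<alpha> + Y\<^sup>2) + 9 * Bd)"
    using b' kap_pos[OF \<alpha>] c_eta_nonneg Bd f0 by (intro ennreal_plus) (auto intro!: Bochner_Integration.integral_nonneg)
  also have "ennreal (expectation (\<lambda>z. f (t + z))) = (\<integral>\<^sup>+ z. ennreal (f (t + z)) \<partial>L)"
    using f0 by (intro nn_integral_eq_integral[symmetric] If) auto
  finally show ?thesis .
qed

end

section \<open>The outward increment of the chain\<close>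

lemma eventually_dominated:
  assumes "D < 0" "\<alpha> < p" "\<alpha> < q"
  shows "eventually (\<lambda>t::real. D * t powr - \<alpha> + C1 * t powr - p + C2 * t powr - q \<le> 0) at_top"
proof -
  have "((\<lambda>t::real. D + C1 * t powr (\<alpha> - p) + C2 * t powr (\<alpha> - q)) \<longlongrightarrow> D + C1 * 0 + C2 * 0) at_top"
    by (intro tendsto_intros tendsto_neg_powr filterlim_ident) (use assms in auto)
  then have "eventually (\<lambda>t::real. D + C1 * t powr (\<alpha> - p) + C2 * t powr (\<alpha> - q) < 0) at_top"
    by (rule order_tendstoD) (use assms in simp)
  then show ?thesis
    using eventually_gt_at_top[of 0]
  proof eventually_elim
    case (elim t)
    have "D * t powr - \<alpha> + C1 * t powr - p + C2 * t powr - q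
      = t powr - \<alpha> * (D + C1 * t powr (\<alpha> - p) + C2 * t powr (\<alpha> - q))"
      by (simp add: distrib_left mult.left_commute flip: powr_add)
    also have "\<dots> \<le> 0" using elim by (intro mult_nonneg_nonpos) auto
    finally show ?case .
  qed
qed

lemma eventually_powr_small:
  assumes "s < 0" "0 < e"
  shows "\<exists>t0\<ge>1. \<forall>t\<ge>t0. A * t powr s < (e::real)"
proof -
  have "((\<lambda>t::real. A * t powr s) \<longlongrightarrow> A * 0) at_top"
    by (intro tendsto_intros tendsto_neg_powr filterlim_ident) (use assms in auto)
  then have "eventually (\<lambda>t::real. A * t powr s < e) at_top"
    by (rule order_tendstoD) (use assms in simp)
  then obtain t0 where "\<forall>t\<ge>t0. A * t powr s < e" by (auto simp: eventually_at_top_linorder)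
  then show ?thesis by (intro exI[of _ "max 1 t0"]) auto
qed

context real_chain
begin

text \<open>The sign reflects the negative half-line, so that both halves of the tail condition
  become one statement about a right tail. The law is taken from the kernel because the drift
  estimates integrate over \<open>K x\<close>.\<close>

definition outward_law :: "real \<Rightarrow> real measure" where
  "outward_law x = distr (K x) borel (\<lambda>z. sgn x * (z - x))"

definition outward_drift :: "real \<Rightarrow> real" where "outward_drift x = sgn x * drift M x"

lemma theta_measurable_M [measurable]: "x \<in> X \<Longrightarrow> theta \<in> borel_measurable (M x)"
  by (subst measurable_cong_sets[OF sets_M refl]) measurable

lemma distr_M_1:
  assumes x: "x \<in> X" shows "distr (M x) borel (\<lambda>\<omega>. \<omega> !! 1) = K x"
proof (rule measure_eqI)
  fix A assume "A \<in> sets (distr (M x) borel (\<lambda>\<omega>. \<omega> !! 1))"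
  then have A [measurable]: "A \<in> sets borel" by simp
  have "(\<lambda>\<omega>. \<omega> !! 1) -` A \<inter> space (M x) = cyl [UNIV, A]"
    using space_M[OF x] by (auto simp: cyl_def less_Suc_eq)
  then have "emeasure (distr (M x) borel (\<lambda>\<omega>. \<omega> !! 1)) A = emeasure (M x) (cyl [UNIV, A])"
    by (simp only: emeasure_distr[OF snth_measurable_M[OF x] A])
  also have "\<dots> = kseq K [UNIV, A] x" by (rule emeasure_cyl[OF x]) auto
  also have "\<dots> = emeasure (K x) A" by simp
  finally show "emeasure (distr (M x) borel (\<lambda>\<omega>. \<omega> !! 1)) A = emeasure (K x) A" .
qed simp

lemma AE_start: assumes x: "x \<in> X" shows "AE \<omega> in M x. \<omega> !! 0 = x"
proof -
  interpret prob_space "M x" by (rule prob_M[OF x])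
  have "emeasure (M x) (cyl [{x}]) = kseq K [{x}] x" by (rule emeasure_cyl[OF x]) auto
  then have "prob (cyl [{x}]) = 1" by (simp add: emeasure_eq_measure)
  then have "AE \<omega> in M x. \<omega> \<in> cyl [{x}]"
    by (subst (asm) prob_eq_1) (auto intro: sets_cyl[OF x])
  then show ?thesis by eventually_elim (simp add: cyl_def)
qed

text \<open>The bridge between the kernel, which governs \<open>kseq\<close>, and
  \<open>theta\<close> under \<open>M x\<close>, in terms of which the tail and drift conditions are
  stated.\<close>

lemma outward_law_eq: assumes x: "x \<in> X" shows "outward_law x = distr (M x) borel (\<lambda>\<omega>. sgn x * theta \<omega>)"
proof -
  have "outward_law x = distr (distr (M x) borel (\<lambda>\<omega>. \<omega> !! 1)) borel (\<lambda>z. sgn x * (z - x))"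
    unfolding outward_law_def distr_M_1[OF x] ..
  also have "\<dots> = distr (M x) borel (\<lambda>\<omega>. sgn x * (\<omega> !! 1 - x))"
    by (subst distr_distr[OF _ snth_measurable_M[OF x]]) (measurable, simp only: o_def)
  also have "\<dots> = distr (M x) borel (\<lambda>\<omega>. sgn x * theta \<omega>)"
  proof (rule distr_cong_AE)
    show "AE \<omega> in M x. sgn x * (\<omega> !! 1 - x) = sgn x * theta \<omega>"
      using AE_start[OF x] by eventually_elim (simp add: theta_def)
    show "(\<lambda>\<omega>. sgn x * (\<omega> !! 1 - x)) \<in> borel_measurable (M x)"
      by (intro borel_measurable_times borel_measurable_diff borel_measurable_const snth_measurable_M x)
    show "(\<lambda>\<omega>. sgn x * theta \<omega>) \<in> borel_measurable (M x)"
      by (intro borel_measurable_times borel_measurable_const theta_measurable_M x)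
  qed simp_all
  finally show ?thesis .
qed

lemma nn_integral_K_outward:
  assumes x: "x \<noteq> 0" and [measurable]: "f \<in> borel_measurable borel"
  shows "(\<integral>\<^sup>+ y. f y \<partial>K x) = (\<integral>\<^sup>+ z. f (sgn x * (\<bar>x\<bar> + z)) \<partial>outward_law x)"
proof -
  have *: "sgn x * (\<bar>x\<bar> + sgn x * (y - x)) = y" for y
    using x by (cases "x > 0") auto
  have "(\<integral>\<^sup>+ z. f (sgn x * (\<bar>x\<bar> + z)) \<partial>outward_law x) = (\<integral>\<^sup>+ y. f (sgn x * (\<bar>x\<bar> + sgn x * (y - x))) \<partial>K x)"
    unfolding outward_law_def by (rule nn_integral_distr) auto
  then show ?thesis by (simp only: *)
qed

lemma expectation_outward_law: assumes x: "x \<in> X" shows "(\<integral>z. z \<partial>outward_law x) = outward_drift x"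
  unfolding outward_law_eq[OF x] outward_drift_def drift_def
  by (subst integral_distr) (use theta_measurable_M[OF x] in auto)

lemma out_law_outward_law:
  assumes T: "cond_T_out X M \<alpha> \<beta> c x0" and \<eta>: "0 < \<eta>" "\<eta> < c"
  shows "\<exists>Y Bd x1. \<forall>x\<in>X. x1 \<le> \<bar>x\<bar> \<longrightarrow> out_law (outward_law x) \<alpha> (min \<beta> 2) c \<eta> Y Bd"
proof -
  note T' = T[unfolded cond_T_out_def]
  have \<alpha>: "1 < \<alpha>" "\<alpha> < 2" "\<alpha> < \<beta>" using T' by auto
  have "\<forall>\<^sub>F y in at_top. \<forall>x\<in>{x\<in>X. x \<ge> x0}.
    dist (y powr \<alpha> * measure (M x) {\<omega> \<in> space (M x). pos_part_r (theta \<omega>) > y}) c < \<eta>"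
    using T' \<eta> by (auto dest!: uniform_limitD[of _ _ _ _ \<eta>])
  then obtain Y1 where Y1: "\<And>y x. Y1 \<le> y \<Longrightarrow> x \<in> X \<Longrightarrow> x0 \<le> x \<Longrightarrow>
    dist (y powr \<alpha> * measure (M x) {\<omega> \<in> space (M x). pos_part_r (theta \<omega>) > y}) c < \<eta>"
    by (auto simp: eventually_at_top_linorder)
  have "\<forall>\<^sub>F y in at_top. \<forall>x\<in>{x\<in>X. x \<le> - x0}.
    dist (y powr \<alpha> * measure (M x) {\<omega> \<in> space (M x). neg_part_r (theta \<omega>) > y}) c < \<eta>"
    using T' \<eta> by (auto dest!: uniform_limitD[of _ _ _ _ \<eta>])
  then obtain Y2 where Y2: "\<And>y x. Y2 \<le> y \<Longrightarrow> x \<in> X \<Longrightarrow> x \<le> - x0 \<Longrightarrow>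
    dist (y powr \<alpha> * measure (M x) {\<omega> \<in> space (M x). neg_part_r (theta \<omega>) > y}) c < \<eta>"
    by (auto simp: eventually_at_top_linorder)
  define S1 where "S1 = (SUP x\<in>{x\<in>X. x \<ge> x0}. \<integral>\<^sup>+ \<omega>. ennreal (neg_part_r (theta \<omega>) powr \<beta>) \<partial>M x)"
  define S2 where "S2 = (SUP x\<in>{x\<in>X. x \<le> - x0}. \<integral>\<^sup>+ \<omega>. ennreal (pos_part_r (theta \<omega>) powr \<beta>) \<partial>M x)"
  have S: "S1 < \<infinity>" "S2 < \<infinity>" using T' by (auto simp: S1_def S2_def)
  define Y where "Y = max 1 (max Y1 Y2)"
  \<comment> \<open>Both suprema are added so that one bound serves either sign of \<open>x\<close>;
    the summand 1 pays for lowering \<beta> to \<open>min \<beta> 2\<close>.\<close>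
  define Bd where "Bd = 1 + enn2real S1 + enn2real S2"
  \<comment> \<open>At least 1, to keep away from the origin, where \<open>sgn\<close>
    vanishes.\<close>
  define x1 where "x1 = max 1 x0"
  have "out_law (outward_law x) \<alpha> (min \<beta> 2) c \<eta> Y Bd" if x: "x \<in> X" and x1: "x1 \<le> \<bar>x\<bar>" for x
  proof -
    have x0: "x0 \<le> \<bar>x\<bar>" "x \<noteq> 0" using x1 by (auto simp: x1_def)
    interpret Mx: prob_space "M x" by (rule prob_M[OF x])
    have [measurable]: "theta \<in> borel_measurable (M x)" by (rule theta_measurable_M[OF x])
    have prob: "prob_space (outward_law x)"
      unfolding outward_law_eq[OF x] by (rule Mx.prob_space_distr) measurable
    have tail: "\<bar>y powr \<alpha> * measure (outward_law x) {y<..} - c\<bar> < \<eta>" if y: "Y \<le> y" for y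
    proof -
      have "measure (outward_law x) {y<..} = measure (M x) {\<omega> \<in> space (M x). sgn x * theta \<omega> > y}"
        unfolding outward_law_eq[OF x]
        by (subst measure_distr) (auto intro!: arg_cong[where f = "measure (M x)"])
      moreover have y': "y \<ge> 1" "y \<ge> Y1" "y \<ge> Y2" using y by (auto simp: Y_def)
      moreover have "sgn x * theta \<omega> > y \<longleftrightarrow> (if x > 0 then pos_part_r (theta \<omega>) > y else neg_part_r (theta \<omega>) > y)" for \<omega>
        using y'(1) x0 by (auto simp: pos_part_r_def neg_part_r_def)
      ultimately show ?thesis
        using Y1[of y x] Y2[of y x] x x0 by (cases "x > 0") (auto simp: dist_real_def)
    qed
    have neg: "(\<integral>\<^sup>+ z. ennreal (neg_part_r z powr min \<beta> 2) \<partial>outward_law x) \<le> ennreal Bd"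
    proof -
      have le: "neg_part_r z powr min \<beta> 2 \<le> 1 + neg_part_r z powr \<beta>" for z
      proof (cases "neg_part_r z \<le> 1")
        case True
        then have "neg_part_r z powr min \<beta> 2 \<le> 1 powr min \<beta> 2"
          using \<alpha> by (intro powr_mono2) (auto simp: neg_part_r_def)
        then show ?thesis by (simp add: add_increasing2)
      next
        case False
        then have "neg_part_r z powr min \<beta> 2 \<le> neg_part_r z powr \<beta>" by (intro powr_mono) auto
        then show ?thesis by simp
      qed
      have "(\<integral>\<^sup>+ z. ennreal (neg_part_r z powr min \<beta> 2) \<partial>outward_law x)
        \<le> (\<integral>\<^sup>+ z. 1 + ennreal (neg_part_r z powr \<beta>) \<partial>outward_law x)"
        using le by (intro nn_integral_mono) (metis ennreal_1 ennreal_leI ennreal_plus powr_ge_zero zero_le_one)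
      also have "\<dots> = 1 + (\<integral>\<^sup>+ z. ennreal (neg_part_r z powr \<beta>) \<partial>outward_law x)"
      proof -
        have [measurable_cong]: "sets (outward_law x) = sets borel" by (simp add: outward_law_def)
        have "emeasure (outward_law x) (space (outward_law x)) = 1" by (rule prob_space.emeasure_space_1[OF prob])
        then show ?thesis by (subst nn_integral_add) auto
      qed
      also have "(\<integral>\<^sup>+ z. ennreal (neg_part_r z powr \<beta>) \<partial>outward_law x)
        = (\<integral>\<^sup>+ \<omega>. ennreal (neg_part_r (sgn x * theta \<omega>) powr \<beta>) \<partial>M x)"
        unfolding outward_law_eq[OF x] by (rule nn_integral_distr) auto
      also have "\<dots> \<le> S1 + S2"
      proof (cases "x > 0")
        case True
        then have "(\<integral>\<^sup>+ \<omega>. ennreal (neg_part_r (sgn x * theta \<omega>) powr \<beta>) \<partial>M x) \<le> S1"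
          unfolding S1_def using x x0 by (intro SUP_upper2[of x]) auto
        then show ?thesis by (simp add: add_increasing2)
      next
        case False
        have "neg_part_r (- u) = pos_part_r u" for u by (auto simp: neg_part_r_def pos_part_r_def)
        then have "(\<integral>\<^sup>+ \<omega>. ennreal (neg_part_r (sgn x * theta \<omega>) powr \<beta>) \<partial>M x) \<le> S2"
          unfolding S2_def using x x0 False by (intro SUP_upper2[of x]) auto
        then show ?thesis by (simp add: add_increasing)
      qed
      also have "1 + (S1 + S2) = ennreal Bd"
        using S by (simp add: Bd_def less_top add.assoc ennreal_plus[symmetric] del: ennreal_plus)
          (simp add: ennreal_plus less_top)
      finally show ?thesis by (simp add: add_left_mono)
    qed
    show ?thesis
    proof (rule out_law.intro[OF prob], unfold_locales)
      show "sets (outward_law x) = sets borel" by (simp add: outward_law_def)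
      fix y assume y: "Y \<le> y"
      then have y0: "y > 0" by (auto simp: Y_def)
      have e: "measure (outward_law x) {y<..} = (y powr \<alpha> * measure (outward_law x) {y<..}) * y powr - \<alpha>"
        using y0 by (simp add: powr_minus)
      show "(c - \<eta>) * y powr - \<alpha> \<le> measure (outward_law x) {y<..}" "measure (outward_law x) {y<..} \<le> (c + \<eta>) * y powr - \<alpha>"
        by (subst e; use tail[OF y] in \<open>intro mult_right_mono; auto\<close>)+
    qed (use \<alpha> \<eta> neg in \<open>auto simp: Y_def Bd_def\<close>)
  qed
  then show ?thesis by blast
qed

section \<open>The drift condition as a function of the distance from the origin\<close>

definition drift_limit :: "real \<Rightarrow> real \<Rightarrow> bool" where
  "drift_limit \<gamma> b \<longleftrightarrow> (\<forall>e>0. \<exists>x1\<ge>1. \<forall>x\<in>X. x1 \<le> \<bar>x\<bar> \<longrightarrow> \<bar>\<bar>x\<bar> powr \<gamma> * outward_drift x - b\<bar> < e)"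

lemma drift_limit_cond:
  assumes D: "cond_D' X M \<gamma> b" shows "drift_limit \<gamma> b"
  unfolding drift_limit_def
proof (intro allI impI)
  fix e :: real assume e: "0 < e"
  have "eventually (\<lambda>x. dist (x powr \<gamma> * drift M x) b < e) (at_top \<sqinter> principal X)"
    "eventually (\<lambda>x. dist (- (\<bar>x\<bar> powr \<gamma> * drift M x)) b < e) (at_bot \<sqinter> principal X)"
    using D e unfolding cond_D'_def tendsto_iff by auto
  then obtain a a' where
    a: "\<And>x. a \<le> x \<Longrightarrow> x \<in> X \<Longrightarrow> dist (x powr \<gamma> * drift M x) b < e" and
    a': "\<And>x. x \<le> a' \<Longrightarrow> x \<in> X \<Longrightarrow> dist (- (\<bar>x\<bar> powr \<gamma> * drift M x)) b < e"
    unfolding eventually_inf_principal eventually_at_top_linorder eventually_at_bot_linorder by blast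
  show "\<exists>x1\<ge>1. \<forall>x\<in>X. x1 \<le> \<bar>x\<bar> \<longrightarrow> \<bar>\<bar>x\<bar> powr \<gamma> * outward_drift x - b\<bar> < e"
  proof (intro exI[of _ "max 1 (max a (- a'))"] conjI ballI impI)
    fix x assume "x \<in> X" "max 1 (max a (- a')) \<le> \<bar>x\<bar>"
    then show "\<bar>\<bar>x\<bar> powr \<gamma> * outward_drift x - b\<bar> < e"
      using a[of x] a'[of x] by (cases "x > 0") (auto simp: outward_drift_def dist_real_def)
  qed simp
qed

text \<open>Reduces a drift exponent above \<alpha> - 1 to the critical exponent with limit 0, which
  lies below the positive critical value.\<close>

lemma drift_limit_lower_exponent:
  assumes D: "drift_limit \<gamma> b" and "\<gamma>' < \<gamma>" shows "drift_limit \<gamma>' 0"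
  unfolding drift_limit_def
proof (intro allI impI)
  fix e :: real assume e: "0 < e"
  obtain x1 where x1: "x1 \<ge> 1" "\<And>x. x \<in> X \<Longrightarrow> x1 \<le> \<bar>x\<bar> \<Longrightarrow> \<bar>\<bar>x\<bar> powr \<gamma> * outward_drift x - b\<bar> < 1"
    using D unfolding drift_limit_def by (meson zero_less_one)
  obtain t0 where t0: "t0 \<ge> 1" "\<And>t. t \<ge> t0 \<Longrightarrow> (\<bar>b\<bar> + 1) * t powr (\<gamma>' - \<gamma>) < e"
    using eventually_powr_small[of "\<gamma>' - \<gamma>" e "\<bar>b\<bar> + 1"] assms e by auto
  show "\<exists>x1\<ge>1. \<forall>x\<in>X. x1 \<le> \<bar>x\<bar> \<longrightarrow> \<bar>\<bar>x\<bar> powr \<gamma>' * outward_drift x - 0\<bar> < e"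
  proof (intro exI[of _ "max x1 t0"] conjI ballI impI)
    fix x assume x: "x \<in> X" "max x1 t0 \<le> \<bar>x\<bar>"
    then have "x \<noteq> 0" using x1 by auto
    then have "\<bar>x\<bar> powr \<gamma>' * outward_drift x = (\<bar>x\<bar> powr \<gamma> * outward_drift x) * \<bar>x\<bar> powr (\<gamma>' - \<gamma>)"
      by (simp add: powr_diff)
    then have "\<bar>\<bar>x\<bar> powr \<gamma>' * outward_drift x\<bar> = \<bar>\<bar>x\<bar> powr \<gamma> * outward_drift x\<bar> * \<bar>x\<bar> powr (\<gamma>' - \<gamma>)"
      by (simp add: abs_mult)
    also have "\<dots> \<le> (\<bar>b\<bar> + 1) * \<bar>x\<bar> powr (\<gamma>' - \<gamma>)"
      using x1(2)[of x] x by (intro mult_right_mono) auto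
    also have "\<dots> < e" using t0(2) x by auto
    finally show "\<bar>\<bar>x\<bar> powr \<gamma>' * outward_drift x - 0\<bar> < e" by simp
  qed (use x1 in auto)
qed

end

section \<open>The classification\<close>

locale out_chain = real_chain +
  fixes \<alpha> \<beta> c x0 :: real
  assumes T: "cond_T_out X M \<alpha> \<beta> c x0"
begin

lemma params: "1 < \<alpha>" "\<alpha> < 2" "\<alpha> < min \<beta> 2" "0 < c"
  using T by (auto simp: cond_T_out_def)

lemma kap: "0 < kap \<alpha>"
  using params by (intro kap_pos)

lemma never_hit_of_drift:
  assumes N: "cond_N' X M" and b': "b' < c * kap \<alpha>"
    and m: "\<And>x. x \<in> X \<Longrightarrow> x1 \<le> \<bar>x\<bar> \<Longrightarrow> outward_drift x \<le> b' * \<bar>x\<bar> powr (1 - \<alpha>)"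
  shows "\<exists>a. \<forall>x\<in>X. (INF N. kseq K (replicate N {y. \<bar>y\<bar> > a}) x) = 0"
proof -
  \<comment> \<open>Small enough that replacing \<open>c\<close> by \<open>c - \<eta>\<close> gives
    away at most half of the gap between \<open>b'\<close> and
    \<open>c * kap \<alpha>\<close>.\<close>
  define \<eta> where "\<eta> = min (c / 2) ((c * kap \<alpha> - b') / (2 * kap \<alpha>))"
  have \<eta>: "0 < \<eta>" "\<eta> < c" using params kap b' by (auto simp: \<eta>_def)
  have "\<eta> * kap \<alpha> \<le> (c * kap \<alpha> - b') / (2 * kap \<alpha>) * kap \<alpha>"
    using kap by (intro mult_right_mono) (auto simp: \<eta>_def)
  also have "\<dots> = (c * kap \<alpha> - b') / 2" using kap by simp
  finally have D: "b' - (c - \<eta>) * kap \<alpha> < 0" using b' by (simp add: algebra_simps)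
  obtain Y Bd x2 where L: "\<And>x. x \<in> X \<Longrightarrow> x2 \<le> \<bar>x\<bar> \<Longrightarrow> out_law (outward_law x) \<alpha> (min \<beta> 2) c \<eta> Y Bd"
    using out_law_outward_law[OF T \<eta>] by blast
  have "eventually (\<lambda>t. (b' - (c - \<eta>) * kap \<alpha>) * t powr - \<alpha>
      + c * (Y powr (2 - \<alpha>) / (2 - \<alpha>)) * t powr - 2 + 2 * Bd * t powr - min \<beta> 2 \<le> 0) at_top"
    by (rule eventually_dominated[OF D]) (use params in auto)
  then obtain x3 where x3: "\<And>t. x3 \<le> t \<Longrightarrow> (b' - (c - \<eta>) * kap \<alpha>) * t powr - \<alpha>
      + c * (Y powr (2 - \<alpha>) / (2 - \<alpha>)) * t powr - 2 + 2 * Bd * t powr - min \<beta> 2 \<le> 0"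
    unfolding eventually_at_top_linorder by blast
  define a where "a = max (max 3 x1) (max x2 x3)"
  define f where "f y = ennreal (ln (max 1 \<bar>y\<bar>))" for y :: real
  have [measurable]: "f \<in> borel_measurable borel" unfolding f_def by measurable
  have super: "(\<integral>\<^sup>+ y. f y \<partial>K x) \<le> f x" if x: "x \<in> X" "\<bar>x\<bar> > a" for x
  proof -
    have t: "3 \<le> \<bar>x\<bar>" "x1 \<le> \<bar>x\<bar>" "x2 \<le> \<bar>x\<bar>" "x3 \<le> \<bar>x\<bar>" using x by (auto simp: a_def)
    interpret out_law "outward_law x" \<alpha> "min \<beta> 2" c \<eta> Y Bd by (rule L[OF x(1) t(3)])
    have "(\<integral>\<^sup>+ y. f y \<partial>K x) = (\<integral>\<^sup>+ z. f (sgn x * (\<bar>x\<bar> + z)) \<partial>outward_law x)"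
      by (rule nn_integral_K_outward) (use t in auto)
    also have "\<dots> = (\<integral>\<^sup>+ z. ennreal (ln (max 1 \<bar>\<bar>x\<bar> + z\<bar>)) \<partial>outward_law x)"
      using t by (intro nn_integral_cong) (simp add: f_def abs_mult abs_sgn_eq)
    also have "\<dots> \<le> ennreal (ln \<bar>x\<bar> + (b' - (c - \<eta>) * kap \<alpha>) * \<bar>x\<bar> powr - \<alpha>
        + c * (Y powr (2 - \<alpha>) / (2 - \<alpha>)) / \<bar>x\<bar>\<^sup>2 + 2 * Bd * \<bar>x\<bar> powr - min \<beta> 2)"
      by (rule log_drift[OF t(1)]) (use m[OF x(1) t(2)] expectation_outward_law[OF x(1)] in simp)
    also have "\<dots> \<le> ennreal (ln \<bar>x\<bar>)"
    proof (rule ennreal_leI)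
      have "\<bar>x\<bar> powr - 2 = 1 / \<bar>x\<bar>\<^sup>2" using t by (simp add: powr_minus_divide)
      then show "ln \<bar>x\<bar> + (b' - (c - \<eta>) * kap \<alpha>) * \<bar>x\<bar> powr - \<alpha>
        + c * (Y powr (2 - \<alpha>) / (2 - \<alpha>)) / \<bar>x\<bar>\<^sup>2 + 2 * Bd * \<bar>x\<bar> powr - min \<beta> 2 \<le> ln \<bar>x\<bar>"
        using x3[OF t(4)] by simp
    qed
    also have "\<dots> = f x" using t by (simp add: f_def max_def)
    finally show ?thesis .
  qed
  have large: "\<exists>R. \<forall>y. \<bar>y\<bar> \<ge> R \<longrightarrow> ennreal (real k) \<le> f y" for k
  proof (intro exI[of _ "exp (real k)"] allI impI)
    fix y :: real assume y: "exp (real k) \<le> \<bar>y\<bar>"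
    then have "real k \<le> ln (max 1 \<bar>y\<bar>)" by (subst ln_ge_iff) auto
    then show "ennreal (real k) \<le> f y" unfolding f_def by (rule ennreal_leI)
  qed
  show ?thesis
  proof (intro exI[of _ a] ballI)
    fix x assume x: "x \<in> X"
    show "(INF N. kseq K (replicate N {y. \<bar>y\<bar> > a}) x) = 0"
    proof (rule never_hit_zero[where f = f, OF x N])
      show "f \<in> borel_measurable borel" by measurable
      show "f x < \<infinity>" by (simp add: f_def)
      show "(\<integral>\<^sup>+ y. f y \<partial>K x) \<le> f x" if "x \<in> X" "\<bar>x\<bar> > a" for x by (rule super[OF that])
      show "\<exists>R. \<forall>y. R \<le> \<bar>y\<bar> \<longrightarrow> ennreal (real k) \<le> f y" for k by (rule large)
    qed
  qed
qed

lemma null_recurrent_case: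
  assumes N: "cond_N' X M" and D: "drift_limit (\<alpha> - 1) b" and b: "b < c * kap \<alpha>"
  shows "null_recurrent_mc X M"
proof -
  define b' where "b' = (b + c * kap \<alpha>) / 2"
  have "0 < b' - b" using b by (simp add: b'_def)
  then obtain x1 where x1: "x1 \<ge> 1"
    "\<And>x. x \<in> X \<Longrightarrow> x1 \<le> \<bar>x\<bar> \<Longrightarrow> \<bar>\<bar>x\<bar> powr (\<alpha> - 1) * outward_drift x - b\<bar> < b' - b"
    using D unfolding drift_limit_def by meson
  have scale: "\<bar>x\<bar> powr (1 - \<alpha>) * (\<bar>x\<bar> powr (\<alpha> - 1) * outward_drift x) = outward_drift x"
    if "x1 \<le> \<bar>x\<bar>" for x
    using that x1(1) by (subst mult.assoc[symmetric], subst powr_add[symmetric]) auto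
  have "\<exists>a. \<forall>x\<in>X. (INF N. kseq K (replicate N {y. \<bar>y\<bar> > a}) x) = 0"
  proof (rule never_hit_of_drift[OF N])
    show "b' < c * kap \<alpha>" using b by (simp add: b'_def)
    fix x assume x: "x \<in> X" "x1 \<le> \<bar>x\<bar>"
    have "\<bar>x\<bar> powr (1 - \<alpha>) * (\<bar>x\<bar> powr (\<alpha> - 1) * outward_drift x) \<le> \<bar>x\<bar> powr (1 - \<alpha>) * b'"
      by (rule mult_left_mono) (use x1(2)[OF x] in auto)
    then show "outward_drift x \<le> b' * \<bar>x\<bar> powr (1 - \<alpha>)"
      unfolding scale[OF x(2)] by (simp add: mult.commute)
  qed
  then have rec: "recurrent_mc X M" by (auto intro: recurrentI)
  define b2 where "b2 = \<bar>b\<bar> + (b' - b)"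
  have b2: "0 \<le> b2" using b by (simp add: b2_def b'_def)
  have m2: "\<bar>outward_drift x\<bar> \<le> b2 * \<bar>x\<bar> powr (1 - \<alpha>)" if x: "x \<in> X" "x1 \<le> \<bar>x\<bar>" for x
  proof -
    have "\<bar>x\<bar> powr (1 - \<alpha>) * \<bar>\<bar>x\<bar> powr (\<alpha> - 1) * outward_drift x\<bar> \<le> \<bar>x\<bar> powr (1 - \<alpha>) * b2"
      by (rule mult_left_mono) (use x1(2)[OF x] in \<open>auto simp: b2_def\<close>)
    moreover have "\<bar>x\<bar> powr (1 - \<alpha>) * \<bar>\<bar>x\<bar> powr (\<alpha> - 1) * outward_drift x\<bar> = \<bar>outward_drift x\<bar>"
      using arg_cong[OF scale[OF x(2)], of abs] by (simp add: abs_mult)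
    ultimately show ?thesis by (simp only: mult.commute)
  qed
  \<comment> \<open>For the hitting time only orders of magnitude matter, so any positive tolerance
    below \<open>c\<close> serves.\<close>
  define \<eta> where "\<eta> = c / 2"
  have \<eta>: "0 < \<eta>" "\<eta> < c" using params by (auto simp: \<eta>_def)
  obtain Y Bd x2 where L: "\<And>x. x \<in> X \<Longrightarrow> x2 \<le> \<bar>x\<bar> \<Longrightarrow> out_law (outward_law x) \<alpha> (min \<beta> 2) c \<eta> Y Bd"
    using out_law_outward_law[OF T \<eta>] by blast
  define C where "C = 2 * b2 + 54 * ((c + \<eta>) * kap \<alpha> + Y\<^sup>2) + 9 * Bd"
  \<comment> \<open>Truncation with parameter \<open>e = 1 / Suc n\<close>: each \<open>f n\<close>
    is bounded by \<open>Suc n\<close>, as the hitting-time argument requires, and the functions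
    tend to \<open>\<bar>y\<bar> powr \<alpha>\<close>.\<close>
  define f where "f n y = \<bar>y\<bar> powr \<alpha> / (1 + 1 / real (Suc n) * \<bar>y\<bar> powr \<alpha>)" for n :: nat and y :: real
  have den: "1 \<le> 1 + 1 / real (Suc n) * \<bar>y\<bar> powr \<alpha>" for n and y :: real by simp
  have f_le: "f n y \<le> \<bar>y\<bar> powr \<alpha>" for n y
    unfolding f_def using den[of n y] divide_left_mono[of 1 _ "\<bar>y\<bar> powr \<alpha>"] by fastforce
  have f_bd: "f n y \<le> real (Suc n)" for n y
  proof -
    have "\<bar>y\<bar> powr \<alpha> \<le> real (Suc n) * (1 + 1 / real (Suc n) * \<bar>y\<bar> powr \<alpha>)"
      by (simp add: distrib_left del: of_nat_Suc)
    then show ?thesis unfolding f_def using den[of n y]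
      by (subst pos_divide_le_eq) (linarith, simp add: mult.commute)
  qed
  have fm [measurable]: "f n \<in> borel_measurable borel" for n unfolding f_def by measurable
  \<comment> \<open>Half of the limit is enough: as soon as \<open>n\<close> is at least
    \<open>\<bar>y\<bar> powr \<alpha>\<close>, the denominator of \<open>f n y\<close> is at most
    2.\<close>
  define g where "g y = ennreal (\<bar>y\<bar> powr \<alpha> / 2)" for y :: real
  have gm [measurable]: "g \<in> borel_measurable borel" unfolding g_def by measurable
  have g_le: "g y \<le> (SUP n. ennreal (f n y))" for y
  proof -
    obtain n where n: "\<bar>y\<bar> powr \<alpha> \<le> real n" using real_arch_simple by blast
    define d where "d = 1 + 1 / real (Suc n) * \<bar>y\<bar> powr \<alpha>"
    have "d \<le> 2" "1 \<le> d" using n den[of n y] by (auto simp: d_def)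
    then have "\<bar>y\<bar> powr \<alpha> / 2 \<le> f n y"
      unfolding f_def d_def[symmetric] by (intro divide_left_mono) auto
    then show ?thesis unfolding g_def by (intro SUP_upper2[of n] ennreal_leI) auto
  qed
  define a0 where "a0 = max (max 1 x1) x2"
  have "(\<integral>\<^sup>+ \<omega>. hit_time a \<omega> \<partial>M x) = \<infinity>" if a: "a0 \<le> a" and x: "x \<in> X" "\<bar>x\<bar> > a" for a x
  proof -
    have big: "1 \<le> \<bar>y\<bar>" "x1 \<le> \<bar>y\<bar>" "x2 \<le> \<bar>y\<bar>" if "\<bar>y\<bar> > a" for y
      using that a by (auto simp: a0_def)
    interpret Lx: out_law "outward_law x" \<alpha> "min \<beta> 2" c \<eta> Y Bd by (rule L[OF x(1) big(3)[OF x(2)]])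
    define P where "P = (c + \<eta>) * kap \<alpha> + Y\<^sup>2"
    have "0 < P" using \<eta> kap by (simp add: P_def add_pos_nonneg)
    then have C: "C > 0"
      unfolding C_def P_def[symmetric] using b2 Lx.Bd by linarith
    show ?thesis
    proof (rule hit_time_infinite[where f = f and g = g and C = "ennreal C" and s = "ennreal (a powr \<alpha>)", OF x])
      show "ennreal C < \<infinity>" "ennreal C \<noteq> 0" "ennreal (a powr \<alpha>) < \<infinity>" using C by auto
      show "\<exists>b<\<infinity>. \<forall>y. ennreal (f n y) \<le> b" for n
        by (rule exI[of _ "ennreal (real (Suc n))"]) (intro conjI allI ennreal_leI f_bd, simp)
      show "ennreal (f n y) \<le> (\<integral>\<^sup>+ z. ennreal (f n z) \<partial>K y) + ennreal C" if y: "y \<in> X" "\<bar>y\<bar> > a" for n y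
      proof -
        interpret out_law "outward_law y" \<alpha> "min \<beta> 2" c \<eta> Y Bd by (rule L[OF y(1) big(3)[OF y(2)]])
        have "y \<noteq> 0" using big(1)[OF y(2)] by auto
        then have "(\<integral>\<^sup>+ z. ennreal (f n z) \<partial>K y) = (\<integral>\<^sup>+ z. ennreal (f n (sgn y * (\<bar>y\<bar> + z))) \<partial>outward_law y)"
          by (rule nn_integral_K_outward) measurable
        also have "\<dots> = (\<integral>\<^sup>+ z. ennreal (f n (\<bar>y\<bar> + z)) \<partial>outward_law y)"
          using \<open>y \<noteq> 0\<close> by (intro nn_integral_cong) (simp add: f_def abs_mult abs_sgn_eq)
        finally have e: "(\<integral>\<^sup>+ z. ennreal (f n z) \<partial>K y) = (\<integral>\<^sup>+ z. ennreal (f n (\<bar>y\<bar> + z)) \<partial>outward_law y)" .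
        have "\<bar>expectation (\<lambda>z. z)\<bar> \<le> b2 * \<bar>y\<bar> powr (1 - \<alpha>)"
          using m2[OF y(1) big(2)[OF y(2)]] expectation_outward_law[OF y(1)] by simp
        from truncated_powr_drift[OF big(1)[OF y(2)] _ this b2, of "1 / real (Suc n)"]
        have "ennreal (f n \<bar>y\<bar>) \<le> (\<integral>\<^sup>+ z. ennreal (f n (\<bar>y\<bar> + z)) \<partial>outward_law y) + ennreal C"
          unfolding f_def C_def by simp
        then show ?thesis unfolding e by (simp add: f_def)
      qed
      show "ennreal (f n y) \<le> ennreal (a powr \<alpha>)" if "\<bar>y\<bar> \<le> a" for n y
      proof (rule ennreal_leI)
        have "\<bar>y\<bar> powr \<alpha> \<le> a powr \<alpha>" using that params by (intro powr_mono2) auto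
        then show "f n y \<le> a powr \<alpha>" using f_le[of n y] by linarith
      qed
      have "x \<noteq> 0" using big(1)[OF x(2)] by auto
      \<comment> \<open>The outward part of the jump suffices: after an outward jump the distance
        from the origin is at least the size of the jump.\<close>
      have "\<infinity> = (\<integral>\<^sup>+ z. ennreal (1 / 2) * ennreal (max 0 z powr \<alpha>) \<partial>outward_law x)"
        by (subst nn_integral_cmult) (auto simp: Lx.infinite_moment ennreal_mult_top)
      also have "\<dots> \<le> (\<integral>\<^sup>+ z. g (sgn x * (\<bar>x\<bar> + z)) \<partial>outward_law x)"
      proof (rule nn_integral_mono)
        fix z
        have "max 0 z powr \<alpha> \<le> \<bar>\<bar>x\<bar> + z\<bar> powr \<alpha>"
          using params by (cases "z \<ge> 0") (auto intro!: powr_mono2)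
        then have "1 / 2 * max 0 z powr \<alpha> \<le> \<bar>sgn x * (\<bar>x\<bar> + z)\<bar> powr \<alpha> / 2"
          using \<open>x \<noteq> 0\<close> by (simp add: abs_mult abs_sgn_eq)
        then show "ennreal (1 / 2) * ennreal (max 0 z powr \<alpha>) \<le> g (sgn x * (\<bar>x\<bar> + z))"
          unfolding g_def by (subst ennreal_mult'[symmetric]) (auto intro: ennreal_leI)
      qed
      also have "\<dots> = (\<integral>\<^sup>+ y. g y \<partial>K x)"
        by (rule nn_integral_K_outward[symmetric, OF \<open>x \<noteq> 0\<close> gm])
      finally show "(\<integral>\<^sup>+ y. g y \<partial>K x) = \<infinity>" by (simp add: top_unique)
    qed (use g_le fm gm in auto)
  qed
  then show ?thesis using rec unfolding null_recurrent_mc_def by blast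
qed

lemma positive_recurrent_case:
  assumes D: "drift_limit \<gamma> b" and \<gamma>: "0 \<le> \<gamma>" "\<gamma> < \<alpha> - 1" and b: "b < 0"
  shows "positive_recurrent_mc X M"
proof -
  \<comment> \<open>With this exponent the linear term is
    \<open>p * \<bar>x\<bar> powr \<gamma> * outward_drift x\<close>, which tends to
    \<open>p * b < 0\<close>.\<close>
  define p where "p = 1 + \<gamma>"
  define q where "q = (p + \<alpha>) / 2"
  have pq: "1 \<le> p" "p \<le> q" "q < \<alpha>" "p - q < 0" using \<gamma> by (auto simp: p_def q_def)
  obtain x1 where x1: "x1 \<ge> 1"
    "\<And>x. x \<in> X \<Longrightarrow> x1 \<le> \<bar>x\<bar> \<Longrightarrow> \<bar>\<bar>x\<bar> powr \<gamma> * outward_drift x - b\<bar> < - b / 2"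
    using D b unfolding drift_limit_def by (meson divide_pos_pos neg_0_less_iff_less zero_less_numeral)
  define \<eta> where "\<eta> = c / 2"
  have \<eta>: "0 < \<eta>" "\<eta> < c" using params by (auto simp: \<eta>_def)
  obtain Y Bd x2 where L: "\<And>x. x \<in> X \<Longrightarrow> x2 \<le> \<bar>x\<bar> \<Longrightarrow> out_law (outward_law x) \<alpha> (min \<beta> 2) c \<eta> Y Bd"
    using out_law_outward_law[OF T \<eta>] by blast
  define C where "C = 4 * (out_law.pos_moment_bound \<alpha> c \<eta> Y q + 1 + Bd)"
  \<comment> \<open>The linear term is at most \<open>b / 2 = - 2 * \<delta>\<close> and the error
    is below \<delta>, which leaves a drift of at most \<open>- \<delta>\<close>. The factor
    \<open>1 / \<delta>\<close> in \<open>f\<close> normalises it to the unit that Foster's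
    criterion asks for.\<close>
  define \<delta> where "\<delta> = - b / 4"
  have \<delta>: "0 < \<delta>" using b by (simp add: \<delta>_def)
  obtain x3 where x3: "x3 \<ge> 1" "\<And>t. t \<ge> x3 \<Longrightarrow> C * t powr (p - q) < \<delta>"
    using eventually_powr_small[OF pq(4) \<delta>, of C] by blast
  \<comment> \<open>Including \<delta> gives \<open>\<delta> \<le> \<bar>x\<bar> powr p\<close>, so
    that the reduced value is nonnegative and passes faithfully to \<open>ennreal\<close>.\<close>
  define a where "a = max (max x1 x2) (max x3 \<delta>)"
  define f where "f y = ennreal (\<bar>y\<bar> powr p / \<delta>)" for y :: real
  have [measurable]: "f \<in> borel_measurable borel" unfolding f_def by measurable
  show ?thesis
  proof (rule positive_recurrentI[where f = f and a = a])
    fix x assume x: "x \<in> X" "\<bar>x\<bar> > a"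
    then have t: "x1 \<le> \<bar>x\<bar>" "x2 \<le> \<bar>x\<bar>" "x3 \<le> \<bar>x\<bar>" "\<delta> \<le> \<bar>x\<bar>" "1 \<le> \<bar>x\<bar>" using x1 by (auto simp: a_def)
    have x0: "x \<noteq> 0" "0 < \<bar>x\<bar>" using t by auto
    interpret out_law "outward_law x" \<alpha> "min \<beta> 2" c \<eta> Y Bd by (rule L[OF x(1) t(2)])
    have "\<bar>x\<bar> powr (p - 1) * expectation (\<lambda>z. z) \<le> b / 2"
      using x1(2)[OF x(1) t(1)] expectation_outward_law[OF x(1)] by (simp add: p_def)
    then have "p * (\<bar>x\<bar> powr (p - 1) * expectation (\<lambda>z. z)) \<le> p * (b / 2)"
      using pq(1) by (intro mult_left_mono) auto
    also have "\<dots> \<le> 1 * (b / 2)" using pq(1) b by (intro mult_right_mono_neg) auto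
    finally have "p * (\<bar>x\<bar> powr (p - 1) * expectation (\<lambda>z. z)) \<le> 1 * (b / 2)" .
    moreover have "4 * \<bar>x\<bar> powr (p - q) * (pos_moment_bound q + 1 + Bd) < \<delta>"
      using x3(2)[OF t(3)] by (simp add: C_def algebra_simps)
    ultimately have le: "\<bar>x\<bar> powr p + p * \<bar>x\<bar> powr (p - 1) * expectation (\<lambda>z. z)
        + 4 * \<bar>x\<bar> powr (p - q) * (pos_moment_bound q + 1 + Bd) \<le> \<bar>x\<bar> powr p - \<delta>"
      unfolding \<delta>_def mult.assoc by linarith
    have "\<bar>x\<bar> powr 1 \<le> \<bar>x\<bar> powr p" using t pq by (intro powr_mono) auto
    then have ge: "\<delta> \<le> \<bar>x\<bar> powr p" using t by simp
    have "(\<integral>\<^sup>+ y. ennreal (\<bar>y\<bar> powr p) \<partial>K x) = (\<integral>\<^sup>+ z. ennreal (\<bar>sgn x * (\<bar>x\<bar> + z)\<bar> powr p) \<partial>outward_law x)"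
      by (rule nn_integral_K_outward[OF x0(1)]) measurable
    also have "\<dots> = (\<integral>\<^sup>+ z. ennreal (\<bar>\<bar>x\<bar> + z\<bar> powr p) \<partial>outward_law x)"
      using x0 by (intro nn_integral_cong) (simp add: abs_mult abs_sgn_eq)
    also have "\<dots> \<le> ennreal (\<bar>x\<bar> powr p - \<delta>)"
      by (rule order_trans[OF powr_drift[OF x0(2) pq(1-3)]]) (rule ennreal_leI[OF le])
    finally have *: "(\<integral>\<^sup>+ y. ennreal (\<bar>y\<bar> powr p) \<partial>K x) \<le> ennreal (\<bar>x\<bar> powr p - \<delta>)" .
    have "(\<integral>\<^sup>+ y. f y \<partial>K x) = (\<integral>\<^sup>+ y. ennreal (1 / \<delta>) * ennreal (\<bar>y\<bar> powr p) \<partial>K x)"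
      unfolding f_def using \<delta> by (simp add: ennreal_mult'[symmetric])
    also have "\<dots> = ennreal (1 / \<delta>) * (\<integral>\<^sup>+ y. ennreal (\<bar>y\<bar> powr p) \<partial>K x)"
      by (rule nn_integral_cmult) measurable
    also have "\<dots> \<le> ennreal (1 / \<delta>) * ennreal (\<bar>x\<bar> powr p - \<delta>)" by (rule mult_left_mono[OF *]) simp
    also have "\<dots> = ennreal (\<bar>x\<bar> powr p / \<delta> - 1)"
      using \<delta> by (subst ennreal_mult'[symmetric]) (auto simp: diff_divide_distrib)
    finally have "1 + (\<integral>\<^sup>+ y. f y \<partial>K x) \<le> 1 + ennreal (\<bar>x\<bar> powr p / \<delta> - 1)" by (rule add_left_mono)
    also have "\<dots> = f x"
      unfolding f_def using ge \<delta> by (subst ennreal_1[symmetric], subst ennreal_plus[symmetric]) auto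
    finally show "1 + (\<integral>\<^sup>+ y. f y \<partial>K x) \<le> f x" .
  qed (auto simp: f_def)
qed

lemma directional_transient_case:
  assumes N: "cond_N' X M" and b': "c * kap \<alpha> < b'"
    and m: "\<And>x. x \<in> X \<Longrightarrow> x1 \<le> \<bar>x\<bar> \<Longrightarrow> b' * \<bar>x\<bar> powr (1 - \<alpha>) \<le> outward_drift x"
  shows "directional_transient_mc X M"
proof -
  define \<eta> where "\<eta> = min (c / 2) ((b' - c * kap \<alpha>) / (2 * kap \<alpha>))"
  have \<eta>: "0 < \<eta>" "\<eta> < c" using params kap b' by (auto simp: \<eta>_def)
  have "\<eta> * kap \<alpha> \<le> (b' - c * kap \<alpha>) / (2 * kap \<alpha>) * kap \<alpha>"
    using kap by (intro mult_right_mono) (auto simp: \<eta>_def)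
  also have "\<dots> = (b' - c * kap \<alpha>) / 2" using kap by simp
  finally have q: "(c + \<eta>) * kap \<alpha> < b'" using b' by (simp add: algebra_simps)
  define q where "q = (c + \<eta>) * kap \<alpha>"
  have q0: "0 < q" "q < b'" using \<eta> params kap q by (auto simp: q_def)
  \<comment> \<open>Three constraints: \<open>\<nu> \<le> 1\<close> for the pointwise bound;
    \<open>\<alpha> + \<nu> < min \<beta> 2\<close>, since the inward error lacks the factor
    \<open>t powr - \<nu>\<close> and must still be of smaller order; and
    \<open>(1 + \<nu>) * q < b'\<close>, so that the positive drift survives the second-order
    factor.\<close>
  define \<nu> where "\<nu> = min (min 1 ((min \<beta> 2 - \<alpha>) / 2)) ((b' - q) / (2 * q))"
  have "\<nu> \<le> (min \<beta> 2 - \<alpha>) / 2"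
    unfolding \<nu>_def by (rule min.coboundedI1) (rule min.cobounded2)
  moreover have "0 < (min \<beta> 2 - \<alpha>) / 2" "0 < (b' - q) / (2 * q)" using params q0 by auto
  ultimately have \<nu>: "0 < \<nu>" "\<nu> \<le> 1" "\<alpha> + \<nu> < min \<beta> 2"
    by (auto simp: \<nu>_def)
  have "\<nu> * q \<le> (b' - q) / (2 * q) * q" using q0 by (intro mult_right_mono) (auto simp: \<nu>_def)
  also have "\<dots> = (b' - q) / 2" using q0 by simp
  finally have "(1 + \<nu>) * (c + \<eta>) * kap \<alpha> - b' < 0"
    using q0 by (simp add: q_def algebra_simps)
  then have D: "\<nu> * ((1 + \<nu>) * (c + \<eta>) * kap \<alpha> - b') < 0" using \<nu> by (simp add: mult_pos_neg)
  obtain Y Bd x2 where L: "\<And>x. x \<in> X \<Longrightarrow> x2 \<le> \<bar>x\<bar> \<Longrightarrow> out_law (outward_law x) \<alpha> (min \<beta> 2) c \<eta> Y Bd"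
    using out_law_outward_law[OF T \<eta>] by blast
  have "eventually (\<lambda>t. \<nu> * ((1 + \<nu>) * (c + \<eta>) * kap \<alpha> - b') * t powr - (\<alpha> + \<nu>)
      + (\<nu> * (1 + \<nu>) * Y\<^sup>2) * t powr - (2 + \<nu>) + 8 * Bd * t powr - min \<beta> 2 \<le> 0) at_top"
    by (rule eventually_dominated[OF D]) (use params \<nu> in auto)
  then obtain x3 where x3: "\<And>t. x3 \<le> t \<Longrightarrow> \<nu> * ((1 + \<nu>) * (c + \<eta>) * kap \<alpha> - b') * t powr - (\<alpha> + \<nu>)
      + (\<nu> * (1 + \<nu>) * Y\<^sup>2) * t powr - (2 + \<nu>) + 8 * Bd * t powr - min \<beta> 2 \<le> 0"
    unfolding eventually_at_top_linorder by blast
  define a where "a = max (max 2 x1) (max x2 x3)"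
  define F where "F y = (if y \<ge> 1 then y powr - \<nu> else 1)" for y :: real
  have [measurable]: "F \<in> borel_measurable borel" unfolding F_def by measurable
  have super: "(\<integral>\<^sup>+ y. ennreal (F (sgn x * y)) \<partial>K x) \<le> ennreal (F \<bar>x\<bar>)" if x: "x \<in> X" "a \<le> \<bar>x\<bar>" for x
  proof -
    have t: "2 \<le> \<bar>x\<bar>" "x1 \<le> \<bar>x\<bar>" "x2 \<le> \<bar>x\<bar>" "x3 \<le> \<bar>x\<bar>" using x by (auto simp: a_def)
    have x0: "x \<noteq> 0" using t by auto
    interpret out_law "outward_law x" \<alpha> "min \<beta> 2" c \<eta> Y Bd by (rule L[OF x(1) t(3)])
    have "(\<integral>\<^sup>+ y. ennreal (F (sgn x * y)) \<partial>K x) = (\<integral>\<^sup>+ z. ennreal (F (sgn x * (sgn x * (\<bar>x\<bar> + z)))) \<partial>outward_law x)"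
      by (rule nn_integral_K_outward[OF x0]) measurable
    also have "\<dots> = (\<integral>\<^sup>+ z. ennreal (if \<bar>x\<bar> + z \<ge> 1 then (\<bar>x\<bar> + z) powr - \<nu> else 1) \<partial>outward_law x)"
    proof (rule nn_integral_cong)
      fix z
      have "sgn x * (sgn x * (\<bar>x\<bar> + z)) = \<bar>x\<bar> + z" using x0 by (cases "x > 0") auto
      then show "ennreal (F (sgn x * (sgn x * (\<bar>x\<bar> + z))))
        = ennreal (if \<bar>x\<bar> + z \<ge> 1 then (\<bar>x\<bar> + z) powr - \<nu> else 1)" by (simp only: F_def)
    qed
    also have "\<dots> \<le> ennreal (\<bar>x\<bar> powr - \<nu> * (1 + \<nu> * ((1 + \<nu>) * (c + \<eta>) * kap \<alpha> - b') * \<bar>x\<bar> powr - \<alpha>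
        + \<nu> * (1 + \<nu>) * (Y\<^sup>2 / \<bar>x\<bar>\<^sup>2)) + 8 * Bd * \<bar>x\<bar> powr - min \<beta> 2)"
      by (rule negative_powr_drift[OF t(1)]) (use \<nu> m[OF x(1) t(2)] expectation_outward_law[OF x(1)] in auto)
    also have "\<dots> \<le> ennreal (\<bar>x\<bar> powr - \<nu>)"
    proof (rule ennreal_leI)
      have "\<bar>x\<bar> powr - (\<alpha> + \<nu>) = \<bar>x\<bar> powr - \<nu> * \<bar>x\<bar> powr - \<alpha>"
        by (simp add: add.commute flip: powr_add)
      moreover have "\<bar>x\<bar> powr - (2 + \<nu>) = \<bar>x\<bar> powr - \<nu> * (1 / \<bar>x\<bar>\<^sup>2)"
      proof -
        have "\<bar>x\<bar> powr - (2 + \<nu>) = \<bar>x\<bar> powr - \<nu> * \<bar>x\<bar> powr - 2"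
          by (subst powr_add[symmetric], rule arg_cong[where f = "\<lambda>s. \<bar>x\<bar> powr s"]) simp
        also have "\<bar>x\<bar> powr - 2 = 1 / \<bar>x\<bar>\<^sup>2" using t by (simp add: powr_minus_divide)
        finally show ?thesis .
      qed
      ultimately show "\<bar>x\<bar> powr - \<nu> * (1 + \<nu> * ((1 + \<nu>) * (c + \<eta>) * kap \<alpha> - b') * \<bar>x\<bar> powr - \<alpha>
        + \<nu> * (1 + \<nu>) * (Y\<^sup>2 / \<bar>x\<bar>\<^sup>2)) + 8 * Bd * \<bar>x\<bar> powr - min \<beta> 2 \<le> \<bar>x\<bar> powr - \<nu>"
        using x3[OF t(4)] by (simp add: algebra_simps add_divide_distrib)
    qed
    also have "\<bar>x\<bar> powr - \<nu> = F \<bar>x\<bar>" using t by (simp add: F_def)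
    finally show ?thesis .
  qed
  have F_small: "\<exists>t0\<ge>1. \<forall>t\<ge>t0. F t \<le> e" if "0 < e" for e
    using eventually_powr_small[of "- \<nu>" e 1] \<nu> that by (fastforce simp: F_def)
  have F_mono: "F s \<le> F t" if "1 \<le> s" "t \<le> s" for s t
    using that \<nu> powr_mono[of "- \<nu>" 0 s] by (auto simp: F_def intro!: powr_mono2')
  show ?thesis
  proof (rule directional_transientI[OF N])
    fix r e :: real assume e: "0 < e"
    \<comment> \<open>The supermartingale property holds from distance \<open>a\<close> on, so the
      level is first raised to at least \<open>a\<close>; the return to \<open>r\<close> is by
      monotonicity of \<open>kseq\<close> in the sets.\<close>
    define r' where "r' = max r a"
    have r': "r \<le> r'" "a \<le> r'" "2 \<le> r'" by (auto simp: r'_def a_def)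
    have F0: "0 < F r'" using r' by (simp add: F_def)
    obtain t0 where t0: "\<And>t. t \<ge> t0 \<Longrightarrow> F t \<le> e * F r'"
      using F_small[of "e * F r'"] e F0 by auto
    \<comment> \<open>From distance \<open>R\<close> on, \<open>F\<close> is at most
      \<open>e * F r'\<close>, so the probability of ever coming back below level \<open>r'\<close>
      on that side is at most \<open>e\<close>.\<close>
    define R where "R = max t0 (r' + 1)"
    have stay: "ennreal (1 - e) \<le> kseq K (replicate N A) x"
      if x: "x \<in> X" "\<bar>x\<bar> \<ge> R" and s: "s = sgn x" and A: "A = {y. r' \<le> s * y}" for x N A s
    proof (rule stay_lower[where f = "\<lambda>y. ennreal (F (s * y))" and \<rho> = "F r'", OF _ x(1)])
      have s1: "s = 1 \<or> s = -1" using x r' by (auto simp: s R_def sgn_if)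
      show "A \<in> sets borel" unfolding A by measurable
      show "(\<integral>\<^sup>+ z. ennreal (F (s * z)) \<partial>K y) \<le> ennreal (F (s * y))" if y: "y \<in> X" "y \<in> A" for y
      proof -
        have "sgn y = s" "s * y = \<bar>y\<bar>" using s1 y r' by (auto simp: A)
        then show ?thesis using super[OF y(1)] y(2) r' by (simp add: A)
      qed
      show "ennreal (F r') \<le> ennreal (F (s * y))" if "y \<notin> A" for y
        using that r' by (intro ennreal_leI F_mono) (auto simp: A)
      have "s * x = \<bar>x\<bar>" by (simp add: s abs_sgn mult.commute)
      then show "ennreal (F (s * x)) \<le> ennreal (e * F r')"
        using t0[of "\<bar>x\<bar>"] x by (intro ennreal_leI) (auto simp: R_def)
    qed (use F0 e in auto)
    have mono: "kseq K (replicate N A) x \<le> kseq K (replicate N A') x" if "A \<subseteq> A'" for A A' N x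
    proof (induction N arbitrary: x)
      case (Suc N)
      have "(\<integral>\<^sup>+ y. kseq K (replicate N A) y \<partial>K x) \<le> (\<integral>\<^sup>+ y. kseq K (replicate N A') y \<partial>K x)"
        by (intro nn_integral_mono Suc)
      then show ?case using that by (auto simp: indicator_def)
    qed simp
    show "\<exists>R>r. \<forall>x\<in>X. (R \<le> x \<longrightarrow> (\<forall>N. ennreal (1 - e) \<le> kseq K (replicate N {r..}) x)) \<and>
      (x \<le> - R \<longrightarrow> (\<forall>N. ennreal (1 - e) \<le> kseq K (replicate N {..-r}) x))"
    proof (intro exI[of _ R] conjI ballI impI allI)
      show "r < R" using r' by (simp add: R_def)
      have R0: "0 < R" using r' by (simp add: R_def)
      fix x N assume x: "x \<in> X"
      show "ennreal (1 - e) \<le> kseq K (replicate N {r..}) x" if "R \<le> x"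
      proof -
        have "ennreal (1 - e) \<le> kseq K (replicate N {y. r' \<le> 1 * y}) x"
          by (rule stay[OF x _ _ refl]) (use that R0 in auto)
        also have "\<dots> \<le> kseq K (replicate N {r..}) x" by (rule mono) (use r' in auto)
        finally show ?thesis .
      qed
      show "ennreal (1 - e) \<le> kseq K (replicate N {..-r}) x" if "x \<le> - R"
      proof -
        have "ennreal (1 - e) \<le> kseq K (replicate N {y. r' \<le> - 1 * y}) x"
          by (rule stay[OF x _ _ refl]) (use that R0 in auto)
        also have "\<dots> \<le> kseq K (replicate N {..-r}) x" by (rule mono) (use r' in auto)
        finally show ?thesis .
      qed
    qed
  qed
qed

lemma directional_transient_supercritical:
  assumes N: "cond_N' X M" and D: "drift_limit \<gamma> b"
    and b: "\<gamma> = \<alpha> - 1 \<and> c * kap \<alpha> < b \<or> \<gamma> < \<alpha> - 1 \<and> 0 < b"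
  shows "directional_transient_mc X M"
proof -
  have ck: "0 < c * kap \<alpha>" using params kap by simp
  have b0: "0 < b" using b ck by auto
  \<comment> \<open>At the critical exponent both \<open>b'\<close> and \<open>d\<close> are the
    midpoint between the critical value and \<open>b\<close>. Below it
    \<open>t powr (\<gamma> - (\<alpha> - 1))\<close> tends to 0, so a fixed \<open>b'\<close> above
    the critical value is eventually outweighed by the drift.\<close>
  obtain b' d t0 where *: "c * kap \<alpha> < b'" "0 < d" "d < b" "\<And>t. t0 \<le> t \<Longrightarrow> b' * t powr (\<gamma> - (\<alpha> - 1)) \<le> d" "1 \<le> t0"
  proof (cases "\<gamma> = \<alpha> - 1")
    case True
    show ?thesis
      by (rule that[of "(c * kap \<alpha> + b) / 2" "(c * kap \<alpha> + b) / 2" 1])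
        (use True b ck powr_zero_eq_one in \<open>auto split: if_splits\<close>)
  next
    case False
    then obtain t0 where t0: "t0 \<ge> 1" "\<And>t. t \<ge> t0 \<Longrightarrow> (c * kap \<alpha> + 1) * t powr (\<gamma> - (\<alpha> - 1)) < b / 2"
      using eventually_powr_small[of "\<gamma> - (\<alpha> - 1)" "b / 2" "c * kap \<alpha> + 1"] b b0 by auto
    show ?thesis
      by (rule that[of "c * kap \<alpha> + 1" "b / 2" t0]) (use t0 b0 in \<open>auto intro: less_imp_le\<close>)
  qed
  obtain x1 where x1: "x1 \<ge> 1"
    "\<And>x. x \<in> X \<Longrightarrow> x1 \<le> \<bar>x\<bar> \<Longrightarrow> \<bar>\<bar>x\<bar> powr \<gamma> * outward_drift x - b\<bar> < b - d"
    using D *(3) unfolding drift_limit_def by (meson diff_gt_0_iff_gt)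
  show ?thesis
  proof (rule directional_transient_case[OF N *(1)])
    fix x assume x: "x \<in> X" "max t0 x1 \<le> \<bar>x\<bar>"
    have "b' * \<bar>x\<bar> powr (\<gamma> - (\<alpha> - 1)) \<le> \<bar>x\<bar> powr \<gamma> * outward_drift x"
      using *(4)[of "\<bar>x\<bar>"] x1(2)[of x] x by auto
    then have "\<bar>x\<bar> powr - \<gamma> * (b' * \<bar>x\<bar> powr (\<gamma> - (\<alpha> - 1))) \<le> \<bar>x\<bar> powr - \<gamma> * (\<bar>x\<bar> powr \<gamma> * outward_drift x)"
      by (rule mult_left_mono) simp
    moreover have "\<bar>x\<bar> powr - \<gamma> * (b' * \<bar>x\<bar> powr (\<gamma> - (\<alpha> - 1))) = b' * \<bar>x\<bar> powr (1 - \<alpha>)"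
      by (subst mult.left_commute, subst powr_add[symmetric]) simp
    moreover have "\<bar>x\<bar> powr - \<gamma> * (\<bar>x\<bar> powr \<gamma> * outward_drift x) = outward_drift x"
      using x x1(1) by (subst mult.assoc[symmetric], subst powr_add[symmetric]) auto
    ultimately show "b' * \<bar>x\<bar> powr (1 - \<alpha>) \<le> outward_drift x" by simp
  qed
qed

end

theorem theorem2p3:
  fixes X :: "real set" and K :: "real \<Rightarrow> real measure" and M :: "real \<Rightarrow> real stream measure"
    and \<alpha> \<beta> c x0 \<gamma> b :: real
  assumes mc: "markov_chain X K M"
    and N: "cond_N' X M"
    and T: "cond_T_out X M \<alpha> \<beta> c x0"
    and D: "cond_D' X M \<gamma> b"
  shows "(\<gamma> > \<alpha> - 1 \<longrightarrow> null_recurrent_mc X M)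
       \<and> (\<gamma> < \<alpha> - 1 \<and> b < 0 \<longrightarrow> positive_recurrent_mc X M)
       \<and> (\<gamma> < \<alpha> - 1 \<and> b > 0 \<longrightarrow> directional_transient_mc X M)
       \<and> (\<gamma> = \<alpha> - 1 \<and> b < c * pi * \<bar>1 / sin (pi * \<alpha>)\<bar> \<longrightarrow> null_recurrent_mc X M)
       \<and> (\<gamma> = \<alpha> - 1 \<and> b > c * pi * \<bar>1 / sin (pi * \<alpha>)\<bar> \<longrightarrow> directional_transient_mc X M)"
proof -
  interpret out_chain X K M \<alpha> \<beta> c x0
    by unfold_locales fact+
  have DL: "drift_limit \<gamma> b" by (rule drift_limit_cond[OF D])
  have \<gamma>0: "0 \<le> \<gamma>" using D by (simp add: cond_D'_def)
  have ck: "c * pi * \<bar>1 / sin (pi * \<alpha>)\<bar> = c * kap \<alpha>" by (simp add: kap_def)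
  have "0 < c * kap \<alpha>" using params kap by simp
  then have "null_recurrent_mc X M" if "\<gamma> > \<alpha> - 1"
    using null_recurrent_case[OF N drift_limit_lower_exponent[OF DL that]] by simp
  then show ?thesis
    unfolding ck
    using null_recurrent_case[OF N] positive_recurrent_case[OF DL \<gamma>0]
      directional_transient_supercritical[OF N DL] DL by blast
qed

end
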